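(* Let $K$ be a field, let $f(x)\in K[x]$ be a polynomial of degree $d\ge 2$, and let $\alpha\in K$. Assume that for every $n\ge 1$ the polynomial $f^n(x)-\alpha$ has $d^n$ distinct roots in an algebraic closure of $K$ and is irreducible over $K$ (where $f^n$ is the $n$-th iterate of $f$). Let $T$ be the $d$-ary rooted tree of iterated preimages of $\alpha$ under $f$, let $\mathcal P_d$ be its space of infinite paths, let $H_\infty\subseteq \mathrm{Aut}(T)$ be the image of the arboreal representation $\rho_{f,\alpha}$, and let $\mathbf v=(v_n)_{n\ge 0}\in\mathcal P_d$ be a path. Then there exist a countably generated discrete group $G$ and a group homomorphism $\Phi: G\to \mathrm{Homeo}(\mathcal P_d)$ such that the following hold. (1) There is an isomorphism (of topological groups) $\widetilde\phi:\overline{\Phi(G)}\to H_\infty$ of the Ellis group $\overline{\Phi(G)}\subset \mathrm{Homeo}(\mathcal P_d)$ of the action $\Phi$ onto $H_\infty$. (2) There is a descending chain $G=G_0\supset G_1\supset G_2\supset\cdots$ of subgroups of finite index in $G$ and a homeomorphism of Cantor sets $$\phi: G_\infty=\varprojlim\{G/G_{n+1}\to G/G_n\}\to\mathcal P_d$$ with $\phi(\mathbf e)=\mathbf v$, where $\mathbf e=(eG_n)_{n\ge0}$ is the sequence of cosets of the identity, such that for all $\mathbf u\in G_\infty$ and all $\mathbf g\in\overline{\Phi(G)}$ $$\widetilde\phi(\mathbf g)\cdot\phi(\mathbf u)=\phi(\mathbf g(\mathbf u)).$$ Here $\cdot$ is the action of $H_\infty\subseteq\mathrm{Aut}(T)$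 on $\mathcal P_d$, and $\mathbf g(\mathbf u)$ denotes the action of the Ellis group on $G_\infty$, i.e. the continuous action of $\overline{\Phi(G)}$ on $G_\infty$ in which $\Phi(h)$, $h\in G$, acts as left multiplication by $h$.
   Context: Tree of preimages. Put $V_0=\{\alpha\}$ and $V_n=f^{-n}(\alpha)$ for $n\ge 1$, the set of solutions of $f^n(x)=\alpha$ in a separable closure $K^{\rm sep}$ of $K$. The tree $T$ has vertex set $\bigsqcup_{n\ge0}V_n$, and $b\in V_{n+1}$ is joined by an edge to $c\in V_n$ if and only if $f(b)=c$. Under the assumptions $|V_n|=d^n$, and every vertex of $V_n$ is joined to exactly $d$ vertices of $V_{n+1}$, so $T$ is a $d$-ary rooted tree. $\mathrm{Aut}(T)$ is the group of automorphisms of the rooted tree. Path space. $\mathcal P_d\subset\prod_{n\ge0}V_n$ is the set of sequences $(v_n)_{n\ge0}$ with $v_n\in V_n$ and $v_n,v_{n+1}$ joined by an edge for all $n$, with the topology induced by the product of the discrete topologies; it is a Cantor set. $\mathrm{Aut}(T)$ acts on $\mathcal P_d$ by homeomorphisms. Arboreal representation. $\mathrm{Gal}(K^{\rm sep}/K)$ acts on each $V_n$ by permutations compatibly with the edges of $T$. Let $H_n$ be its image in the automorphism group of the finite subtree $T_n$ with vertices $V_0\cup\dots\cup V_n$ (so $H_n\cong\mathrm{Gal}(K(f^{-n}(\alpha))/K)$). This gives the homomorphism $\rho_{f,\alpha}:\mathrm{Gal}(K^{\rm sep}/K)\to H_\infty=\varprojlim\{H_{n+1}\to H_n\}\subseteq\mathrm{Aut}(T)$,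 a closed subgroup of the profinite group $\mathrm{Aut}(T)=\varprojlim \mathrm{Aut}(T_n)$; $H_\infty$ is its image. Ellis group. For an equicontinuous action $\Phi:G\to\mathrm{Homeo}(X)$ on a Cantor set $X$, the Ellis (enveloping) group is the closure $\overline{\Phi(G)}$ of $\Phi(G)$ in $\mathrm{Homeo}(X)$ in the uniform topology; it is a profinite group acting on $X$ by homeomorphisms. Group chains. For a descending chain $\{G_n\}_{n\ge0}$ of finite index subgroups with $G_0=G$, the bonding maps $G/G_{n+1}\to G/G_n$ are $gG_{n+1}\mapsto gG_n$, the $G/G_n$ are discrete, and $G$ acts on $G_\infty$ by left multiplication: $g\cdot(g_0G_0,g_1G_1,\dots)=(gg_0G_0,gg_1G_1,\dots)$. *)

theory Defs
  imports
    "HOL-Analysis.Analysis"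
    "HOL-Algebra.Left_Coset"
    "HOL-Algebra.Group_Action"
    "HOL-Algebra.Generated_Groups"
    "HOL-Algebra.Algebraic_Closure_Type"
begin

section \<open>Separable closure and absolute Galois group\<close>

text \<open>The separable closure of the field \<open>'k\<close> inside the algebraic closure of the library: the
  elements whose minimal polynomial has only simple roots in the algebraic closure.\<close>

definition sep_closure :: "'k::field alg_closure set" where
  "sep_closure = {x. \<exists>p :: 'k poly. Factorial_Ring.irreducible p \<and> poly (map_poly to_ac p) x = 0
                       \<and> rsquarefree (map_poly to_ac p)}"

text \<open>As everywhere in \<^const>\<open>BijGroup\<close>, maps are extensional, i.e. \<^term>\<open>undefined\<close> outside
  the set on which they act.\<close>

definition abs_galois_group :: "('k::field alg_closure \<Rightarrow> 'k alg_closure) monoid" where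
  "abs_galois_group = (BijGroup sep_closure)\<lparr>carrier :=
     {\<tau> \<in> Bij sep_closure.
        (\<forall>x\<in>sep_closure. \<forall>y\<in>sep_closure. \<tau> (x + y) = \<tau> x + \<tau> y \<and> \<tau> (x * y) = \<tau> x * \<tau> y) \<and>
        (\<forall>c. \<tau> (to_ac c) = to_ac c)}\<rparr>"


section \<open>The tree of preimages\<close>

definition poly_iter :: "'a::comm_semiring_1 poly \<Rightarrow> nat \<Rightarrow> 'a poly" where
  "poly_iter f n = (pcompose f ^^ n) [:0, 1:]"

definition preimages :: "'k::field poly \<Rightarrow> 'k \<Rightarrow> nat \<Rightarrow> 'k alg_closure set" where
  "preimages f \<alpha> n = {x \<in> sep_closure. poly (map_poly to_ac (poly_iter f n)) x = to_ac \<alpha>}"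

text \<open>A vertex is tagged with its level, so that the vertex set is a disjoint union.\<close>

definition tree_vertices :: "'k::field poly \<Rightarrow> 'k \<Rightarrow> (nat \<times> 'k alg_closure) set" where
  "tree_vertices f \<alpha> = Sigma UNIV (preimages f \<alpha>)"

definition subtree_vertices :: "'k::field poly \<Rightarrow> 'k \<Rightarrow> nat \<Rightarrow> (nat \<times> 'k alg_closure) set" where
  "subtree_vertices f \<alpha> n = Sigma {..n} (preimages f \<alpha>)"

definition tree_adj ::
  "'k::field poly \<Rightarrow> nat \<times> 'k alg_closure \<Rightarrow> nat \<times> 'k alg_closure \<Rightarrow> bool" where
  "tree_adj f x y \<longleftrightarrow>
     (fst x = Suc (fst y) \<and> poly (map_poly to_ac f) (snd x) = snd y) \<or>
     (fst y = Suc (fst x) \<and> poly (map_poly to_ac f) (snd y) = snd x)"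

text \<open>Automorphisms of the graph with vertex set \<open>W\<close> and adjacency relation \<open>E\<close> that fix the
  root \<open>r\<close>.\<close>

definition rooted_aut_group :: "'v set \<Rightarrow> 'v \<Rightarrow> ('v \<Rightarrow> 'v \<Rightarrow> bool) \<Rightarrow> ('v \<Rightarrow> 'v) monoid" where
  "rooted_aut_group W r E = (BijGroup W)\<lparr>carrier :=
     {\<sigma> \<in> Bij W. \<sigma> r = r \<and> (\<forall>x\<in>W. \<forall>y\<in>W. E (\<sigma> x) (\<sigma> y) \<longleftrightarrow> E x y)}\<rparr>"

definition tree_aut ::
  "'k::field poly \<Rightarrow> 'k \<Rightarrow> (nat \<times> 'k alg_closure \<Rightarrow> nat \<times> 'k alg_closure) monoid" where
  "tree_aut f \<alpha> = rooted_aut_group (tree_vertices f \<alpha>) (0, to_ac \<alpha>) (tree_adj f)"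

definition subtree_aut ::
  "'k::field poly \<Rightarrow> 'k \<Rightarrow> nat \<Rightarrow> (nat \<times> 'k alg_closure \<Rightarrow> nat \<times> 'k alg_closure) monoid" where
  "subtree_aut f \<alpha> n = rooted_aut_group (subtree_vertices f \<alpha> n) (0, to_ac \<alpha>) (tree_adj f)"

text \<open>The profinite topology, i.e. the topology induced by restriction to the finite subtrees,
  whose automorphism groups are discrete.\<close>

definition tree_aut_topology ::
  "'k::field poly \<Rightarrow> 'k \<Rightarrow> (nat \<times> 'k alg_closure \<Rightarrow> nat \<times> 'k alg_closure) topology" where
  "tree_aut_topology f \<alpha> =
     pullback_topology (carrier (tree_aut f \<alpha>))
       (\<lambda>\<sigma> n. restrict \<sigma> (subtree_vertices f \<alpha> n))
       (product_topology (\<lambda>n. discrete_topology (carrier (subtree_aut f \<alpha> n))) UNIV)"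


section \<open>The path space\<close>

definition tree_paths :: "'k::field poly \<Rightarrow> 'k \<Rightarrow> (nat \<Rightarrow> 'k alg_closure) set" where
  "tree_paths f \<alpha> =
     {v. (\<forall>n. v n \<in> preimages f \<alpha> n) \<and> (\<forall>n. tree_adj f (n, v n) (Suc n, v (Suc n)))}"

definition path_space :: "'k::field poly \<Rightarrow> 'k \<Rightarrow> (nat \<Rightarrow> 'k alg_closure) topology" where
  "path_space f \<alpha> =
     subtopology (product_topology (\<lambda>n. discrete_topology (preimages f \<alpha> n)) UNIV) (tree_paths f \<alpha>)"

definition path_act ::
  "(nat \<times> 'a \<Rightarrow> nat \<times> 'a) \<Rightarrow> (nat \<Rightarrow> 'a) \<Rightarrow> nat \<Rightarrow> 'a" where
  "path_act \<sigma> v = (\<lambda>n. snd (\<sigma> (n, v n)))"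

text \<open>The usual ultrametric on a set of sequences. It is used to define the uniform topology on the
  homeomorphism group of the path space. On a compact space this topology does not depend on the
  choice of a compatible metric; compatibility is \<open>mtopology_of_path_metric\<close> below.\<close>

definition seq_dist :: "(nat \<Rightarrow> 'a) \<Rightarrow> (nat \<Rightarrow> 'a) \<Rightarrow> real" where
  "seq_dist u v = (if u = v then 0 else (1/2) ^ (LEAST n. u n \<noteq> v n))"

definition path_metric :: "'k::field poly \<Rightarrow> 'k \<Rightarrow> (nat \<Rightarrow> 'k alg_closure) metric" where
  "path_metric f \<alpha> = metric (tree_paths f \<alpha>, seq_dist)"

lemma seq_dist_less_iff: "seq_dist u v < (1/2) ^ N \<longleftrightarrow> (\<forall>n\<le>N. u n = v n)"
proof (cases "u = v")
  case False
  then obtain k where "u k \<noteq> v k" by blast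
  then have 1: "u (LEAST n. u n \<noteq> v n) \<noteq> v (LEAST n. u n \<noteq> v n)" by (rule LeastI)
  have 2: "u m = v m" if "m < (LEAST n. u n \<noteq> v n)" for m
    using not_less_Least[OF that] by blast
  have "seq_dist u v < (1/2) ^ N \<longleftrightarrow> N < (LEAST n. u n \<noteq> v n)"
    using False by (simp add: seq_dist_def power_strict_decreasing_iff)
  also have "\<dots> \<longleftrightarrow> (\<forall>n\<le>N. u n = v n)"
    using 1 2 by (meson le_less_trans not_le)
  finally show ?thesis .
qed (simp add: seq_dist_def)

lemma Metric_space_seq_dist: "Metric_space S seq_dist"
proof
  show "0 \<le> seq_dist u v" for u v :: "nat \<Rightarrow> 'a" by (simp add: seq_dist_def)
  show "seq_dist u v = seq_dist v u" for u v :: "nat \<Rightarrow> 'a"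
    by (simp add: seq_dist_def eq_commute)
  show "seq_dist u v = 0 \<longleftrightarrow> u = v" for u v :: "nat \<Rightarrow> 'a" by (simp add: seq_dist_def)
  show "seq_dist u w \<le> seq_dist u v + seq_dist v w" for u v w :: "nat \<Rightarrow> 'a"
  proof (cases "u = w")
    case False
    define N where "N = (LEAST n. u n \<noteq> w n)"
    have uw: "seq_dist u w = (1/2) ^ N" using False by (simp add: seq_dist_def N_def)
    have "\<not> (seq_dist u v < (1/2) ^ N \<and> seq_dist v w < (1/2) ^ N)"
      using uw seq_dist_less_iff[of u v N] seq_dist_less_iff[of v w N] seq_dist_less_iff[of u w N]
      by auto
    then have "(1/2) ^ N \<le> seq_dist u v \<or> (1/2) ^ N \<le> seq_dist v w" by linarith
    moreover have "0 \<le> seq_dist u v" "0 \<le> seq_dist v w" by (simp_all add: seq_dist_def)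
    ultimately show ?thesis using uw by linarith
  qed (simp add: seq_dist_def)
qed

lemma mtopology_of_path_metric: "mtopology_of (path_metric f \<alpha>) = path_space f \<alpha>"
proof -
  let ?S = "tree_paths f \<alpha>" and ?V = "preimages f \<alpha>"
  interpret Metric_space ?S seq_dist by (rule Metric_space_seq_dist)
  let ?P = "product_topology (\<lambda>n. discrete_topology (?V n)) UNIV"
  have SV: "w n \<in> ?V n" if "w \<in> ?S" for w n using that by (simp add: tree_paths_def)
  have "mtopology = subtopology ?P ?S"
  proof (rule topology_eq[THEN iffD2], intro allI iffI)
    fix U assume U: "openin mtopology U"
    show "openin (subtopology ?P ?S) U"
    proof (subst openin_subopen, intro ballI)
      fix u assume u: "u \<in> U"
      then have uS: "u \<in> ?S" using U openin_mtopology by blast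
      obtain r where r: "r > 0" "mball u r \<subseteq> U" using U u openin_mtopology by blast
      obtain N where N: "(1/2::real) ^ N < r"
        using real_arch_pow_inv[OF r(1), of "1/2"] by auto
      let ?B = "PiE UNIV (\<lambda>n. if n \<le> N then {u n} else ?V n)"
      have "openin ?P ?B"
        unfolding openin_PiE_gen
      proof (intro disjI2 conjI ballI)
        show "finite {i \<in> UNIV. (if i \<le> N then {u i} else ?V i) \<noteq> topspace (discrete_topology (?V i))}"
          by (rule finite_subset[of _ "{..N}"]) auto
      qed (use SV[OF uS] in auto)
      moreover have "?S \<inter> ?B \<subseteq> mball u r"
      proof
        fix w assume w: "w \<in> ?S \<inter> ?B"
        have "u n = w n" if "n \<le> N" for n
        proof -
          have "w n \<in> (if n \<le> N then {u n} else ?V n)" using w by (auto simp: PiE_def Pi_def)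
          then show ?thesis using that by simp
        qed
        then have "seq_dist u w < (1/2) ^ N" by (simp add: seq_dist_less_iff)
        then show "w \<in> mball u r" using w uS N by simp
      qed
      moreover have "u \<in> ?B" using SV[OF uS] by auto
      ultimately show "\<exists>T. openin (subtopology ?P ?S) T \<and> u \<in> T \<and> T \<subseteq> U"
        using r(2) uS by (intro exI[of _ "?S \<inter> ?B"]) (auto simp: openin_subtopology_Int2)
    qed
  next
    fix U assume "openin (subtopology ?P ?S) U"
    then obtain T where T: "openin ?P T" "U = T \<inter> ?S" by (auto simp: openin_subtopology)
    show "openin mtopology U"
      unfolding openin_mtopology
    proof (intro conjI allI impI)
      show "U \<subseteq> ?S" using T by blast
      fix u assume u: "u \<in> U"
      obtain W where W: "finite {n. W n \<noteq> topspace (discrete_topology (?V n))}"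
          "u \<in> PiE UNIV W" "PiE UNIV W \<subseteq> T"
        using T u unfolding openin_product_topology_alt by auto
      obtain N where N: "\<And>n. W n \<noteq> ?V n \<Longrightarrow> n \<le> N"
        using W(1) by (auto simp: finite_nat_set_iff_bounded_le)
      have "mball u ((1/2) ^ N) \<subseteq> U"
      proof
        fix w assume w: "w \<in> mball u ((1/2) ^ N)"
        then have eq: "u n = w n" if "n \<le> N" for n using that by (simp add: seq_dist_less_iff)
        have "w n \<in> W n" for n
        proof (cases "n \<le> N")
          case True
          have "u n \<in> W n" using W(2) by blast
          then show ?thesis using eq[OF True] by simp
        next
          case False
          then have "W n = ?V n" using N by blast
          then show ?thesis using w SV[of w n] by simp
        qed
        then have "w \<in> T" using W(3) by blast
        then show "w \<in> U" using w T(2) by simp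
      qed
      then show "\<exists>r>0. mball u r \<subseteq> U" by (intro exI[of _ "(1/2)^N"]) simp
    qed
  qed
  then show ?thesis
    by (simp add: path_metric_def path_space_def)
qed


section \<open>The arboreal representation\<close>

definition arboreal_rep ::
  "'k::field poly \<Rightarrow> 'k \<Rightarrow> ('k alg_closure \<Rightarrow> 'k alg_closure)
     \<Rightarrow> nat \<times> 'k alg_closure \<Rightarrow> nat \<times> 'k alg_closure" where
  "arboreal_rep f \<alpha> \<tau> = restrict (\<lambda>(n, b). (n, \<tau> b)) (tree_vertices f \<alpha>)"

definition arboreal_image ::
  "'k::field poly \<Rightarrow> 'k \<Rightarrow> (nat \<times> 'k alg_closure \<Rightarrow> nat \<times> 'k alg_closure) monoid" where
  "arboreal_image f \<alpha> =
     (tree_aut f \<alpha>)\<lparr>carrier := arboreal_rep f \<alpha> ` carrier abs_galois_group\<rparr>"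

definition arboreal_topology ::
  "'k::field poly \<Rightarrow> 'k \<Rightarrow> (nat \<times> 'k alg_closure \<Rightarrow> nat \<times> 'k alg_closure) topology" where
  "arboreal_topology f \<alpha> =
     subtopology (tree_aut_topology f \<alpha>) (carrier (arboreal_image f \<alpha>))"


section \<open>Cantor sets, group actions and the Ellis group\<close>

definition cantor_space :: "'a topology \<Rightarrow> bool" where
  "cantor_space T \<longleftrightarrow>
     topspace T \<noteq> {} \<and> compact_space T \<and> metrizable_space T \<and>
     (\<forall>x\<in>topspace T. connected_component_of_set T x = {x}) \<and>
     T derived_set_of topspace T = topspace T"

definition homeo_group :: "'a topology \<Rightarrow> ('a \<Rightarrow> 'a) monoid" where
  "homeo_group T = (BijGroup (topspace T))\<lparr>carrier :=
     {h \<in> Bij (topspace T). homeomorphic_map T T h}\<rparr>"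

text \<open>The uniform topology on the homeomorphism group of the topology induced by a compact
  metric: \<^const>\<open>cfunspace\<close> is the space of (bounded) continuous maps with the supremum metric.\<close>

definition homeo_topology :: "'a metric \<Rightarrow> ('a \<Rightarrow> 'a) topology" where
  "homeo_topology m =
     subtopology (mtopology_of (cfunspace (mtopology_of m) m)) (carrier (homeo_group (mtopology_of m)))"

definition equicontinuous_action ::
  "'a metric \<Rightarrow> ('g, 'b) monoid_scheme \<Rightarrow> ('g \<Rightarrow> 'a \<Rightarrow> 'a) \<Rightarrow> bool" where
  "equicontinuous_action m G \<Phi> \<longleftrightarrow>
     (\<forall>\<epsilon>>0. \<exists>\<delta>>0. \<forall>h\<in>carrier G. \<forall>x\<in>mspace m. \<forall>y\<in>mspace m.
        mdist m x y < \<delta> \<longrightarrow> mdist m (\<Phi> h x) (\<Phi> h y) < \<epsilon>)"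

definition ellis_group ::
  "'a metric \<Rightarrow> ('g, 'b) monoid_scheme \<Rightarrow> ('g \<Rightarrow> 'a \<Rightarrow> 'a) \<Rightarrow> ('a \<Rightarrow> 'a) monoid" where
  "ellis_group m G \<Phi> = (homeo_group (mtopology_of m))\<lparr>carrier :=
     Abstract_Topology.closure_of (homeo_topology m) (\<Phi> ` carrier G)\<rparr>"

definition ellis_topology ::
  "'a metric \<Rightarrow> ('g, 'b) monoid_scheme \<Rightarrow> ('g \<Rightarrow> 'a \<Rightarrow> 'a) \<Rightarrow> ('a \<Rightarrow> 'a) topology" where
  "ellis_topology m G \<Phi> = subtopology (homeo_topology m) (carrier (ellis_group m G \<Phi>))"


section \<open>Group chains\<close>

definition countably_generated :: "('g, 'b) monoid_scheme \<Rightarrow> bool" where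
  "countably_generated G \<longleftrightarrow> (\<exists>S. S \<subseteq> carrier G \<and> countable S \<and> generate G S = carrier G)"

definition group_chain :: "('g, 'b) monoid_scheme \<Rightarrow> (nat \<Rightarrow> 'g set) \<Rightarrow> bool" where
  "group_chain G C \<longleftrightarrow> C 0 = carrier G \<and>
     (\<forall>n. subgroup (C n) G \<and> finite (lcosets\<^bsub>G\<^esub> (C n)) \<and> C (Suc n) \<subset> C n)"

definition chain_limit_set :: "('g, 'b) monoid_scheme \<Rightarrow> (nat \<Rightarrow> 'g set) \<Rightarrow> (nat \<Rightarrow> 'g set) set" where
  "chain_limit_set G C = {u. (\<forall>n. u n \<in> lcosets\<^bsub>G\<^esub> (C n)) \<and>
     (\<forall>n. \<exists>g\<in>carrier G. u (Suc n) = g <#\<^bsub>G\<^esub> C (Suc n) \<and> u n = g <#\<^bsub>G\<^esub> C n)}"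

definition chain_limit :: "('g, 'b) monoid_scheme \<Rightarrow> (nat \<Rightarrow> 'g set) \<Rightarrow> (nat \<Rightarrow> 'g set) topology" where
  "chain_limit G C =
     subtopology (product_topology (\<lambda>n. discrete_topology (lcosets\<^bsub>G\<^esub> (C n))) UNIV)
       (chain_limit_set G C)"

text \<open>\<open>act\<close> is the continuous action of the Ellis group on the limit of the chain that extends the
  action of \<open>G\<close> by left multiplication. There is at most one such action, see
  \<open>ellis_chain_action_unique\<close>.\<close>

definition ellis_chain_action ::
  "'a metric \<Rightarrow> ('g, 'b) monoid_scheme \<Rightarrow> ('g \<Rightarrow> 'a \<Rightarrow> 'a) \<Rightarrow> (nat \<Rightarrow> 'g set)
     \<Rightarrow> (('a \<Rightarrow> 'a) \<Rightarrow> (nat \<Rightarrow> 'g set) \<Rightarrow> (nat \<Rightarrow> 'g set)) \<Rightarrow> bool" where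
  "ellis_chain_action m G \<Phi> C act \<longleftrightarrow>
     group_action (ellis_group m G \<Phi>) (topspace (chain_limit G C)) act \<and>
     continuous_map (prod_topology (ellis_topology m G \<Phi>) (chain_limit G C)) (chain_limit G C)
       (\<lambda>(g, u). act g u) \<and>
     (\<forall>h\<in>carrier G. \<forall>u\<in>topspace (chain_limit G C). act (\<Phi> h) u = (\<lambda>n. h <#\<^bsub>G\<^esub> u n))"

lemma ellis_chain_action_unique:
  assumes a: "ellis_chain_action m G \<Phi> C act" and b: "ellis_chain_action m G \<Phi> C act'"
    and g: "g \<in> carrier (ellis_group m G \<Phi>)" and u: "u \<in> topspace (chain_limit G C)"
  shows "act g u = act' g u"
proof -
  let ?X = "homeo_topology m" and ?E = "ellis_topology m G \<Phi>" and ?L = "chain_limit G C"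
  let ?S = "topspace ?X \<inter> \<Phi> ` carrier G"
  have E: "carrier (ellis_group m G \<Phi>) = Abstract_Topology.closure_of ?X ?S"
    by (simp add: ellis_group_def flip: closure_of_restrict)
  have S: "?S \<subseteq> Abstract_Topology.closure_of ?X ?S" by (rule closure_of_subset) blast
  then have gE: "g \<in> Abstract_Topology.closure_of ?E ?S"
    using g by (simp add: ellis_topology_def E closure_of_subtopology Int_absorb1)
  have haus: "Hausdorff_space ?L"
    unfolding chain_limit_def
    by (intro Hausdorff_space_subtopology) (simp add: Hausdorff_space_product_topology)
  have cont: "continuous_map ?E ?L (\<lambda>g. B g u)" if "ellis_chain_action m G \<Phi> C B" for B
  proof -
    have "continuous_map ?E ?L ((\<lambda>(g, u). B g u) \<circ> (\<lambda>g. (g, u)))"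
      using that u unfolding ellis_chain_action_def
      by (intro continuous_map_compose[where X' = "prod_topology ?E ?L"]) (auto simp: continuous_map_pairedI)
    then show ?thesis by (simp add: o_def)
  qed
  show ?thesis
  proof (rule forall_in_closure_of_eq[OF gE haus cont[OF a] cont[OF b]])
    show "act x u = act' x u" if "x \<in> ?S" for x
      using that a b u by (auto simp: ellis_chain_action_def)
  qed
qed

end

theory Submission
  imports Defs
begin

text \<open>Let \<open>E\<close> be the image of the absolute Galois group in the homeomorphism group of the path space.
  \<open>E\<close> is closed: automorphisms of \<open>K\<^sup>s\<^sup>e\<^sup>p\<close> that agree on more and more levels of the tree define an
  embedding of the subfield on which they are eventually constant, and this embedding extends to
  \<open>K\<^sup>s\<^sup>e\<^sup>p\<close>. Since every level is finite, \<open>E\<close> contains a countable dense set; let \<open>G\<close> be the group it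
  generates, acting tautologically, so that its Ellis group is \<open>E\<close>. A Galois element acts on a path
  exactly as it acts on the vertices, which identifies \<open>E\<close> with the arboreal image. By irreducibility
  \<open>E\<close>, and hence the dense subgroup \<open>G\<close>, is transitive on every level, so the cosets of the stabilizers
  \<open>C n\<close> of \<open>v n\<close> in \<open>G\<close> correspond to the vertices of level \<open>n\<close>, and coset sequences to paths.\<close>

section \<open>Polynomials over the base field\<close>

text \<open>\<open>sep_closure\<close> is defined through polynomials, not as a field, so its
  closure under sums and products is the main algebraic obstacle. It is settled by linear algebra
  over K: in characteristic p, a finite-dimensional algebra spanned over K by its own p-th powers
  has only separable elements. There Frobenius preserves linear independence, while an inseparable
  element would produce a relation among p-th powers of independent elements. Embeddings are
  extended to the whole algebraic closure, where roots always exist, and only then restricted to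
  \<open>sep_closure\<close>; the finiteness of sets of conjugates makes the restriction surjective.
  The topologies on paths, tree automorphisms, homeomorphisms and coset sequences are all described
  by one relation, agreement up to level n. Continuity, closures and homeomorphisms thus become
  statements about levels, and the uniform metric is needed only once, to bring the homeomorphism
  group into this form.\<close>

abbreviation (input) eval_ac :: "'k::field poly \<Rightarrow> 'k alg_closure \<Rightarrow> 'k alg_closure" where
  "eval_ac p x \<equiv> poly (map_poly to_ac p) x"

lemma map_poly_to_ac_add: "map_poly to_ac (p + q) = map_poly to_ac p + map_poly to_ac q"
  by (rule poly_eqI) (simp add: coeff_map_poly)

lemma map_poly_to_ac_diff: "map_poly to_ac (p - q) = map_poly to_ac p - map_poly to_ac q"
  by (rule poly_eqI) (simp add: coeff_map_poly)

lemma map_poly_to_ac_mult: "map_poly to_ac (p * q) = map_poly to_ac p * map_poly to_ac q"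
  by (rule poly_eqI) (simp add: coeff_map_poly coeff_mult to_ac_sum)

lemma degree_map_poly_to_ac [simp]: "Polynomial.degree (map_poly to_ac p) = Polynomial.degree p"
  by (rule degree_map_poly) simp

lemma map_poly_to_ac_eq_0_iff [simp]: "map_poly to_ac p = 0 \<longleftrightarrow> p = 0"
  by (rule map_poly_eq_0_iff) auto

lemma pderiv_map_poly_to_ac: "pderiv (map_poly to_ac p) = map_poly to_ac (pderiv p)"
  by (rule poly_eqI) (simp add: coeff_map_poly coeff_pderiv)

lemma eval_ac_pCons [simp]: "eval_ac (pCons c p) x = to_ac c + x * eval_ac p x"
  by (simp add: map_poly_pCons)

lemma eval_ac_add [simp]: "eval_ac (p + q) x = eval_ac p x + eval_ac q x"
  by (simp add: map_poly_to_ac_add)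

lemma eval_ac_diff [simp]: "eval_ac (p - q) x = eval_ac p x - eval_ac q x"
  by (simp add: map_poly_to_ac_diff)

lemma eval_ac_mult [simp]: "eval_ac (p * q) x = eval_ac p x * eval_ac q x"
  by (simp add: map_poly_to_ac_mult)

lemma eval_ac_pcompose [simp]: "eval_ac (pcompose p q) x = eval_ac p (eval_ac q x)"
  by (induction p) (simp_all add: pcompose_pCons)

lemma eval_ac_dvd: "p dvd q \<Longrightarrow> eval_ac p x = 0 \<Longrightarrow> eval_ac q x = 0"
  by (elim dvdE) simp

lemma eval_ac_altdef: "eval_ac p x = (\<Sum>i\<le>Polynomial.degree p. to_ac (Polynomial.coeff p i) * x ^ i)"
  by (simp add: poly_altdef coeff_map_poly)

lemma finite_eval_ac_roots: "p \<noteq> 0 \<Longrightarrow> finite {x. eval_ac p x = 0}"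
  by (intro poly_roots_finite) simp

text \<open>Among the nonzero polynomials with root \<open>x\<close> one of least degree is taken;
  the remainder of any other annihilator modulo it has root \<open>x\<close> and smaller degree,
  hence is zero.\<close>

lemma min_poly_ac:
  fixes x :: "'k::field alg_closure"
  obtains m :: "'k poly" where "m \<noteq> 0" "eval_ac m x = 0" "\<And>r. eval_ac r x = 0 \<Longrightarrow> m dvd r"
proof -
  define P where "P = (\<lambda>p :: 'k poly. p \<noteq> 0 \<and> eval_ac p x = 0)"
  obtain p where "P p" using alg_closure_algebraic[of x] unfolding P_def by blast
  define m where "m = arg_min Polynomial.degree P"
  have m: "P m" "\<And>r. P r \<Longrightarrow> Polynomial.degree m \<le> Polynomial.degree r"
    using arg_min_nat_lemma[of P p Polynomial.degree] \<open>P p\<close> unfolding m_def by auto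
  show thesis
  proof (rule that)
    show "m \<noteq> 0" "eval_ac m x = 0" using m(1) by (auto simp: P_def)
    fix r :: "'k poly" assume r: "eval_ac r x = 0"
    have "eval_ac (r div m * m + r mod m) x = 0" using r by (simp only: div_mult_mod_eq)
    then have "eval_ac (r mod m) x = 0" using \<open>eval_ac m x = 0\<close>
      by (simp only: eval_ac_add eval_ac_mult) simp
    then have "r mod m = 0"
      using m(2)[of "r mod m"] degree_mod_less'[of m r] \<open>m \<noteq> 0\<close> by (fastforce simp: P_def)
    then show "m dvd r" by (simp add: dvd_eq_mod_eq_0)
  qed
qed

lemma eval_ac_unit:
  assumes "is_unit p" shows "eval_ac p x \<noteq> 0"
proof -
  obtain q where "p * q = 1" using assms by (metis dvdE)
  then have "eval_ac p x * eval_ac q x = 1" by (metis eval_ac_mult map_poly_1' poly_1 to_ac_1)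
  then show ?thesis by auto
qed

text \<open>A minimal \<open>m\<close> divides \<open>q\<close>. It has a root, so it is not a unit;
  the cofactor is therefore a unit and \<open>q\<close> is as minimal as \<open>m\<close>.\<close>

lemma irreducible_dvd_of_root:
  fixes q :: "'k::field poly"
  assumes q: "Factorial_Ring.irreducible q" "eval_ac q x = 0" and r: "eval_ac r x = 0"
  shows "q dvd r"
proof -
  obtain m :: "'k poly" where m: "m \<noteq> 0" "eval_ac m x = 0" "\<And>r. eval_ac r x = 0 \<Longrightarrow> m dvd r"
    using min_poly_ac[of x] by blast
  obtain u where u: "q = m * u" using m(3)[OF q(2)] by (elim dvdE)
  have "is_unit u" using q(1) eval_ac_unit m(2) u by (metis Factorial_Ring.irreducible_def)
  then have "q dvd m" using u by (metis dvd_mult_unit_iff dvd_refl mult.commute)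
  then show ?thesis using m(3)[OF r] by (rule dvd_trans)
qed

lemma irreducible_poly_ac:
  fixes x :: "'k::field alg_closure"
  obtains q :: "'k poly" where "Factorial_Ring.irreducible q" "eval_ac q x = 0"
proof -
  obtain m :: "'k poly" where m: "m \<noteq> 0" "eval_ac m x = 0" "\<And>r. eval_ac r x = 0 \<Longrightarrow> m dvd r"
    using min_poly_ac[of x] by blast
  have "Factorial_Ring.irreducible m"
  proof (rule Factorial_Ring.irreducibleI)
    show "m \<noteq> 0" by fact
    show "\<not> is_unit m" using m(2) eval_ac_unit by blast
    fix a b assume ab: "m = a * b"
    then have "eval_ac a x = 0 \<or> eval_ac b x = 0" using m(2) by simp
    then have "m dvd a \<or> m dvd b" using m(3) by blast
    then show "is_unit a \<or> is_unit b"
      using ab m(1) by (metis dvd_mult_cancel_left dvd_mult_cancel_right mult.left_neutral mult.right_neutral mult_eq_0_iff)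
  qed
  then show thesis using m(2) that by blast
qed

section \<open>Simple roots\<close>

lemma size_proots_alg_closed:
  fixes p :: "'a::alg_closed_field poly"
  assumes "p \<noteq> 0" shows "size (proots p) = Polynomial.degree p"
proof -
  obtain A where A: "size A = Polynomial.degree p"
      "p = Polynomial.smult (Polynomial.lead_coeff p) (\<Prod>x\<in>#A. [:-x, 1:])"
    using alg_closed_imp_factorization[OF assms] by blast
  have "proots p = proots (\<Prod>x\<in>#A. [:-x, 1:])"
    using A(2) assms by (metis leading_coeff_0_iff proots_smult)
  also have "\<dots> = A"
  proof (induction A)
    case (add x A)
    have "(\<Prod>x\<in>#A. [:-x, 1:]) \<noteq> (0 :: 'a poly)" by (auto simp: prod_mset_zero_iff)
    then show ?case using add by (simp add: proots_mult del: mult_pCons_left)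
  qed simp
  finally show ?thesis using A(1) by simp
qed

text \<open>With multiplicity there are exactly as many roots as the degree, and multiplicities that
  are at least 1 add up to the number of roots only if all equal 1. This turns the assumption of d^n
  distinct roots into separability.\<close>

lemma rsquarefree_iff_card_roots:
  fixes p :: "'a::alg_closed_field poly"
  assumes "p \<noteq> 0"
  shows "rsquarefree p \<longleftrightarrow> card {x. poly p x = 0} = Polynomial.degree p"
proof -
  let ?M = "proots p"
  have S: "{x. poly p x = 0} = set_mset ?M" using assms by auto
  have pos: "count ?M x \<ge> 1" if "x \<in> set_mset ?M" for x using that by (simp add: Suc_le_eq)
  have size: "size ?M = (\<Sum>x\<in>set_mset ?M. count ?M x)" by (rule size_multiset_overloaded_eq)
  have "rsquarefree p \<longleftrightarrow> (\<forall>x\<in>set_mset ?M. count ?M x = 1)"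
    using assms by (auto simp: rsquarefree_def order_root) (metis less_irrefl)+
  also have "\<dots> \<longleftrightarrow> card (set_mset ?M) = size ?M"
  proof
    assume "card (set_mset ?M) = size ?M"
    then have "(\<Sum>x\<in>set_mset ?M. 1) = (\<Sum>x\<in>set_mset ?M. count ?M x)" using size by simp
    then show "\<forall>x\<in>set_mset ?M. count ?M x = 1"
      using sum_mono_inv[of "\<lambda>_. 1" "set_mset ?M" "count ?M"] pos by fastforce
  qed (simp add: size)
  finally show ?thesis using size_proots_alg_closed[OF assms] S by simp
qed

lemma multiple_root_imp_pderiv_root:
  fixes p :: "'a::field poly"
  assumes "p \<noteq> 0" "\<not> rsquarefree p"
  obtains a where "poly p a = 0" "poly (pderiv p) a = 0"
proof -
  obtain a where a: "Polynomial.order a p \<noteq> 0" "Polynomial.order a p \<noteq> 1"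
    using assms unfolding rsquarefree_def by blast
  then have "[:- a, 1:] ^ 2 dvd p" by (intro order_divides[THEN iffD2]) simp
  then obtain r where "p = [:- a, 1:] * ([:- a, 1:] * r)"
    by (metis dvdE mult.assoc power2_eq_square)
  then show thesis
    by (intro that[of a]) (simp_all add: pderiv_mult pderiv_pCons del: mult_pCons_left)
qed

text \<open>A multiple root is shared with the derivative, so the irreducible \<open>q\<close>
  divides its derivative; for a nonzero derivative the degrees forbid this.\<close>

lemma irreducible_not_rsquarefree_imp_pderiv_0:
  fixes q :: "'k::field poly"
  assumes q: "Factorial_Ring.irreducible q" "\<not> rsquarefree (map_poly to_ac q)"
  shows "pderiv q = 0"
proof (rule ccontr)
  assume nz: "pderiv q \<noteq> 0"
  obtain a where "eval_ac q a = 0" "poly (pderiv (map_poly to_ac q)) a = 0"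
  proof (rule multiple_root_imp_pderiv_root[of "map_poly to_ac q"])
    show "map_poly to_ac q \<noteq> 0" using q(1) by auto
  qed (use q(2) in auto)
  then have "q dvd pderiv q"
    using irreducible_dvd_of_root[OF q(1)] by (simp add: pderiv_map_poly_to_ac)
  then have "Polynomial.degree q \<le> Polynomial.degree (pderiv q)" using nz by (rule dvd_imp_degree_le)
  \<comment> \<open>The leading coefficient of the derivative is a multiple of the coefficient of
    \<open>q\<close> one index higher, and that index now exceeds the degree of
    \<open>q\<close>.\<close>
  then have "Polynomial.lead_coeff (pderiv q) = 0" by (simp add: coeff_pderiv coeff_eq_0)
  then show False using nz by simp
qed


text \<open>Divisibility by 0 means being 0, so the statement also covers characteristic 0, where it
  says that \<open>q\<close> is constant.\<close>

lemma pderiv_0_imp_CHAR: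
  fixes q :: "'k::field poly"
  assumes "pderiv q = 0" "Polynomial.coeff q i \<noteq> 0"
  shows "CHAR('k) dvd i"
proof (cases i)
  case (Suc j)
  have "Polynomial.coeff (pderiv q) j = 0" using assms(1) by simp
  then show ?thesis
    using assms(2) Suc by (simp add: coeff_pderiv of_nat_eq_0_iff_char_dvd del: of_nat_Suc)
qed simp

section \<open>The separable closure is a subfield\<close>

interpretation ac: vector_space "\<lambda>c x. to_ac c * x :: 'k::field alg_closure"
  by unfold_locales (simp_all add: algebra_simps)

section \<open>Dimension counts in vector spaces\<close>

context vector_space
begin

text \<open>Independence is a property of sets, so repetitions in the family have to be excluded
  separately: a repeated vector would give the relation with coefficients 1 and -1.\<close>

lemma independent_family:
  assumes "finite I" "\<And>c. (\<Sum>i\<in>I. scale (c i) (g i)) = 0 \<Longrightarrow> \<forall>i\<in>I. c i = 0"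
  shows "inj_on g I" "independent (g ` I)"
proof -
  show inj: "inj_on g I"
  proof (rule inj_onI, rule ccontr)
    fix i j assume ij: "i \<in> I" "j \<in> I" "g i = g j" "i \<noteq> j"
    define c where "c = (\<lambda>k. if k = i then 1 else if k = j then - 1 else 0 :: 'a)"
    have "(\<Sum>k\<in>I. scale (c k) (g k)) = (\<Sum>k\<in>{i, j}. scale (c k) (g k))"
      using ij assms(1) by (intro sum.mono_neutral_right) (auto simp: c_def)
    also have "\<dots> = 0" using ij by (simp add: c_def)
    finally show False using assms(2)[of c] ij by (auto simp: c_def)
  qed
  show "independent (g ` I)"
  proof
    assume "dependent (g ` I)"
    then obtain u where u: "\<exists>v\<in>g ` I. u v \<noteq> 0" "(\<Sum>v\<in>g ` I. scale (u v) v) = 0"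
      using assms(1) by (auto simp: dependent_finite)
    then show False using assms(2)[of "u \<circ> g"] by (auto simp: sum.reindex[OF inj] o_def)
  qed
qed

lemma independent_familyD:
  assumes "finite I" "inj_on g I" "independent (g ` I)" "(\<Sum>i\<in>I. scale (c i) (g i)) = 0" "i \<in> I"
  shows "c i = 0"
proof (rule ccontr)
  assume "c i \<noteq> 0"
  let ?u = "c \<circ> inv_into I g"
  have "(\<Sum>v\<in>g ` I. scale (?u v) v) = 0"
    using assms by (simp add: sum.reindex)
  moreover have "?u (g i) \<noteq> 0" using assms \<open>c i \<noteq> 0\<close> by simp
  ultimately have "dependent (g ` I)"
    using assms(1,5) dependent_finite[of "g ` I"] by (auto intro!: exI[of _ ?u])
  then show False using assms(3) by simp
qed

text \<open>A vector of \<open>S\<close> outside \<open>span T\<close> could be added to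
  \<open>T\<close>, giving an independent subset of \<open>span S\<close> with more elements than
  \<open>S\<close>.\<close>

lemma spanning_of_card_eq:
  assumes "finite S" "independent T" "T \<subseteq> span S" "card S \<le> card T"
  shows "S \<subseteq> span T"
proof (rule ccontr)
  assume "\<not> S \<subseteq> span T"
  then obtain s where s: "s \<in> S" "s \<notin> span T" by blast
  have fin: "finite T" using independent_span_bound assms by blast
  have "independent (insert s T)" using s assms(2) by (simp add: independent_insert)
  moreover have "insert s T \<subseteq> span S" using assms(3) s(1) span_base by blast
  ultimately have "card (insert s T) \<le> card S" using independent_span_bound assms(1) by blast
  moreover have "s \<notin> T" using s(2) span_base by blast
  ultimately show False using assms(4) fin by simp
qed

text \<open>A dependent \<open>T\<close> has a redundant vector; without it, fewer vectors than the
  independent set \<open>S\<close> has would still span \<open>S\<close>.\<close>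

lemma independent_of_spanning_card:
  assumes "independent S" "finite T" "S \<subseteq> span T" "card T \<le> card S"
  shows "independent T"
proof
  assume "dependent T"
  then obtain t where t: "t \<in> T" "t \<in> span (T - {t})" unfolding dependent_def by blast
  then have "span T = span (T - {t})" by (metis insert_Diff span_redundant)
  then have "card S \<le> card (T - {t})" using independent_span_bound assms by blast
  moreover have "card (T - {t}) < card T" using t(1) assms(2) by (rule card_Diff1_less[rotated])
  ultimately show False using assms(4) by linarith
qed

end

text \<open>Bilinearity, by one induction per factor. Applied to powers of two elements it gives a
  finite spanning set of the algebra that they generate.\<close>

lemma span_ac_mult:
  assumes "a \<in> ac.span A" "b \<in> ac.span B"
  shows "a * b \<in> ac.span {x * y |x y. x \<in> A \<and> y \<in> B}"
  using assms(1)
proof (induction rule: ac.span_induct_alt)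
  case base
  then show ?case by (simp add: ac.span_zero)
next
  case (step c x y)
  have "x * b \<in> ac.span {x * y |x y. x \<in> A \<and> y \<in> B}"
    using assms(2)
  proof (induction rule: ac.span_induct_alt)
    case base
    then show ?case by (simp add: ac.span_zero)
  next
    case (step d y z)
    have "to_ac d * (x * y) \<in> ac.span {x * y |x y. x \<in> A \<and> y \<in> B}"
      using step(1) \<open>x \<in> A\<close> by (intro ac.span_scale ac.span_base) blast
    then have "to_ac d * (x * y) + x * z \<in> ac.span {x * y |x y. x \<in> A \<and> y \<in> B}"
      using step(2) by (rule ac.span_add)
    then show ?case by (simp add: algebra_simps)
  qed
  then have "to_ac c * (x * b) + y * b \<in> ac.span {x * y |x y. x \<in> A \<and> y \<in> B}"
    using step(2) by (intro ac.span_add ac.span_scale)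
  then show ?case by (simp add: algebra_simps)
qed

text \<open>Translates linear relations among powers of \<open>x\<close> into polynomials with root
  \<open>x\<close>. The case \<open>r = 0\<close> is listed separately because its degree 0 is not
  below \<open>n\<close> when \<open>n = 0\<close>.\<close>

lemma poly_of_coeffs:
  fixes c :: "nat \<Rightarrow> 'k::field"
  obtains r where "\<And>i. Polynomial.coeff r i = (if i < n then c i else 0)"
    "\<And>x. eval_ac r x = (\<Sum>i<n. to_ac (c i) * x ^ i)" "r = 0 \<or> Polynomial.degree r < n"
proof -
  define r where "r = (\<Sum>i<n. Polynomial.monom (c i) i)"
  have coeff: "Polynomial.coeff r i = (if i < n then c i else 0)" for i
    by (auto simp: r_def coeff_sum sum.delta' if_distrib coeff_monom cong: if_cong)
  have eval_monom: "eval_ac (Polynomial.monom a i) x = to_ac a * x ^ i" for a :: 'k and i x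
    by (simp add: map_poly_monom poly_monom)
  have "eval_ac (\<Sum>i\<in>I. Polynomial.monom (c i) i) x = (\<Sum>i\<in>I. to_ac (c i) * x ^ i)" if "finite I" for I x
    using that by (induction I) (simp_all add: eval_monom)
  moreover have "r = 0 \<or> Polynomial.degree r < n"
    using coeff[of "Polynomial.degree r"] by (auto split: if_splits)
  ultimately show thesis using coeff by (intro that[of r]) (simp_all add: r_def)
qed

text \<open>A relation would be a polynomial of degree below that of \<open>q\<close> which
  \<open>q\<close> divides.\<close>

lemma independent_powers:
  fixes q :: "'k::field poly"
  assumes q: "Factorial_Ring.irreducible q" "eval_ac q x = 0" and n: "n \<le> Polynomial.degree q"
  shows "inj_on (\<lambda>i. x ^ i) {..<n}" "ac.independent ((\<lambda>i. x ^ i) ` {..<n})"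
proof -
  have *: "\<forall>i\<in>{..<n}. c i = 0" if c: "(\<Sum>i<n. to_ac (c i) * x ^ i) = 0" for c :: "nat \<Rightarrow> 'k"
  proof -
    obtain r where r: "\<And>i. Polynomial.coeff r i = (if i < n then c i else 0)"
        "\<And>x. eval_ac r x = (\<Sum>i<n. to_ac (c i) * x ^ i)" "r = 0 \<or> Polynomial.degree r < n"
      by (rule poly_of_coeffs[of n c]) blast
    have "q dvd r" using irreducible_dvd_of_root[OF q] c r(2) by simp
    then have "r = 0" using dvd_imp_degree_le[of q r] r(3) n by linarith
    then show ?thesis using r(1) by (metis coeff_0 lessThan_iff)
  qed
  show "inj_on (\<lambda>i. x ^ i) {..<n}" "ac.independent ((\<lambda>i. x ^ i) ` {..<n})"
    using ac.independent_family[of "{..<n}" "\<lambda>i. x ^ i"] * by blast+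
qed

lemma power_mem_span_powers:
  fixes q :: "'k::field poly"
  assumes q: "Factorial_Ring.irreducible q" "eval_ac q x = 0"
  shows "x ^ k \<in> ac.span ((\<lambda>i. x ^ i) ` {..<Polynomial.degree q})"
proof -
  let ?r = "Polynomial.monom 1 k mod q"
  have "q \<noteq> 0" using q(1) by auto
  have "x ^ k = eval_ac (Polynomial.monom 1 k div q * q + ?r) x"
    by (simp only: div_mult_mod_eq) (simp add: map_poly_monom poly_monom)
  also have "\<dots> = eval_ac ?r x" using q(2) by (simp only: eval_ac_add eval_ac_mult) simp
  also have "\<dots> = (\<Sum>i\<le>Polynomial.degree ?r. to_ac (Polynomial.coeff ?r i) * x ^ i)"
    by (rule eval_ac_altdef)
  also have "\<dots> \<in> ac.span ((\<lambda>i. x ^ i) ` {..<Polynomial.degree q})"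
  proof (intro ac.span_sum)
    fix i assume "i \<in> {..Polynomial.degree ?r}"
    then show "to_ac (Polynomial.coeff ?r i) * x ^ i \<in> ac.span ((\<lambda>i. x ^ i) ` {..<Polynomial.degree q})"
      using degree_mod_less'[of q "Polynomial.monom 1 k"] \<open>q \<noteq> 0\<close>
      by (cases "?r = 0") (auto intro!: ac.span_scale ac.span_base[OF imageI] ac.span_zero)
  qed
  finally show ?thesis .
qed


section \<open>Separability and p-th powers\<close>

text \<open>The definition of \<open>sep_closure\<close> asks for some irreducible polynomial. Two
  irreducible polynomials with the common root \<open>x\<close> divide each other, so they share
  degree and roots, and any of them can serve as the test.\<close>

lemma mem_sep_closure_iff:
  fixes q :: "'k::field poly"
  assumes q: "Factorial_Ring.irreducible q" "eval_ac q x = 0"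
  shows "x \<in> sep_closure \<longleftrightarrow> rsquarefree (map_poly to_ac q)"
proof
  assume "x \<in> sep_closure"
  then obtain p where p: "Factorial_Ring.irreducible p" "eval_ac p x = 0" "rsquarefree (map_poly to_ac p)"
    unfolding sep_closure_def by blast
  have dvd: "p dvd q" "q dvd p" using irreducible_dvd_of_root p q by blast+
  have nz: "p \<noteq> 0" "q \<noteq> 0" using p(1) q(1) by auto
  have "Polynomial.degree p = Polynomial.degree q"
    using dvd nz by (simp add: dvd_imp_degree_le order_antisym)
  moreover have "{x. eval_ac p x = 0} = {x. eval_ac q x = 0}"
    using dvd eval_ac_dvd by blast
  ultimately show "rsquarefree (map_poly to_ac q)"
    using p(3) nz rsquarefree_iff_card_roots[of "map_poly to_ac p"]
      rsquarefree_iff_card_roots[of "map_poly to_ac q"] by simp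
qed (use q in \<open>auto simp: sep_closure_def\<close>)

lemma frobenius_inj:
  fixes x y :: "'a::idom"
  assumes "CHAR('a) > 0" "x ^ CHAR('a) = y ^ CHAR('a)"
  shows "x = y"
proof -
  have pr: "Factorial_Ring.prime CHAR('a)" using assms(1) by (rule prime_CHAR_semidom)
  have "(x + - y) ^ CHAR('a) = x ^ CHAR('a) + (- y) ^ CHAR('a)"
    using freshmans_dream'[OF pr, of _ 1 x "- y"] by simp
  also have "\<dots> = 0" using assms(2) minus_power_prime_CHAR[OF refl pr, of y] by simp
  finally show ?thesis by simp
qed

lemma inj_frobenius_ac:
  assumes "CHAR('k::field) > 0" shows "inj (\<lambda>x :: 'k alg_closure. x ^ CHAR('k))"
  using assms frobenius_inj[where 'a = "'k alg_closure"] unfolding CHAR_alg_closure inj_def by blast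

text \<open>For separable \<open>x\<close> the algebras K[x] and K[x^p] coincide. A relation among
  the p-th powers is a polynomial \<open>r\<close> with r(x^p) = 0, so \<open>q\<close> divides
  r(X^p) and r(y^p) = 0 for every root y of \<open>q\<close>. Frobenius is injective, so
  \<open>r\<close> would have as many roots as the degree of \<open>q\<close>, which exceeds its
  own. Being independent, the p-th powers span K[x] by a dimension count.\<close>

lemma separable_frobenius_span:
  fixes q :: "'k::field poly"
  assumes char: "CHAR('k) > 0"
    and q: "Factorial_Ring.irreducible q" "eval_ac q x = 0" "rsquarefree (map_poly to_ac q)"
  shows "x ^ k \<in> ac.span ((\<lambda>i. (x ^ i) ^ CHAR('k)) ` {..<Polynomial.degree q})"
proof -
  let ?n = "Polynomial.degree q" and ?p = "CHAR('k)"
  let ?S = "(\<lambda>i. x ^ i) ` {..<?n}" and ?T = "(\<lambda>i. (x ^ i) ^ ?p) ` {..<?n}"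
  have nz: "q \<noteq> 0" using q(1) by auto
  have *: "\<forall>i\<in>{..<?n}. c i = 0" if c: "(\<Sum>i<?n. to_ac (c i) * (x ^ i) ^ ?p) = 0" for c :: "nat \<Rightarrow> 'k"
  proof -
    obtain r where r: "\<And>i. Polynomial.coeff r i = (if i < ?n then c i else 0)"
        "\<And>x. eval_ac r x = (\<Sum>i<?n. to_ac (c i) * x ^ i)" "r = 0 \<or> Polynomial.degree r < ?n"
      by (rule poly_of_coeffs[of ?n c]) blast
    let ?h = "pcompose r (Polynomial.monom 1 ?p)"
    have h: "eval_ac ?h y = eval_ac r (y ^ ?p)" for y
      by (simp add: map_poly_monom poly_monom)
    have "eval_ac ?h x = 0"
      using c unfolding h r(2) by (simp only: power_mult[symmetric] mult.commute)
    then have "q dvd ?h" by (rule irreducible_dvd_of_root[OF q(1,2)])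
    then have root: "eval_ac r (y ^ ?p) = 0" if "eval_ac q y = 0" for y
      using eval_ac_dvd[OF \<open>q dvd ?h\<close> that] by (simp only: h)
    have "r = 0"
    proof (rule ccontr)
      assume "r \<noteq> 0"
      have inj: "inj_on (\<lambda>y. y ^ ?p) {y. eval_ac q y = 0}"
        using inj_frobenius_ac[OF char] by (rule inj_on_subset) simp
      have "?n = card {y. eval_ac q y = 0}"
        using rsquarefree_iff_card_roots[of "map_poly to_ac q"] q(3) nz by simp
      also have "\<dots> = card ((\<lambda>y. y ^ ?p) ` {y. eval_ac q y = 0})" using card_image[OF inj] by simp
      also have "\<dots> \<le> card {y. eval_ac r y = 0}"
        using finite_eval_ac_roots[OF \<open>r \<noteq> 0\<close>] root by (intro card_mono) auto
      also have "\<dots> \<le> Polynomial.degree r"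
        using card_poly_roots_bound[of "map_poly to_ac r"] \<open>r \<noteq> 0\<close> by simp
      finally show False using r(3) \<open>r \<noteq> 0\<close> by simp
    qed
    then show ?thesis using r(1) by (metis coeff_0 lessThan_iff)
  qed
  have T: "inj_on (\<lambda>i. (x ^ i) ^ ?p) {..<?n}" "ac.independent ?T"
    using ac.independent_family[of "{..<?n}" "\<lambda>i. (x ^ i) ^ ?p"] * by blast+
  have "?S \<subseteq> ac.span ?T"
  proof (rule ac.spanning_of_card_eq)
    show "?T \<subseteq> ac.span ?S"
      using power_mem_span_powers[OF q(1,2)] by (auto simp: power_mult[symmetric])
    show "card ?S \<le> card ?T" using card_image[OF T(1)] card_image_le[of "{..<?n}"] by simp
  qed (use T in auto)
  then have "ac.span ?S \<subseteq> ac.span ?T" by (simp add: ac.span_minimal)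
  then show ?thesis using power_mem_span_powers[OF q(1,2)] by blast
qed

text \<open>Frobenius is additive and semilinear: a scalar c from K comes out as c^p, which is again
  in K.\<close>

lemma span_frobenius:
  fixes B :: "'k::field alg_closure set"
  assumes char: "CHAR('k) > 0" and "x \<in> ac.span B"
  shows "x ^ CHAR('k) \<in> ac.span ((\<lambda>b. b ^ CHAR('k)) ` B)"
  using assms(2)
proof (induction rule: ac.span_induct_alt)
  case base
  then show ?case using char by (simp add: ac.span_zero power_0_left)
next
  case (step c x y)
  have pr: "Factorial_Ring.prime CHAR('k)" using char by (rule prime_CHAR_semidom)
  have eq: "(to_ac c * x + y) ^ CHAR('k) = to_ac (c ^ CHAR('k)) * x ^ CHAR('k) + y ^ CHAR('k)"
    using freshmans_dream'[where 'a = "'k alg_closure", of _ 1 "to_ac c * x" y] pr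
    by (simp add: power_mult_distrib)
  have "to_ac (c ^ CHAR('k)) * x ^ CHAR('k) \<in> ac.span ((\<lambda>b. b ^ CHAR('k)) ` B)"
    using step(1) by (intro ac.span_scale ac.span_base) blast
  then show ?case unfolding eq using step(2) by (rule ac.span_add)
qed

text \<open>If \<open>L\<close> is the span of \<open>S\<close>, the hypothesis on \<open>S\<close> says that \<open>L\<close> is spanned by its \<open>p\<close>-th powers.
  Then Frobenius maps a basis of \<open>L\<close> to a basis, hence preserves linear independence.\<close>

lemma independent_frobenius:
  fixes S :: "'k::field alg_closure set"
  assumes char: "CHAR('k) > 0" and S: "finite S" "S \<subseteq> ac.span ((\<lambda>b. b ^ CHAR('k)) ` S)"
    and T: "ac.independent T" "T \<subseteq> ac.span S"
  shows "ac.independent ((\<lambda>b. b ^ CHAR('k)) ` T)"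
proof -
  let ?F = "\<lambda>b :: 'k alg_closure. b ^ CHAR('k)"
  obtain B where B: "T \<subseteq> B" "B \<subseteq> ac.span S" "ac.independent B" "ac.span S \<subseteq> ac.span B"
    using ac.maximal_independent_subset_extend[OF T(2,1)] by blast
  have fin: "finite B" using ac.independent_span_bound[OF S(1) B(3,2)] by blast
  have inj: "inj_on ?F B" using inj_frobenius_ac[OF char] by (rule inj_on_subset) simp
  have "?F ` S \<subseteq> ac.span (?F ` B)"
    using span_frobenius[OF char] B(4) ac.span_base by blast
  then have "S \<subseteq> ac.span (?F ` B)" using S(2) ac.span_minimal ac.subspace_span by blast
  then have "B \<subseteq> ac.span (?F ` B)" using B(2) ac.span_minimal ac.subspace_span by blast
  then have "ac.independent (?F ` B)"
    using fin by (intro ac.independent_of_spanning_card[OF B(3)]) (auto intro: card_image_le)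
  then show ?thesis by (rule ac.independent_mono) (rule image_mono[OF B(1)])
qed

text \<open>If \<open>z\<close> were inseparable, its irreducible polynomial would have derivative 0
  and so be a polynomial in X^p, of degree p k. Read as a linear relation, it makes the p-th powers
  of 1, z, ..., z^k dependent. But k + 1 is at most p k, so 1, z, ..., z^k are independent, and
  \<open>independent_frobenius\<close> carries this over to their p-th powers.\<close>

lemma separable_of_powers_in_span:
  fixes S :: "'k::field alg_closure set"
  assumes S: "finite S" "CHAR('k) > 0 \<Longrightarrow> S \<subseteq> ac.span ((\<lambda>b. b ^ CHAR('k)) ` S)"
    and z: "\<And>i. z ^ i \<in> ac.span S"
  shows "z \<in> sep_closure"
proof (rule ccontr)
  let ?p = "CHAR('k)"
  assume nsep: "z \<notin> sep_closure"
  obtain q :: "'k poly" where q: "Factorial_Ring.irreducible q" "eval_ac q z = 0"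
    by (rule irreducible_poly_ac)
  have nz: "q \<noteq> 0" using q(1) by auto
  have "pderiv q = 0"
    using mem_sep_closure_iff[OF q] irreducible_not_rsquarefree_imp_pderiv_0[OF q(1)] nsep by blast
  then have dvd: "?p dvd i" if "Polynomial.coeff q i \<noteq> 0" for i using that by (rule pderiv_0_imp_CHAR)
  have deg: "Polynomial.degree q > 0"
  proof (rule ccontr)
    assume "\<not> Polynomial.degree q > 0"
    then obtain c where "q = [:c:]" by (metis degree_eq_zeroE not_gr_zero)
    then show False using q(2) nz by simp
  qed
  have pd: "?p dvd Polynomial.degree q" using dvd[of "Polynomial.degree q"] nz by simp
  \<comment> \<open>Divisibility by 0 would make the degree 0, so characteristic 0 is ruled out
    here.\<close>
  then have p0: "?p > 0" using deg by (auto intro: Nat.gr0I)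
  then have p1: "?p > 1" using prime_CHAR_semidom prime_gt_1_nat by blast
  obtain k where k: "Polynomial.degree q = ?p * k" using pd by (elim dvdE)
  have "0 < k" using deg k by (auto intro: Nat.gr0I)
  then have kp: "k < ?p * k" using p1 by simp
  have kd: "Suc k \<le> Polynomial.degree q" using kp by (simp only: k Suc_le_eq)
  let ?g = "\<lambda>i. z ^ i"
  have ind: "inj_on ?g {..<Suc k}" "ac.independent (?g ` {..<Suc k})"
    using independent_powers[OF q kd] by blast+
  have "ac.independent ((\<lambda>b. b ^ ?p) ` ?g ` {..<Suc k})"
    using ind(2) z p0 S by (intro independent_frobenius[of S]) auto
  then have ind': "ac.independent ((\<lambda>i. (z ^ i) ^ ?p) ` {..<Suc k})" by (simp add: image_image)
  have inj': "inj_on (\<lambda>i. (z ^ i) ^ ?p) {..<Suc k}"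
    using ind(1) inj_frobenius_ac[OF p0] by (auto simp: inj_on_def)
  have "0 = (\<Sum>i\<le>?p * k. to_ac (Polynomial.coeff q i) * z ^ i)"
    using q(2) k by (simp add: eval_ac_altdef)
  \<comment> \<open>Only exponents divisible by p carry a nonzero coefficient; what remains is a
    relation among the p-th powers of z^0, ..., z^k.\<close>
  also have "\<dots> = (\<Sum>i\<in>(\<lambda>i. ?p * i) ` {..<Suc k}. to_ac (Polynomial.coeff q i) * z ^ i)"
  proof (rule sum.mono_neutral_right)
    show "\<forall>i\<in>{..?p * k} - (\<lambda>i. ?p * i) ` {..<Suc k}. to_ac (Polynomial.coeff q i) * z ^ i = 0"
    proof
      fix i assume i: "i \<in> {..?p * k} - (\<lambda>i. ?p * i) ` {..<Suc k}"
      have "\<not> ?p dvd i"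
      proof
        assume "?p dvd i"
        then obtain j where "i = ?p * j" by (elim dvdE)
        then show False using i p0 by (auto simp: less_Suc_eq_le)
      qed
      then show "to_ac (Polynomial.coeff q i) * z ^ i = 0" using dvd by auto
    qed
  qed (auto simp: less_Suc_eq_le)
  also have "\<dots> = (\<Sum>i<Suc k. to_ac (Polynomial.coeff q (?p * i)) * (z ^ i) ^ ?p)"
    using p0 by (subst sum.reindex) (auto simp: inj_on_def power_mult[symmetric] mult.commute)
  finally have "Polynomial.coeff q (?p * k) = 0"
    using ac.independent_familyD[OF _ inj' ind', of "\<lambda>i. Polynomial.coeff q (?p * i)" k] by simp
  then show False using k nz by (metis leading_coeff_0_iff)
qed

text \<open>The products x^i y^j span K[x,y]. Since p-th powers span K[x] and K[y], the p-th powers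
  of these products span K[x,y], and the criterion applies to the sum and the product, all of whose
  powers lie in this span.\<close>

lemma sep_closure_add_mult:
  fixes x y :: "'k::field alg_closure"
  assumes x: "x \<in> sep_closure" and y: "y \<in> sep_closure"
  shows "x + y \<in> sep_closure" "x * y \<in> sep_closure"
proof -
  obtain q where q: "Factorial_Ring.irreducible q" "eval_ac q x = 0" "rsquarefree (map_poly to_ac q)"
    using x unfolding sep_closure_def by blast
  obtain r where r: "Factorial_Ring.irreducible r" "eval_ac r y = 0" "rsquarefree (map_poly to_ac r)"
    using y unfolding sep_closure_def by blast
  let ?X = "(\<lambda>i. x ^ i) ` {..<Polynomial.degree q}" and ?Y = "(\<lambda>i. y ^ i) ` {..<Polynomial.degree r}"
  define S where "S = {a * b |a b. a \<in> ?X \<and> b \<in> ?Y}"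
  have "S = (\<lambda>(a, b). a * b) ` (?X \<times> ?Y)" by (auto simp: S_def)
  then have fin: "finite S" by simp
  have mem: "x ^ i * y ^ j \<in> ac.span S" for i j
    unfolding S_def using span_ac_mult power_mem_span_powers q r by blast
  have S: "S \<subseteq> ac.span ((\<lambda>b. b ^ CHAR('k)) ` S)" if char: "CHAR('k) > 0"
  proof
    fix s assume "s \<in> S"
    then obtain i j where s: "s = x ^ i * y ^ j" by (auto simp: S_def)
    let ?F = "\<lambda>b :: 'k alg_closure. b ^ CHAR('k)"
    have "x ^ i \<in> ac.span (?F ` ?X)" "y ^ j \<in> ac.span (?F ` ?Y)"
      using separable_frobenius_span[OF char q] separable_frobenius_span[OF char r]
      by (simp_all add: image_image)
    then have "s \<in> ac.span {a * b |a b. a \<in> ?F ` ?X \<and> b \<in> ?F ` ?Y}"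
      unfolding s by (rule span_ac_mult)
    moreover have "{a * b |a b. a \<in> ?F ` ?X \<and> b \<in> ?F ` ?Y} \<subseteq> ?F ` S"
    proof
      fix t assume "t \<in> {a * b |a b. a \<in> ?F ` ?X \<and> b \<in> ?F ` ?Y}"
      then obtain a b where "a \<in> ?X" "b \<in> ?Y" "t = ?F a * ?F b" by blast
      then have "a * b \<in> S" "t = ?F (a * b)" unfolding S_def by (blast, simp add: power_mult_distrib)
      then show "t \<in> ?F ` S" by blast
    qed
    ultimately show "s \<in> ac.span (?F ` S)" using ac.span_mono by blast
  qed
  have pow_add: "(x + y) ^ i \<in> ac.span S" for i
  proof -
    \<comment> \<open>The binomial coefficients are written as images of elements of K so that they
      act as scalars.\<close>
    have "(x + y) ^ i = (\<Sum>k\<le>i. to_ac (of_nat (i choose k)) * (x ^ k * y ^ (i - k)))"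
      by (simp add: binomial_ring mult.assoc)
    then show ?thesis by (auto intro!: ac.span_sum ac.span_scale mem simp del: to_ac_of_nat)
  qed
  show "x + y \<in> sep_closure" using fin S pow_add by (rule separable_of_powers_in_span)
  have pow_mult: "(x * y) ^ i \<in> ac.span S" for i using mem[of i i] by (simp add: power_mult_distrib)
  show "x * y \<in> sep_closure" using fin S pow_mult by (rule separable_of_powers_in_span)
qed

lemma to_ac_mem_sep_closure: "to_ac c \<in> sep_closure"
proof (rule separable_of_powers_in_span[of "{1}"])
  show "to_ac c ^ i \<in> ac.span {1}" for i
    using ac.span_scale[OF ac.span_base[of 1 "{1}"], of "c ^ i"] by simp
qed (auto intro: ac.span_base)

section \<open>Extension of embeddings\<close>

text \<open>A partial embedding is represented by its graph: a \<open>K\<close>-subalgebra of the square of the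
  algebraic closure which, by the last condition, is single-valued.\<close>

definition partial_embedding :: "('k::field alg_closure \<times> 'k alg_closure) set \<Rightarrow> bool" where
  "partial_embedding \<Gamma> \<longleftrightarrow> (\<forall>c. (to_ac c, to_ac c) \<in> \<Gamma>) \<and>
     (\<forall>x x' y y'. (x, x') \<in> \<Gamma> \<longrightarrow> (y, y') \<in> \<Gamma> \<longrightarrow> (x + y, x' + y') \<in> \<Gamma> \<and> (x * y, x' * y') \<in> \<Gamma>) \<and>
     (\<forall>y. (0, y) \<in> \<Gamma> \<longrightarrow> y = 0)"

context
  fixes \<Gamma> :: "('k::field alg_closure \<times> 'k alg_closure) set"
  assumes \<Gamma>: "partial_embedding \<Gamma>"
begin

lemma partial_embedding_to_ac: "(to_ac c, to_ac c) \<in> \<Gamma>"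
  using \<Gamma> by (simp add: partial_embedding_def)

lemma partial_embedding_0: "(0, 0) \<in> \<Gamma>"
  using partial_embedding_to_ac[of 0] by simp

lemma partial_embedding_1: "(1, 1) \<in> \<Gamma>"
  using partial_embedding_to_ac[of 1] by simp

lemma partial_embedding_add: "(x, x') \<in> \<Gamma> \<Longrightarrow> (y, y') \<in> \<Gamma> \<Longrightarrow> (x + y, x' + y') \<in> \<Gamma>"
  using \<Gamma> unfolding partial_embedding_def by blast

lemma partial_embedding_mult: "(x, x') \<in> \<Gamma> \<Longrightarrow> (y, y') \<in> \<Gamma> \<Longrightarrow> (x * y, x' * y') \<in> \<Gamma>"
  using \<Gamma> unfolding partial_embedding_def by blast

lemma partial_embedding_0D: "(0, y) \<in> \<Gamma> \<Longrightarrow> y = 0"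
  using \<Gamma> by (simp add: partial_embedding_def)

lemma partial_embedding_diff:
  assumes "(x, x') \<in> \<Gamma>" "(y, y') \<in> \<Gamma>" shows "(x - y, x' - y') \<in> \<Gamma>"
  using partial_embedding_add[OF assms(1) partial_embedding_mult[OF partial_embedding_to_ac[of "- 1"] assms(2)]]
  by simp

lemma partial_embedding_unique:
  assumes "(x, y) \<in> \<Gamma>" "(x, y') \<in> \<Gamma>" shows "y = y'"
  using partial_embedding_0D[of "y - y'"] partial_embedding_diff[OF assms] by simp

lemma partial_embedding_sum:
  assumes "\<And>i. i \<in> I \<Longrightarrow> (g i, g' i) \<in> \<Gamma>" shows "(sum g I, sum g' I) \<in> \<Gamma>"
  using assms by (induction I rule: infinite_finite_induct) (auto intro: partial_embedding_add partial_embedding_0)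

lemma partial_embedding_eval: "(x, x') \<in> \<Gamma> \<Longrightarrow> (eval_ac p x, eval_ac p x') \<in> \<Gamma>"
  by (induction p) (auto intro: partial_embedding_0 partial_embedding_add partial_embedding_mult partial_embedding_to_ac)

text \<open>The domain of \<open>\<Gamma>\<close> is only given as a ring, but its elements are
  algebraic over K: if the minimal polynomial of \<open>x\<close> is c + X r, then c is nonzero and
  the inverse is -r(x)/c, a polynomial in \<open>x\<close>.\<close>

lemma partial_embedding_inverse:
  assumes x: "(x, x') \<in> \<Gamma>" "x \<noteq> 0" obtains y where "(inverse x, y) \<in> \<Gamma>"
proof -
  obtain m :: "'k poly" where m: "m \<noteq> 0" "eval_ac m x = 0" "\<And>r. eval_ac r x = 0 \<Longrightarrow> m dvd r"
    using min_poly_ac[of x] by blast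
  obtain c r where mr: "m = pCons c r" by (cases m)
  have "c \<noteq> 0"
  proof
    assume "c = 0"
    then have "r \<noteq> 0" "eval_ac r x = 0" using m mr x(2) by auto
    then have "Polynomial.degree m \<le> Polynomial.degree r" using m(3) by (intro dvd_imp_degree_le)
    then show False using mr \<open>r \<noteq> 0\<close> by simp
  qed
  have "to_ac c + x * eval_ac r x = 0" using m(2) mr by simp
  then have "x * (to_ac (- 1 / c) * eval_ac r x) = 1"
    using \<open>c \<noteq> 0\<close> by (simp add: field_simps add_eq_0_iff)
  then have "inverse x = to_ac (- 1 / c) * eval_ac r x" by (rule inverse_unique)
  then show thesis
    using that partial_embedding_mult[OF partial_embedding_to_ac partial_embedding_eval[OF x(1)], of "- 1 / c" r] by simp
qed

text \<open>The image of the inverse of \<open>x\<close> is an inverse of \<open>x'\<close>. This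
  keeps leading coefficients nonzero when a polynomial is transported along
  \<open>\<Gamma>\<close>.\<close>

lemma partial_embedding_nonzero:
  assumes x: "(x, x') \<in> \<Gamma>" "x \<noteq> 0" shows "x' \<noteq> 0"
proof
  assume "x' = 0"
  obtain y where y: "(inverse x, y) \<in> \<Gamma>" using partial_embedding_inverse[OF x] by blast
  then have "(1, 0) \<in> \<Gamma>" using partial_embedding_mult[OF x(1) y] x(2) \<open>x' = 0\<close> by simp
  then show False using partial_embedding_unique partial_embedding_1 by fastforce
qed

text \<open>A pair of polynomials matched coefficientwise by \<open>\<Gamma>\<close> stands for a
  polynomial over the domain together with its transport. The set is the graph of the extension of
  \<open>\<Gamma>\<close> that sends \<open>x\<close> to \<open>y\<close>, possibly multivalued for
  an unsuitable \<open>y\<close>.\<close>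

definition adjoin :: "'k alg_closure \<Rightarrow> 'k alg_closure \<Rightarrow> ('k alg_closure \<times> 'k alg_closure) set" where
  "adjoin x y = {(poly q x, poly q' y) |q q'. \<forall>i. (Polynomial.coeff q i, Polynomial.coeff q' i) \<in> \<Gamma>}"

lemma adjoin_extends: "\<Gamma> \<subseteq> adjoin x y" "(x, y) \<in> adjoin x y"
proof -
  have "(a, b) \<in> adjoin x y" if "(a, b) \<in> \<Gamma>" for a b
  proof -
    have "\<forall>i. (Polynomial.coeff [:a:] i, Polynomial.coeff [:b:] i) \<in> \<Gamma>"
      using that partial_embedding_0 by (simp add: coeff_pCons split: nat.splits)
    then have "(poly [:a:] x, poly [:b:] y) \<in> adjoin x y" unfolding adjoin_def by blast
    then show ?thesis by simp
  qed
  then show "\<Gamma> \<subseteq> adjoin x y" by auto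
  show "(x, y) \<in> adjoin x y"
    unfolding adjoin_def using partial_embedding_0 partial_embedding_1
    by (auto intro!: exI[of _ "[:0, 1:]"] simp: coeff_pCons split: nat.splits)
qed

lemma partial_embedding_adjoin:
  assumes "\<And>q q'. \<forall>i. (Polynomial.coeff q i, Polynomial.coeff q' i) \<in> \<Gamma> \<Longrightarrow> poly q x = 0 \<Longrightarrow> poly q' y = 0"
  shows "partial_embedding (adjoin x y)"
  unfolding partial_embedding_def
proof (intro conjI allI impI)
  show "(to_ac c, to_ac c) \<in> adjoin x y" for c using adjoin_extends(1) partial_embedding_to_ac by blast
next
  fix a a' b b' assume "(a, a') \<in> adjoin x y" "(b, b') \<in> adjoin x y"
  then obtain q q' r r' where qr: "a = poly q x" "a' = poly q' y" "b = poly r x" "b' = poly r' y"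
      and q: "\<And>i. (Polynomial.coeff q i, Polynomial.coeff q' i) \<in> \<Gamma>"
      and r: "\<And>i. (Polynomial.coeff r i, Polynomial.coeff r' i) \<in> \<Gamma>"
    unfolding adjoin_def by blast
  have "(Polynomial.coeff (q + r) i, Polynomial.coeff (q' + r') i) \<in> \<Gamma>"
       "(Polynomial.coeff (q * r) i, Polynomial.coeff (q' * r') i) \<in> \<Gamma>" for i
    using q r by (auto simp: coeff_mult intro!: partial_embedding_add partial_embedding_sum partial_embedding_mult)
  then have "(poly (q + r) x, poly (q' + r') y) \<in> adjoin x y" "(poly (q * r) x, poly (q' * r') y) \<in> adjoin x y"
    unfolding adjoin_def by blast+
  then show "(a + b, a' + b') \<in> adjoin x y" "(a * b, a' * b') \<in> adjoin x y" using qr by simp_all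
next
  fix b assume "(0, b) \<in> adjoin x y"
  then obtain q q' where "poly q x = 0" "b = poly q' y" "\<forall>i. (Polynomial.coeff q i, Polynomial.coeff q' i) \<in> \<Gamma>"
    unfolding adjoin_def by auto
  then show "b = 0" using assms by blast
qed

text \<open>Here \<open>p\<close> is the minimal polynomial of \<open>x\<close> over the domain of
  \<open>\<Gamma>\<close>, \<open>p'\<close> its transport and \<open>y\<close> a root of
  \<open>p'\<close>. Dividing by \<open>p\<close> and \<open>p'\<close> in parallel shows that every
  polynomial relation satisfied by \<open>x\<close> transports to one satisfied by
  \<open>y\<close>.\<close>

lemma partial_embedding_extend_one:
  obtains \<Gamma>' y where "partial_embedding \<Gamma>'" "\<Gamma> \<subseteq> \<Gamma>'" "(x, y) \<in> \<Gamma>'"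
proof -
  define P where "P = (\<lambda>(q, q'). q \<noteq> 0 \<and> poly q x = 0 \<and>
    (\<forall>i. (Polynomial.coeff q i, Polynomial.coeff q' i) \<in> \<Gamma>))"
  let ?d = "\<lambda>(q, q' :: 'k alg_closure poly). Polynomial.degree (q :: 'k alg_closure poly)"
  obtain r :: "'k poly" where r: "r \<noteq> 0" "eval_ac r x = 0" by (rule alg_closure_algebraic)
  then have "P (map_poly to_ac r, map_poly to_ac r)"
    by (auto simp: P_def coeff_map_poly partial_embedding_to_ac)
  then have min: "P (arg_min ?d P)" "\<And>qq. P qq \<Longrightarrow> ?d (arg_min ?d P) \<le> ?d qq"
    using arg_min_nat_lemma[of P _ ?d] by blast+
  obtain p p' where pp: "arg_min ?d P = (p, p')" by (cases "arg_min ?d P")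
  have p: "p \<noteq> 0" "poly p x = 0" "\<And>i. (Polynomial.coeff p i, Polynomial.coeff p' i) \<in> \<Gamma>"
    using min(1) unfolding pp by (auto simp: P_def)
  have pmin: "Polynomial.degree p \<le> Polynomial.degree q"
    if "q \<noteq> 0" "poly q x = 0" "\<forall>i. (Polynomial.coeff q i, Polynomial.coeff q' i) \<in> \<Gamma>" for q q'
    using min(2)[of "(q, q')"] that unfolding pp by (simp add: P_def)
  let ?m = "Polynomial.degree p"
  have "?m > 0"
  proof (rule ccontr)
    assume "\<not> ?m > 0"
    then obtain c where "p = [:c:]" by (metis degree_eq_zeroE not_gr_zero)
    then show False using p(1,2) by simp
  qed
  have "Polynomial.coeff p' ?m \<noteq> 0" using partial_embedding_nonzero[OF p(3)[of ?m]] p(1) by simp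
  then have "Polynomial.degree p' > 0" using \<open>?m > 0\<close> le_degree by fastforce
  then obtain y where y: "poly p' y = 0" using alg_closed_imp_poly_has_root by blast
  \<comment> \<open>With \<open>e\<close> as the image of the inverse leading coefficient, the
    leading term can be cancelled on both sides while the coefficients stay matched by
    \<open>\<Gamma>\<close>.\<close>
  obtain e where e: "(inverse (Polynomial.lead_coeff p), e) \<in> \<Gamma>"
    using partial_embedding_inverse[OF p(3)[of ?m]] p(1) by auto
  have "poly q' y = 0"
    if "\<forall>i. (Polynomial.coeff q i, Polynomial.coeff q' i) \<in> \<Gamma>" "poly q x = 0" for q q'
    using that
  proof (induction "length (Polynomial.coeffs q)" arbitrary: q q' rule: less_induct)
    case less
    show ?case
    proof (cases "q = 0")
      case True
      then have "q' = 0" using less.prems(1) partial_embedding_0D by (auto intro!: poly_eqI)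
      then show ?thesis by simp
    next
      case False
      let ?n = "Polynomial.degree q"
      have mn: "?m \<le> ?n" using pmin False less.prems by blast
      define c where "c = Polynomial.lead_coeff q * inverse (Polynomial.lead_coeff p)"
      define c' where "c' = Polynomial.coeff q' ?n * e"
      have c: "(c, c') \<in> \<Gamma>" unfolding c_def c'_def using less.prems(1) e by (intro partial_embedding_mult) auto
      define r where "r = q - Polynomial.monom c (?n - ?m) * p"
      define r' where "r' = q' - Polynomial.monom c' (?n - ?m) * p'"
      have rr: "\<forall>i. (Polynomial.coeff r i, Polynomial.coeff r' i) \<in> \<Gamma>"
        using less.prems(1) p(3) c partial_embedding_0
        by (auto simp: r_def r'_def coeff_monom_mult intro!: partial_embedding_diff partial_embedding_mult)
      have rx: "poly r x = 0" using less.prems(2) p(2) by (simp add: r_def)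
      have r0: "Polynomial.coeff r i = 0" if "i \<ge> ?n" for i
      proof (cases "i = ?n")
        case True
        then show ?thesis using mn p(1) by (simp add: r_def coeff_monom_mult c_def)
      next
        case False
        then have "i > ?n" "i - (?n - ?m) > ?m" using that mn by auto
        then show ?thesis by (simp add: r_def coeff_monom_mult coeff_eq_0)
      qed
      have "length (Polynomial.coeffs r) < length (Polynomial.coeffs q)"
      proof (cases "r = 0")
        case True
        then show ?thesis using False by simp
      next
        case r: False
        have "Polynomial.degree r < ?n" using r0[of "Polynomial.degree r"] r by (meson leading_coeff_0_iff not_le)
        then show ?thesis using r False by (simp add: length_coeffs_degree)
      qed
      then have "poly r' y = 0" using less.hyps rr rx by blast
      then show ?thesis using y by (simp add: r'_def)
    qed
  qed
  then have "partial_embedding (adjoin x y)" by (intro partial_embedding_adjoin) blast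
  then show thesis using adjoin_extends by (rule that)
qed

end

lemma partial_embedding_Union_chain:
  assumes "\<C> \<noteq> {}" "subset.chain {\<Gamma>. partial_embedding \<Gamma>} \<C>"
  shows "partial_embedding (\<Union>\<C>)"
  unfolding partial_embedding_def
proof (intro conjI allI impI)
  have emb: "partial_embedding \<Gamma>" if "\<Gamma> \<in> \<C>" for \<Gamma> using assms(2) that by (auto simp: subset.chain_def)
  show "(to_ac c, to_ac c) \<in> \<Union>\<C>" for c using emb assms(1) partial_embedding_to_ac by blast
  show "y = 0" if "(0, y) \<in> \<Union>\<C>" for y using emb that partial_embedding_0D by blast
  fix x x' y y' assume "(x, x') \<in> \<Union>\<C>" "(y, y') \<in> \<Union>\<C>"
  then obtain \<Gamma> where "\<Gamma> \<in> \<C>" "(x, x') \<in> \<Gamma>" "(y, y') \<in> \<Gamma>"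
    using assms(2) by (auto simp: subset_chain_def) (metis subsetD)
  then show "(x + y, x' + y') \<in> \<Union>\<C>" "(x * y, x' * y') \<in> \<Union>\<C>"
    using emb partial_embedding_add partial_embedding_mult by blast+
qed

text \<open>By Zorn there is a maximal extension; it is defined everywhere, since otherwise one more
  element could be adjoined, and single-valuedness makes it a function.\<close>

lemma partial_embedding_extend:
  fixes \<Gamma> :: "('k::field alg_closure \<times> 'k alg_closure) set"
  assumes "partial_embedding \<Gamma>"
  obtains \<sigma> where "\<And>x y. \<sigma> (x + y) = \<sigma> x + \<sigma> y" "\<And>x y. \<sigma> (x * y) = \<sigma> x * \<sigma> y"
    "\<And>c. \<sigma> (to_ac c) = to_ac c" "\<And>x y. (x, y) \<in> \<Gamma> \<Longrightarrow> \<sigma> x = y"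
proof -
  let ?A = "{\<Gamma>'. partial_embedding \<Gamma>' \<and> \<Gamma> \<subseteq> \<Gamma>'}"
  have "\<exists>M\<in>?A. \<forall>N\<in>?A. M \<subseteq> N \<longrightarrow> N = M"
  proof (rule subset_Zorn_nonempty)
    show "?A \<noteq> {}" using assms by blast
    fix \<C> assume C: "\<C> \<noteq> {}" "subset.chain ?A \<C>"
    then have "partial_embedding (\<Union>\<C>)"
      by (intro partial_embedding_Union_chain) (auto simp: subset.chain_def)
    moreover have "\<Gamma> \<subseteq> \<Union>\<C>"
    proof -
      obtain N where "N \<in> \<C>" using C(1) by blast
      moreover have "\<Gamma> \<subseteq> N" using C(2) \<open>N \<in> \<C>\<close> unfolding subset.chain_def by blast
      ultimately show ?thesis by blast
    qed
    ultimately show "\<Union>\<C> \<in> ?A" by blast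
  qed
  then obtain M where "M \<in> ?A" and max: "\<And>N. N \<in> ?A \<Longrightarrow> M \<subseteq> N \<Longrightarrow> N = M" by metis
  then have M: "partial_embedding M" "\<Gamma> \<subseteq> M" by simp_all
  have "\<exists>y. (x, y) \<in> M" for x
  proof -
    obtain M' y where "partial_embedding M'" "M \<subseteq> M'" "(x, y) \<in> M'"
      by (rule partial_embedding_extend_one[OF M(1), of x])
    then show ?thesis using M(2) max[of M'] by auto
  qed
  then obtain \<sigma> where \<sigma>: "\<And>x. (x, \<sigma> x) \<in> M" by metis
  have eq: "\<sigma> x = y" if "(x, y) \<in> M" for x y using partial_embedding_unique[OF M(1)] \<sigma> that by blast
  show thesis
  proof (rule that[of \<sigma>])
    show "\<sigma> (x + y) = \<sigma> x + \<sigma> y" "\<sigma> (x * y) = \<sigma> x * \<sigma> y" for x y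
      using partial_embedding_add[OF M(1)] partial_embedding_mult[OF M(1)] \<sigma> eq by blast+
    show "\<sigma> (to_ac c) = to_ac c" for c using partial_embedding_to_ac[OF M(1)] eq by blast
    show "\<sigma> x = y" if "(x, y) \<in> \<Gamma>" for x y using that M(2) eq by blast
  qed
qed

section \<open>The Galois action on the separable closure\<close>

lemma eval_ac_mem_sep_closure:
  "x \<in> sep_closure \<Longrightarrow> eval_ac p x \<in> sep_closure"
  using to_ac_mem_sep_closure[of 0]
  by (induction p) (auto intro!: sep_closure_add_mult to_ac_mem_sep_closure)

lemma root_mem_sep_closure:
  assumes "x \<in> sep_closure" obtains q where "Factorial_Ring.irreducible q" "eval_ac q x = 0"
    "{y. eval_ac q y = 0} \<subseteq> sep_closure"
  using assms unfolding sep_closure_def by blast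

lemma abs_galois_groupD:
  assumes "\<tau> \<in> carrier abs_galois_group"
  shows "\<tau> \<in> Bij sep_closure" "\<tau> (to_ac c) = to_ac c"
    "x \<in> sep_closure \<Longrightarrow> y \<in> sep_closure \<Longrightarrow> \<tau> (x + y) = \<tau> x + \<tau> y"
    "x \<in> sep_closure \<Longrightarrow> y \<in> sep_closure \<Longrightarrow> \<tau> (x * y) = \<tau> x * \<tau> y"
    "x \<in> sep_closure \<Longrightarrow> \<tau> x \<in> sep_closure"
  using assms Bij_imp_funcset[of \<tau> sep_closure] by (auto simp: abs_galois_group_def)

lemma abs_galois_group_eval:
  assumes \<tau>: "\<tau> \<in> carrier abs_galois_group" and x: "x \<in> sep_closure"
  shows "\<tau> (eval_ac p x) = eval_ac p (\<tau> x)"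
proof (induction p)
  case 0
  then show ?case using abs_galois_groupD(2)[OF \<tau>, of 0] by simp
next
  case (pCons c p)
  have "x * eval_ac p x \<in> sep_closure" using x by (intro sep_closure_add_mult eval_ac_mem_sep_closure)
  then show ?case
    using pCons x by (simp add: abs_galois_groupD[OF \<tau>] to_ac_mem_sep_closure eval_ac_mem_sep_closure)
qed

text \<open>The extended map sends the finite root set of each irreducible polynomial injectively
  into itself, hence onto itself. As \<open>sep_closure\<close> is a union of such root sets, it is
  permuted.\<close>

lemma abs_galois_group_extend:
  fixes \<Gamma> :: "('k::field alg_closure \<times> 'k alg_closure) set"
  assumes "partial_embedding \<Gamma>"
  obtains \<tau> where "\<tau> \<in> carrier abs_galois_group" "\<And>x y. (x, y) \<in> \<Gamma> \<Longrightarrow> x \<in> sep_closure \<Longrightarrow> \<tau> x = y"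
proof -
  obtain \<sigma> where \<sigma>: "\<And>x y. \<sigma> (x + y) = \<sigma> x + \<sigma> y" "\<And>x y. \<sigma> (x * y) = \<sigma> x * \<sigma> y"
      "\<And>c. \<sigma> (to_ac c) = to_ac c" "\<And>x y. (x, y) \<in> \<Gamma> \<Longrightarrow> \<sigma> x = y"
    using partial_embedding_extend[OF assms] by blast
  have \<sigma>0: "\<sigma> 0 = 0" using \<sigma>(3)[of 0] by simp
  have eval: "\<sigma> (eval_ac p x) = eval_ac p (\<sigma> x)" for p x
    by (induction p) (simp_all add: \<sigma> \<sigma>0)
  have inj: "inj \<sigma>"
  proof (rule injI, rule ccontr)
    fix x y assume xy: "\<sigma> x = \<sigma> y" "x \<noteq> y"
    have "\<sigma> (x - y) + \<sigma> y = \<sigma> x" using \<sigma>(1)[of "x - y" y] by simp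
    then have "\<sigma> (x - y) = 0" using xy by simp
    moreover have "\<sigma> (x - y) * \<sigma> (inverse (x - y)) = 1" using xy \<sigma>(2)[of "x - y" "inverse (x - y)"] \<sigma>(3)[of 1] by simp
    ultimately show False by simp
  qed
  have bij: "bij_betw \<sigma> sep_closure sep_closure"
  proof (rule bij_betw_imageI)
    show "inj_on \<sigma> sep_closure" using inj by (rule inj_on_subset) simp
    have *: "\<sigma> ` {y. eval_ac q y = 0} = {y. eval_ac q y = 0}" if "Factorial_Ring.irreducible q" for q
    proof (rule endo_inj_surj)
      show "finite {y. eval_ac q y = 0}" using that by (intro finite_eval_ac_roots) auto
      show "\<sigma> ` {y. eval_ac q y = 0} \<subseteq> {y. eval_ac q y = 0}" using eval[of q] \<sigma>0 by (auto simp flip: eval)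
      show "inj_on \<sigma> {y. eval_ac q y = 0}" using inj by (rule inj_on_subset) simp
    qed
    show "\<sigma> ` sep_closure = sep_closure"
    proof (intro equalityI subsetI)
      fix y assume "y \<in> \<sigma> ` sep_closure"
      then obtain x where x: "x \<in> sep_closure" "y = \<sigma> x" by blast
      then obtain q where q: "Factorial_Ring.irreducible q" "eval_ac q x = 0" "{y. eval_ac q y = 0} \<subseteq> sep_closure"
        using root_mem_sep_closure by blast
      then have "y \<in> {y. eval_ac q y = 0}" using *[OF q(1)] x(2) by blast
      then show "y \<in> sep_closure" using q(3) by blast
    next
      fix y :: "'k alg_closure" assume "y \<in> sep_closure"
      then obtain q where q: "Factorial_Ring.irreducible q" "eval_ac q y = 0" "{y. eval_ac q y = 0} \<subseteq> sep_closure"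
        using root_mem_sep_closure by blast
      then have "y \<in> \<sigma> ` {y. eval_ac q y = 0}" using *[OF q(1)] by blast
      then show "y \<in> \<sigma> ` sep_closure" using q(3) by blast
    qed
  qed
  show thesis
  proof (rule that[of "restrict \<sigma> sep_closure"])
    show "restrict \<sigma> sep_closure \<in> carrier abs_galois_group"
      using bij \<sigma> by (auto simp: abs_galois_group_def Bij_def to_ac_mem_sep_closure sep_closure_add_mult
          cong: bij_betw_cong)
    show "restrict \<sigma> sep_closure x = y" if "(x, y) \<in> \<Gamma>" "x \<in> sep_closure" for x y
      using that \<sigma>(4) by simp
  qed
qed

text \<open>Sending p(x) to p(y) is well defined, because every p that vanishes at \<open>x\<close>
  is a multiple of \<open>q\<close> and so vanishes at \<open>y\<close>.\<close>

lemma abs_galois_group_transitive: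
  assumes q: "Factorial_Ring.irreducible q" "eval_ac q x = 0" "eval_ac q y = 0" and x: "x \<in> sep_closure"
  obtains \<tau> where "\<tau> \<in> carrier abs_galois_group" "\<tau> x = y"
proof -
  let ?\<Gamma> = "{(eval_ac p x, eval_ac p y) |p. True}"
  have eval: "(eval_ac p x, eval_ac p y) \<in> ?\<Gamma>" for p by blast
  have "partial_embedding ?\<Gamma>"
    unfolding partial_embedding_def
  proof (intro conjI allI impI)
    show "(to_ac c, to_ac c) \<in> ?\<Gamma>" for c using eval[of "[:c:]"] by simp
    show "b = 0" if b: "(0, b) \<in> ?\<Gamma>" for b
    proof -
      obtain p where p: "eval_ac p x = 0" "b = eval_ac p y" using b by auto
      show "b = 0" using eval_ac_dvd[OF irreducible_dvd_of_root[OF q(1,2) p(1)] q(3)] p(2) by simp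
    qed
    fix a a' b b' assume "(a, a') \<in> ?\<Gamma>" "(b, b') \<in> ?\<Gamma>"
    then obtain p r where "a = eval_ac p x" "a' = eval_ac p y" "b = eval_ac r x" "b' = eval_ac r y"
      by blast
    then show "(a + b, a' + b') \<in> ?\<Gamma>" "(a * b, a' * b') \<in> ?\<Gamma>"
      using eval[of "p + r"] eval[of "p * r"] by simp_all
  qed
  then obtain \<tau> where "\<tau> \<in> carrier abs_galois_group" "\<And>a b. (a, b) \<in> ?\<Gamma> \<Longrightarrow> a \<in> sep_closure \<Longrightarrow> \<tau> a = b"
    by (rule abs_galois_group_extend) blast
  then show thesis using that eval[of "[:0, 1:]"] x by simp
qed

lemma abs_galois_group_limit:
  fixes \<tau> :: "nat \<Rightarrow> 'k::field alg_closure \<Rightarrow> 'k alg_closure"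
  assumes \<tau>: "\<And>n. \<tau> n \<in> carrier abs_galois_group"
  obtains \<sigma> where "\<sigma> \<in> carrier abs_galois_group"
    "\<And>x y N. x \<in> sep_closure \<Longrightarrow> (\<And>n. n \<ge> N \<Longrightarrow> \<tau> n x = y) \<Longrightarrow> \<sigma> x = y"
proof -
  let ?\<Gamma> = "{(x, y). x \<in> sep_closure \<and> (\<exists>N. \<forall>n\<ge>N. \<tau> n x = y)}"
  note D = abs_galois_groupD[OF \<tau>]
  have "partial_embedding ?\<Gamma>"
    unfolding partial_embedding_def
  proof (intro conjI allI impI)
    show "(to_ac c, to_ac c) \<in> ?\<Gamma>" for c by (auto simp: D to_ac_mem_sep_closure)
    show "b = 0" if "(0, b) \<in> ?\<Gamma>" for b using that D(2)[of _ 0] by auto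
    fix a a' b b' assume "(a, a') \<in> ?\<Gamma>" "(b, b') \<in> ?\<Gamma>"
    then obtain M N where *: "a \<in> sep_closure" "b \<in> sep_closure" "\<And>n. n \<ge> M \<Longrightarrow> \<tau> n a = a'" "\<And>n. n \<ge> N \<Longrightarrow> \<tau> n b = b'"
      by blast
    then show "(a + b, a' + b') \<in> ?\<Gamma>" "(a * b, a' * b') \<in> ?\<Gamma>"
      by (auto simp: D sep_closure_add_mult intro!: exI[of _ "max M N"])
  qed
  then obtain \<sigma> where "\<sigma> \<in> carrier abs_galois_group" "\<And>a b. (a, b) \<in> ?\<Gamma> \<Longrightarrow> a \<in> sep_closure \<Longrightarrow> \<sigma> a = b"
    by (rule abs_galois_group_extend) blast
  then show thesis by (intro that) auto
qed

lemma subgroup_abs_galois_group: "subgroup (carrier abs_galois_group) (BijGroup sep_closure)"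
proof
  show "carrier abs_galois_group \<subseteq> carrier (BijGroup sep_closure)"
    by (auto simp: abs_galois_group_def BijGroup_def)
  show "\<one>\<^bsub>BijGroup sep_closure\<^esub> \<in> carrier abs_galois_group"
    by (auto simp: abs_galois_group_def BijGroup_def id_Bij sep_closure_add_mult to_ac_mem_sep_closure)
next
  fix \<sigma> \<tau> :: "'a alg_closure \<Rightarrow> 'a alg_closure"
  assume \<sigma>: "\<sigma> \<in> carrier abs_galois_group" and \<tau>: "\<tau> \<in> carrier abs_galois_group"
  note D = abs_galois_groupD[OF \<sigma>] abs_galois_groupD[OF \<tau>]
  have "compose sep_closure \<sigma> \<tau> \<in> carrier abs_galois_group"
    unfolding abs_galois_group_def
    by (auto simp: compose_Bij D compose_eq sep_closure_add_mult to_ac_mem_sep_closure)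
  then show "\<sigma> \<otimes>\<^bsub>BijGroup sep_closure\<^esub> \<tau> \<in> carrier abs_galois_group"
    by (simp add: BijGroup_def D)
next
  fix \<sigma> :: "'a alg_closure \<Rightarrow> 'a alg_closure"
  assume \<sigma>: "\<sigma> \<in> carrier abs_galois_group"
  note D = abs_galois_groupD[OF \<sigma>]
  let ?\<rho> = "inv_into sep_closure \<sigma>"
  have bij: "bij_betw \<sigma> sep_closure sep_closure" using D(1) by (simp add: Bij_def)
  have mem: "?\<rho> x \<in> sep_closure" "\<sigma> (?\<rho> x) = x" if "x \<in> sep_closure" for x
    using bij that by (simp_all add: bij_betw_def inv_into_into f_inv_into_f)
  have eq: "?\<rho> x = y" if "y \<in> sep_closure" "\<sigma> y = x" for x y
    using bij that by (auto simp: bij_betw_def)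
  have "(\<lambda>x\<in>sep_closure. ?\<rho> x) \<in> carrier abs_galois_group"
    unfolding abs_galois_group_def
    using restrict_inv_into_Bij[OF D(1)]
    by (auto simp: sep_closure_add_mult to_ac_mem_sep_closure mem D intro!: eq)
  then show "inv\<^bsub>BijGroup sep_closure\<^esub> \<sigma> \<in> carrier abs_galois_group"
    by (simp add: inv_BijGroup D)
qed

section \<open>Topologies generated by finite agreement\<close>

definition agree :: "(nat \<Rightarrow> 'a \<Rightarrow> 'b) \<Rightarrow> nat \<Rightarrow> 'a \<Rightarrow> 'a \<Rightarrow> bool" where
  "agree g n x y \<longleftrightarrow> (\<forall>k\<le>n. g k x = g k y)"

text \<open>The topology is the one induced by the maps \<open>g k\<close> into discrete spaces.\<close>

definition level_topology :: "'a topology \<Rightarrow> (nat \<Rightarrow> 'a \<Rightarrow> 'b) \<Rightarrow> bool" where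
  "level_topology T g \<longleftrightarrow> (\<forall>U. openin T U \<longleftrightarrow>
     U \<subseteq> topspace T \<and> (\<forall>x\<in>U. \<exists>n. \<forall>y\<in>topspace T. agree g n x y \<longrightarrow> y \<in> U))"

lemma agree_refl [simp]: "agree g n x x"
  by (simp add: agree_def)

lemma agree_sym: "agree g n x y \<longleftrightarrow> agree g n y x"
  by (auto simp: agree_def)

lemma agree_trans: "agree g n x y \<Longrightarrow> agree g n y z \<Longrightarrow> agree g n x z"
  by (simp add: agree_def)

lemma agree_mono: "agree g n x y \<Longrightarrow> m \<le> n \<Longrightarrow> agree g m x y"
  by (simp add: agree_def)

lemma level_topologyD:
  assumes "level_topology T g" "openin T U" "x \<in> U"
  shows "\<exists>n. \<forall>y\<in>topspace T. agree g n x y \<longrightarrow> y \<in> U"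
  using assms(1)[unfolded level_topology_def, THEN spec, of U] assms(2,3) by simp

lemma level_topologyI:
  assumes "level_topology T g" "U \<subseteq> topspace T"
    and "\<And>x. x \<in> U \<Longrightarrow> \<exists>n. \<forall>y\<in>topspace T. agree g n x y \<longrightarrow> y \<in> U"
  shows "openin T U"
  using assms(1)[unfolded level_topology_def, THEN spec, of U] assms(2,3) by simp

lemma level_topology_ball:
  assumes "level_topology T g" shows "openin T {y \<in> topspace T. agree g n x y}"
proof (rule level_topologyI[OF assms])
  fix y assume "y \<in> {y \<in> topspace T. agree g n x y}"
  then show "\<exists>m. \<forall>z\<in>topspace T. agree g m y z \<longrightarrow> z \<in> {y \<in> topspace T. agree g n x y}"
    by (auto intro: exI[of _ n] agree_trans[of g n x y])
qed auto

text \<open>Agreement up to \<open>n\<close> is an equivalence relation, so the complement of a ball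
  is a union of balls.\<close>

lemma level_topology_ball_closed:
  assumes "level_topology T g" shows "closedin T {y \<in> topspace T. agree g n x y}"
  unfolding closedin_def
proof
  show "openin T (topspace T - {y \<in> topspace T. agree g n x y})"
  proof (rule level_topologyI[OF assms])
    fix y assume y: "y \<in> topspace T - {y \<in> topspace T. agree g n x y}"
    have "\<not> agree g n x z" if "agree g n y z" for z
      using y that agree_trans[of g n x z y] agree_sym[of g n y z] by blast
    then show "\<exists>m. \<forall>z\<in>topspace T. agree g m y z \<longrightarrow> z \<in> topspace T - {y \<in> topspace T. agree g n x y}"
      by blast
  qed auto
qed auto

text \<open>A basic open box constrains only finitely many coordinates, so some \<open>N\<close>
  bounds them all; conversely the sequences that agree with \<open>x\<close> up to \<open>N\<close>
  form an open box.\<close>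

lemma level_topology_product:
  "level_topology (product_topology (\<lambda>n. discrete_topology (V n)) UNIV) (\<lambda>k u. u k)"
  unfolding level_topology_def
proof (intro allI iffI)
  let ?T = "product_topology (\<lambda>n. discrete_topology (V n)) UNIV"
  fix U assume U: "openin ?T U"
  show "U \<subseteq> topspace ?T \<and> (\<forall>x\<in>U. \<exists>n. \<forall>y\<in>topspace ?T. agree (\<lambda>k u. u k) n x y \<longrightarrow> y \<in> U)"
  proof (intro conjI ballI)
    show "U \<subseteq> topspace ?T" using U by (rule openin_subset)
    fix x assume x: "x \<in> U"
    obtain W where W: "finite {n. W n \<noteq> topspace (discrete_topology (V n))}"
        "x \<in> PiE UNIV W" "PiE UNIV W \<subseteq> U"
      using U x unfolding openin_product_topology_alt by auto
    obtain N where N: "\<And>n. W n \<noteq> V n \<Longrightarrow> n \<le> N"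
      using W(1) by (auto simp: finite_nat_set_iff_bounded_le)
    have "y \<in> U" if y: "y \<in> topspace ?T" "agree (\<lambda>k u. u k) N x y" for y
    proof -
      have "y n \<in> W n" for n
      proof (cases "n \<le> N")
        case True
        then have "x n = y n" using y(2) by (simp add: agree_def)
        then show ?thesis using W(2) by (metis PiE_iff UNIV_I)
      next
        case False
        then show ?thesis using N[of n] y(1) by (auto simp: PiE_iff)
      qed
      then show ?thesis using W(3) by auto
    qed
    then show "\<exists>n. \<forall>y\<in>topspace ?T. agree (\<lambda>k u. u k) n x y \<longrightarrow> y \<in> U" by blast
  qed
next
  let ?T = "product_topology (\<lambda>n. discrete_topology (V n)) UNIV"
  fix U assume U: "U \<subseteq> topspace ?T \<and> (\<forall>x\<in>U. \<exists>n. \<forall>y\<in>topspace ?T. agree (\<lambda>k u. u k) n x y \<longrightarrow> y \<in> U)"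
  show "openin ?T U"
  proof (subst openin_subopen, intro ballI)
    fix x assume x: "x \<in> U"
    then obtain N where N: "\<And>y. y \<in> topspace ?T \<Longrightarrow> agree (\<lambda>k u. u k) N x y \<Longrightarrow> y \<in> U" using U by blast
    have xV: "x n \<in> V n" for n using U x by (auto simp: PiE_iff)
    let ?B = "PiE UNIV (\<lambda>n. if n \<le> N then {x n} else V n)"
    have "openin ?T ?B"
      unfolding openin_PiE_gen
    proof (intro disjI2 conjI ballI)
      show "finite {i \<in> UNIV. (if i \<le> N then {x i} else V i) \<noteq> topspace (discrete_topology (V i))}"
        by (rule finite_subset[of _ "{..N}"]) auto
    qed (use xV in auto)
    moreover have "x \<in> ?B" using xV by auto
    moreover have "?B \<subseteq> U"
    proof
      fix y assume "y \<in> ?B"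
      then have *: "y n \<in> (if n \<le> N then {x n} else V n)" for n by (auto simp: PiE_iff)
      have "y n \<in> V n" for n using *[of n] xV[of n] by (auto split: if_splits)
      moreover have "agree (\<lambda>k u. u k) N x y"
        unfolding agree_def
      proof (intro allI impI)
        show "x k = y k" if "k \<le> N" for k using *[of k] that by simp
      qed
      ultimately show "y \<in> U" using N by (auto simp: PiE_iff)
    qed
    ultimately show "\<exists>T. openin ?T T \<and> x \<in> T \<and> T \<subseteq> U" by blast
  qed
qed

lemma level_topology_pullback:
  assumes "level_topology T g"
  shows "level_topology (pullback_topology A h T) (\<lambda>k x. g k (h x))"
  unfolding level_topology_def
proof (intro allI iffI)
  let ?P = "pullback_topology A h T"
  have top: "topspace ?P = h -` topspace T \<inter> A" by (rule topspace_pullback_topology)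
  fix U
  {
    assume "openin ?P U"
    then obtain W where W: "openin T W" "U = h -` W \<inter> A" by (auto simp: openin_pullback_topology)
    have "\<exists>n. \<forall>y\<in>topspace ?P. agree (\<lambda>k x. g k (h x)) n x y \<longrightarrow> y \<in> U" if "x \<in> U" for x
    proof -
      obtain n where "\<And>y. y \<in> topspace T \<Longrightarrow> agree g n (h x) y \<Longrightarrow> y \<in> W"
        using level_topologyD[OF assms W(1), of "h x"] \<open>x \<in> U\<close> W(2) by blast
      then show ?thesis using W(2) top by (auto simp: agree_def intro!: exI[of _ n])
    qed
    then show "U \<subseteq> topspace ?P \<and> (\<forall>x\<in>U. \<exists>n. \<forall>y\<in>topspace ?P. agree (\<lambda>k x. g k (h x)) n x y \<longrightarrow> y \<in> U)"
      using \<open>openin ?P U\<close> openin_subset by blast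
  next
    assume U: "U \<subseteq> topspace ?P \<and> (\<forall>x\<in>U. \<exists>n. \<forall>y\<in>topspace ?P. agree (\<lambda>k x. g k (h x)) n x y \<longrightarrow> y \<in> U)"
    then obtain n where n: "\<And>x y. x \<in> U \<Longrightarrow> y \<in> topspace ?P \<Longrightarrow> agree (\<lambda>k x. g k (h x)) (n x) x y \<Longrightarrow> y \<in> U"
      by metis
    \<comment> \<open>An open set of \<open>T\<close> with preimage \<open>U\<close>: the union of
      the balls around the images of the points of \<open>U\<close>.\<close>
    let ?W = "\<Union>x\<in>U. {y \<in> topspace T. agree g (n x) (h x) y}"
    have "openin T ?W" using level_topology_ball[OF assms] by blast
    moreover have "U = h -` ?W \<inter> A"
    proof (intro equalityI subsetI)
      show "x \<in> h -` ?W \<inter> A" if "x \<in> U" for x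
        using that U top by (auto intro!: bexI[of _ x])
      fix y assume y: "y \<in> h -` ?W \<inter> A"
      then obtain x where "x \<in> U" "h y \<in> topspace T" "agree g (n x) (h x) (h y)" by blast
      then show "y \<in> U" using n[of x y] y top by (simp add: agree_def)
    qed
    ultimately show "openin ?P U" by (auto simp: openin_pullback_topology)
  }
qed

lemma level_topology_subtopology:
  assumes "level_topology T g" shows "level_topology (subtopology T S) g"
proof -
  have "subtopology T S = pullback_topology S id T"
    by (auto simp: topology_eq openin_subtopology openin_pullback_topology)
  then show ?thesis using level_topology_pullback[OF assms, of S id] by simp
qed

lemma level_topology_prod:
  assumes "level_topology T g" "level_topology T' g'"
  shows "level_topology (prod_topology T T') (\<lambda>k p. (g k (fst p), g' k (snd p)))"
  unfolding level_topology_def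
proof (intro allI iffI)
  let ?P = "prod_topology T T'" and ?g = "\<lambda>k p. (g k (fst p), g' k (snd p))"
  have agree: "agree ?g n (x, x') (y, y') \<longleftrightarrow> agree g n x y \<and> agree g' n x' y'" for n x y x' y'
    by (auto simp: agree_def)
  fix U
  {
    assume U: "openin ?P U"
    have "\<exists>n. \<forall>q\<in>topspace ?P. agree ?g n p q \<longrightarrow> q \<in> U" if "p \<in> U" for p
    proof -
      obtain x x' where p: "p = (x, x')" by (cases p)
      then have "(x, x') \<in> U" using that by simp
      then have "\<exists>W W'. openin T W \<and> openin T' W' \<and> x \<in> W \<and> x' \<in> W' \<and> W \<times> W' \<subseteq> U"
        using U[unfolded openin_prod_topology_alt] by simp
      then obtain W W' where W: "openin T W" "openin T' W'" "x \<in> W" "x' \<in> W'" "W \<times> W' \<subseteq> U"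
        by blast
      obtain n where n: "\<And>y. y \<in> topspace T \<Longrightarrow> agree g n x y \<Longrightarrow> y \<in> W"
        using level_topologyD[OF assms(1) W(1,3)] by blast
      obtain n' where n': "\<And>y. y \<in> topspace T' \<Longrightarrow> agree g' n' x' y \<Longrightarrow> y \<in> W'"
        using level_topologyD[OF assms(2) W(2,4)] by blast
      have "(y, y') \<in> U" if "y \<in> topspace T" "y' \<in> topspace T'" "agree ?g (max n n') p (y, y')" for y y'
      proof -
        have "agree g n x y" "agree g' n' x' y'" using that(3) unfolding p agree by (auto intro: agree_mono)
        then show ?thesis using n n' W(5) that(1,2) by blast
      qed
      then show ?thesis by (intro exI[of _ "max n n'"]) auto
    qed
    then show "U \<subseteq> topspace ?P \<and> (\<forall>p\<in>U. \<exists>n. \<forall>q\<in>topspace ?P. agree ?g n p q \<longrightarrow> q \<in> U)"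
      using openin_subset[OF U] by blast
  next
    assume U: "U \<subseteq> topspace ?P \<and> (\<forall>p\<in>U. \<exists>n. \<forall>q\<in>topspace ?P. agree ?g n p q \<longrightarrow> q \<in> U)"
    show "openin ?P U"
      unfolding openin_prod_topology_alt
    proof (intro allI impI)
      fix x x' assume xU: "(x, x') \<in> U"
      then obtain n where n: "\<And>q. q \<in> topspace ?P \<Longrightarrow> agree ?g n (x, x') q \<Longrightarrow> q \<in> U" using U by blast
      let ?W = "{y \<in> topspace T. agree g n x y}" and ?W' = "{y \<in> topspace T'. agree g' n x' y}"
      have "x \<in> ?W" "x' \<in> ?W'" using xU U by auto
      moreover have "?W \<times> ?W' \<subseteq> U" using n agree by auto
      ultimately show "\<exists>W W'. openin T W \<and> openin T' W' \<and> x \<in> W \<and> x' \<in> W' \<and> W \<times> W' \<subseteq> U"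
        using level_topology_ball[OF assms(1)] level_topology_ball[OF assms(2)]
        by (intro exI[of _ ?W] exI[of _ ?W'] conjI)
    qed
  }
qed

text \<open>A uniform criterion: \<open>m\<close> may depend on \<open>n\<close> but not on the
  points.\<close>

lemma level_topology_continuous_map:
  assumes T: "level_topology T g" and T': "level_topology T' g'"
    and h: "h \<in> topspace T \<rightarrow> topspace T'"
    and agree: "\<And>n. \<exists>m. \<forall>x\<in>topspace T. \<forall>y\<in>topspace T. agree g m x y \<longrightarrow> agree g' n (h x) (h y)"
  shows "continuous_map T T' h"
  unfolding continuous_map_def
proof (intro conjI allI impI)
  fix U assume U: "openin T' U"
  have "\<exists>m. \<forall>y\<in>topspace T. agree g m x y \<longrightarrow> y \<in> {x \<in> topspace T. h x \<in> U}"
    if x: "x \<in> {x \<in> topspace T. h x \<in> U}" for x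
  proof -
    obtain n where n: "\<And>y. y \<in> topspace T' \<Longrightarrow> agree g' n (h x) y \<Longrightarrow> y \<in> U"
      using level_topologyD[OF T' U] x by blast
    obtain m where "\<And>x y. x \<in> topspace T \<Longrightarrow> y \<in> topspace T \<Longrightarrow> agree g m x y \<Longrightarrow> agree g' n (h x) (h y)"
      using agree by blast
    then show ?thesis using n h x by (intro exI[of _ m]) blast
  qed
  then show "openin T {x \<in> topspace T. h x \<in> U}"
    by (intro level_topologyI[OF T]) auto
qed (fact h)

text \<open>The levelwise form of a surjective isometry; being an equivalence, the condition passes
  to the inverse map.\<close>

lemma level_topology_homeomorphic_map:
  assumes T: "level_topology T g" and T': "level_topology T' g'"
    and h: "bij_betw h (topspace T) (topspace T')"
    and agree: "\<And>n x y. x \<in> topspace T \<Longrightarrow> y \<in> topspace T \<Longrightarrow> agree g' n (h x) (h y) \<longleftrightarrow> agree g n x y"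
  shows "homeomorphic_map T T' h"
proof -
  let ?i = "inv_into (topspace T) h"
  have i: "?i y \<in> topspace T" "h (?i y) = y" if "y \<in> topspace T'" for y
    using h that by (auto simp: bij_betw_def inv_into_into f_inv_into_f)
  have "homeomorphic_maps T T' h ?i"
    unfolding homeomorphic_maps_def
  proof (intro conjI ballI)
    show "continuous_map T T' h"
      using h agree by (intro level_topology_continuous_map[OF T T']) (auto simp: bij_betw_def)
    show "continuous_map T' T ?i"
    proof (rule level_topology_continuous_map[OF T' T])
      show "\<exists>m. \<forall>x\<in>topspace T'. \<forall>y\<in>topspace T'. agree g' m x y \<longrightarrow> agree g n (?i x) (?i y)" for n
        using agree i by metis
    qed (use i in blast)
    show "?i (h x) = x" if "x \<in> topspace T" for x using h that by (simp add: bij_betw_def)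
  qed (use i in blast)
  then show ?thesis unfolding homeomorphic_map_maps by blast
qed

lemma level_topology_closure_of:
  assumes "level_topology T g"
  shows "Abstract_Topology.closure_of T S = {x \<in> topspace T. \<forall>n. \<exists>y\<in>S \<inter> topspace T. agree g n x y}"
proof (intro equalityI subsetI CollectI conjI allI)
  fix x n assume x: "x \<in> Abstract_Topology.closure_of T S"
  then show xT: "x \<in> topspace T" unfolding in_closure_of by (rule conjunct1)
  let ?B = "{y \<in> topspace T. agree g n x y}"
  have "x \<in> ?B \<and> openin T ?B" using xT level_topology_ball[OF assms] by simp
  then obtain y where "y \<in> S" "y \<in> ?B" using x unfolding in_closure_of by meson
  then show "\<exists>y\<in>S \<inter> topspace T. agree g n x y" by blast
next
  fix x assume x: "x \<in> {x \<in> topspace T. \<forall>n. \<exists>y\<in>S \<inter> topspace T. agree g n x y}"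
  have "\<exists>y. y \<in> S \<and> y \<in> U" if U: "x \<in> U" "openin T U" for U
  proof -
    obtain n where "\<forall>y\<in>topspace T. agree g n x y \<longrightarrow> y \<in> U"
      using level_topologyD[OF assms U(2,1)] by blast
    moreover obtain y where "y \<in> S" "y \<in> topspace T" "agree g n x y" using x by blast
    ultimately show ?thesis by blast
  qed
  then show "x \<in> Abstract_Topology.closure_of T S" using x unfolding in_closure_of by simp
qed

text \<open>Balls are open and closed, so a ball around \<open>x\<close> that misses
  \<open>y\<close> disconnects every set containing both.\<close>

lemma level_topology_connected_component:
  assumes T: "level_topology T g" and x: "x \<in> topspace T"
    and sep: "\<And>y. y \<in> topspace T \<Longrightarrow> y \<noteq> x \<Longrightarrow> \<exists>n. \<not> agree g n x y"
  shows "connected_component_of_set T x = {x}"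
proof (intro equalityI subsetI)
  fix y assume "y \<in> connected_component_of_set T x"
  then obtain S where S: "connectedin T S" "x \<in> S" "y \<in> S" by (auto simp: connected_component_of_def)
  show "y \<in> {x}"
  proof (rule ccontr)
    assume "y \<notin> {x}"
    have yT: "y \<in> topspace T" using S connectedin_subset_topspace by blast
    then obtain n where n: "\<not> agree g n x y" using sep \<open>y \<notin> {x}\<close> by blast
    let ?U = "{z \<in> topspace T. agree g n x z}"
    have "openin T ?U" "openin T (topspace T - ?U)"
      using level_topology_ball[OF T] level_topology_ball_closed[OF T] by (auto simp: closedin_def)
    moreover have "S \<subseteq> ?U \<union> (topspace T - ?U)" using S(1) connectedin_subset_topspace by blast
    moreover have "?U \<inter> (topspace T - ?U) \<inter> S = {}" by blast
    moreover have "?U \<inter> S \<noteq> {}" using x S(2) by (auto intro: exI[of _ x])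
    moreover have "(topspace T - ?U) \<inter> S \<noteq> {}" using n yT S(3) by blast
    ultimately show False using S(1) unfolding connectedin by blast
  qed
qed (use x in \<open>auto simp: connected_component_of_refl\<close>)

lemma level_topology_derived_set:
  assumes T: "level_topology T g"
    and perfect: "\<And>x n. x \<in> topspace T \<Longrightarrow> \<exists>y\<in>topspace T. y \<noteq> x \<and> agree g n x y"
  shows "T derived_set_of topspace T = topspace T"
proof
  show "topspace T \<subseteq> T derived_set_of topspace T"
  proof
    fix x assume x: "x \<in> topspace T"
    have "\<exists>y. y \<noteq> x \<and> y \<in> topspace T \<and> y \<in> U" if U: "x \<in> U" "openin T U" for U
    proof -
      obtain n where "\<forall>y\<in>topspace T. agree g n x y \<longrightarrow> y \<in> U" using level_topologyD[OF T U(2,1)] by blast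
      then show ?thesis using perfect[OF x, of n] by blast
    qed
    then show "x \<in> T derived_set_of topspace T" using x by (auto simp: derived_set_of_def)
  qed
qed (simp add: derived_set_of_def)

lemma cantor_space_homeomorphic:
  assumes h: "homeomorphic_map T T' h" and T: "cantor_space T"
  shows "cantor_space T'"
proof -
  have sp: "T homeomorphic_space T'" using h homeomorphic_map_imp_homeomorphic_space by blast
  have top: "topspace T' = h ` topspace T" using h by (simp add: homeomorphic_imp_surjective_map)
  have "connected_component_of_set T' y = {y}" if y: "y \<in> topspace T'" for y
  proof -
    obtain x where x: "x \<in> topspace T" "y = h x" using y top by blast
    have "connected_component_of_set T' (h x) = h ` connected_component_of_set T x"
      using homeomorphic_map_connected_component_of[OF h x(1)] by simp
    then show ?thesis using x T by (simp add: cantor_space_def)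
  qed
  moreover have "T' derived_set_of topspace T' = topspace T'"
    using homeomorphic_map_derived_set_of[OF h subset_refl] top T by (simp add: cantor_space_def)
  moreover have "compact_space T'" "metrizable_space T'" "topspace T' \<noteq> {}"
    using T top homeomorphic_compact_space[OF sp] homeomorphic_metrizable_space[OF sp]
    by (auto simp: cantor_space_def)
  ultimately show ?thesis by (auto simp: cantor_space_def)
qed

section \<open>The uniform topology in terms of levels\<close>

lemma seq_dist_le: "(\<And>k. k \<le> n \<Longrightarrow> u k = w k) \<Longrightarrow> seq_dist u w \<le> (1/2) ^ n"
  using seq_dist_less_iff[of u w n] by force

text \<open>The level-\<open>k\<close> datum of a map is the whole function
  \<open>\<lambda>p\<in>S. h p k\<close>; agreement is therefore uniform over \<open>S\<close>, as
  the supremum metric demands.\<close>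

lemma agree_restrict_iff: "agree (\<lambda>k h. \<lambda>p\<in>S. h p k) n h h' \<longleftrightarrow> (\<forall>p\<in>S. \<forall>k\<le>n. h p k = h' p k)"
  unfolding agree_def by (auto simp: fun_eq_iff restrict_def split: if_splits)

lemma mspace_path_metric: "mspace (path_metric f \<alpha>) = tree_paths f \<alpha>"
  using Metric_space.mspace_metric[OF Metric_space_seq_dist] by (simp add: path_metric_def)

lemma mdist_path_metric: "mdist (path_metric f \<alpha>) = seq_dist"
  using Metric_space.mdist_metric[OF Metric_space_seq_dist] by (simp add: path_metric_def)

lemma topspace_path_space: "topspace (path_space f \<alpha>) = tree_paths f \<alpha>"
  using topspace_mtopology_of[of "path_metric f \<alpha>"] by (simp add: mtopology_of_path_metric mspace_path_metric)

text \<open>Agreement up to level n bounds the supremum distance by 2^-n, and a distance below 2^-n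
  forces agreement up to level n. Metric balls and agreement classes thus contain one
  another.\<close>

lemma level_topology_homeo:
  "level_topology (homeo_topology (path_metric f \<alpha>)) (\<lambda>k h. \<lambda>p\<in>tree_paths f \<alpha>. h p k)"
proof -
  let ?P = "tree_paths f \<alpha>" and ?m = "path_metric f \<alpha>"
  let ?M = "cfunspace (path_space f \<alpha>) ?m"
  let ?g = "\<lambda>k h. \<lambda>p\<in>?P. h p k :: 'a alg_closure"
  note m = mspace_path_metric[of f \<alpha>] mdist_path_metric[of f \<alpha>] and top = topspace_path_space[of f \<alpha>]
  note agree = agree_restrict_iff[of ?P]
  interpret M: Metric_space "mspace ?M" "mdist ?M" by (rule Metric_space_mspace_mdist)
  have near: "mdist ?M h h' \<le> (1/2) ^ n" if "agree ?g n h h'" for n h h'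
    using that by (intro mdist_cfunspace_le) (auto simp: top m agree intro: seq_dist_le)
  have near': "agree ?g n h h'"
    if "h \<in> mspace ?M" "h' \<in> mspace ?M" "mdist ?M h h' < (1/2) ^ n" for n h h'
    unfolding agree
  proof (intro ballI)
    fix p assume "p \<in> ?P"
    then have "seq_dist (h p) (h' p) \<le> mdist ?M h h'"
      using mdist_cfunspace_imp_mdist_le[OF that(1,2) order_refl, of p] by (simp add: top m)
    then show "\<forall>k\<le>n. h p k = h' p k" using that(3) seq_dist_less_iff[of "h p" "h' p" n] by simp
  qed
  have ball: "(\<exists>r>0. M.mball h r \<subseteq> U) \<longleftrightarrow> (\<exists>n. \<forall>y\<in>mspace ?M. agree ?g n h y \<longrightarrow> y \<in> U)"
    if hM: "h \<in> mspace ?M" for h U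
  proof
    assume "\<exists>r>0. M.mball h r \<subseteq> U"
    then obtain r where r: "r > 0" "M.mball h r \<subseteq> U" by blast
    obtain n where n: "(1/2::real) ^ n < r" using real_arch_pow_inv[OF r(1), of "1/2"] by auto
    have "h' \<in> U" if "h' \<in> mspace ?M" "agree ?g n h h'" for h'
    proof -
      have "h' \<in> M.mball h r"
        unfolding M.in_mball using hM that(1) le_less_trans[OF near[OF that(2)] n] by blast
      then show ?thesis using r(2) by blast
    qed
    then show "\<exists>n. \<forall>y\<in>mspace ?M. agree ?g n h y \<longrightarrow> y \<in> U" by blast
  next
    assume "\<exists>n. \<forall>y\<in>mspace ?M. agree ?g n h y \<longrightarrow> y \<in> U"
    then obtain n where "\<And>y. y \<in> mspace ?M \<Longrightarrow> agree ?g n h y \<Longrightarrow> y \<in> U" by blast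
    then have "M.mball h ((1/2) ^ n) \<subseteq> U"
      using near'[OF hM] unfolding subset_iff M.in_mball by blast
    then show "\<exists>r>0. M.mball h r \<subseteq> U" by (intro exI[of _ "(1/2) ^ n"]) simp
  qed
  have "openin M.mtopology U \<longleftrightarrow> U \<subseteq> mspace ?M \<and> (\<forall>h\<in>U. \<exists>n. \<forall>y\<in>mspace ?M. agree ?g n h y \<longrightarrow> y \<in> U)" for U
  proof -
    have "openin M.mtopology U \<longleftrightarrow> U \<subseteq> mspace ?M \<and> (\<forall>h\<in>U. \<exists>r>0. M.mball h r \<subseteq> U)"
      unfolding M.openin_mtopology by blast
    also have "\<dots> \<longleftrightarrow> U \<subseteq> mspace ?M \<and> (\<forall>h\<in>U. \<exists>n. \<forall>y\<in>mspace ?M. agree ?g n h y \<longrightarrow> y \<in> U)"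
      using ball by (intro conj_cong refl ball_cong) blast+
    finally show ?thesis .
  qed
  then have "level_topology (mtopology_of ?M) ?g"
    unfolding level_topology_def mtopology_of_def M.topspace_mtopology by blast
  then show ?thesis
    unfolding homeo_topology_def mtopology_of_path_metric by (rule level_topology_subtopology)
qed

section \<open>The tree of preimages\<close>

lemma eval_ac_poly_iter: "eval_ac (poly_iter f n) x = (eval_ac f ^^ n) x"
  by (induction n) (simp_all add: poly_iter_def)

lemma degree_diff_const:
  fixes p :: "'a::field poly"
  assumes "Polynomial.degree p > 0" shows "Polynomial.degree (p - [:c:]) = Polynomial.degree p"
proof -
  have "Polynomial.degree (p + - [:c:]) = Polynomial.degree p"
    by (rule degree_add_eq_left) (use assms in simp)
  then show ?thesis by (simp only: add_uminus_conv_diff)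
qed

locale preimage_tree =
  fixes f :: "'k::field poly" and \<alpha> :: 'k and d :: nat
  assumes deg: "Polynomial.degree f = d" and d: "d \<ge> 2"
    and card_roots: "\<And>n. n \<ge> 1 \<Longrightarrow> card {x. poly (map_poly to_ac (poly_iter f n - [:\<alpha>:])) x = 0} = d ^ n"
    and irred: "\<And>n. n \<ge> 1 \<Longrightarrow> Factorial_Ring.irreducible (poly_iter f n - [:\<alpha>:])"
begin

abbreviation V :: "nat \<Rightarrow> 'k alg_closure set" where "V \<equiv> preimages f \<alpha>"
abbreviation F :: "'k alg_closure \<Rightarrow> 'k alg_closure" where "F \<equiv> eval_ac f"
abbreviation P :: "(nat \<Rightarrow> 'k alg_closure) set" where "P \<equiv> tree_paths f \<alpha>"
abbreviation Gal :: "('k alg_closure \<Rightarrow> 'k alg_closure) set" where "Gal \<equiv> carrier abs_galois_group"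

lemma degree_poly_iter: "Polynomial.degree (poly_iter f n) = d ^ n"
  by (induction n) (simp_all add: poly_iter_def deg degree_pcompose)

lemma degree_poly_iter_diff: "n \<ge> 1 \<Longrightarrow> Polynomial.degree (poly_iter f n - [:\<alpha>:]) = d ^ n"
  using d by (subst degree_diff_const) (simp_all add: degree_poly_iter)

lemma eval_diff_eq_0_iff: "eval_ac (poly_iter f n - [:\<alpha>:]) x = 0 \<longleftrightarrow> (F ^^ n) x = to_ac \<alpha>"
  by (simp add: eval_ac_poly_iter)

text \<open>The separability demanded in \<open>preimages\<close> is automatic: for n at least 1 the
  polynomial is irreducible with as many distinct roots as its degree. Level 0 is treated apart,
  since the hypotheses start at 1; its only vertex comes from K.\<close>

lemma mem_V_iff: "x \<in> V n \<longleftrightarrow> (F ^^ n) x = to_ac \<alpha>"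
proof -
  have "x \<in> sep_closure" if x: "(F ^^ n) x = to_ac \<alpha>"
  proof (cases "n = 0")
    case True
    then show ?thesis using x to_ac_mem_sep_closure by simp
  next
    case False
    let ?q = "poly_iter f n - [:\<alpha>:]"
    have "n \<ge> 1" using False by simp
    then have irr: "Factorial_Ring.irreducible ?q" by (rule irred)
    then have "?q \<noteq> 0" by auto
    then have "rsquarefree (map_poly to_ac ?q)"
      using rsquarefree_iff_card_roots[of "map_poly to_ac ?q"] card_roots[OF \<open>n \<ge> 1\<close>]
        degree_poly_iter_diff[OF \<open>n \<ge> 1\<close>] by simp
    then show ?thesis
      using mem_sep_closure_iff[OF irr] x eval_diff_eq_0_iff by blast
  qed
  then show ?thesis by (auto simp: preimages_def eval_ac_poly_iter)
qed

lemma V_subset_sep_closure: "x \<in> V n \<Longrightarrow> x \<in> sep_closure"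
  by (simp add: preimages_def)

lemma V_0: "V 0 = {to_ac \<alpha>}"
  by (auto simp: mem_V_iff)

lemma mem_V_Suc_iff: "x \<in> V (Suc n) \<longleftrightarrow> F x \<in> V n"
  by (simp add: mem_V_iff funpow_swap1)

lemma card_V: "card (V n) = d ^ n"
proof (cases "n = 0")
  case False
  then have "n \<ge> 1" by simp
  have "V n = {x. eval_ac (poly_iter f n - [:\<alpha>:]) x = 0}"
    unfolding eval_diff_eq_0_iff using mem_V_iff by blast
  then show ?thesis using card_roots[OF \<open>n \<ge> 1\<close>] by simp
qed (simp add: V_0)

lemma finite_V: "finite (V n)"
  using card_V[of n] d by (intro card_ge_0_finite) simp

text \<open>Every fibre has at most \<open>d\<close> points, and the d^(n+1) vertices of the next
  level are spread over d^n fibres, so each bound is attained.\<close>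

lemma card_fibre:
  assumes "y \<in> V n" shows "card {x. F x = y} = d"
proof -
  have fib: "finite {x. F x = y} \<and> card {x. F x = y} \<le> d" for y
  proof -
    let ?p = "map_poly to_ac f - [:y:]"
    have "Polynomial.degree ?p = d"
      using d deg by (subst degree_diff_const) simp_all
    moreover from this have "?p \<noteq> 0" using d by auto
    moreover have "{x. F x = y} = {x. poly ?p x = 0}" by auto
    ultimately show ?thesis using card_poly_roots_bound[of ?p] poly_roots_finite[of ?p] by simp
  qed
  have "V (Suc n) = (\<Union>y\<in>V n. {x. F x = y})" using mem_V_Suc_iff by blast
  then have "card (V (Suc n)) = (\<Sum>y\<in>V n. card {x. F x = y})"
    using finite_V fib by (simp only:) (rule card_UN_disjoint, auto)
  then have "(\<Sum>y\<in>V n. card {x. F x = y}) = (\<Sum>y\<in>V n. d)"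
    by (simp add: card_V mult.commute)
  then show ?thesis
    using sum_mono_inv[of "\<lambda>y. card {x. F x = y}" "V n" "\<lambda>_. d" y] fib assms finite_V by blast
qed

text \<open>A fibre has at least two points because \<open>d \<ge> 2\<close>. This yields both the
  perfectness of the path space and the strict descent of the chain of stabilizers.\<close>

lemma other_preimage:
  assumes "y \<in> V n" obtains x' where "F x' = y" "x' \<noteq> x"
proof -
  have "\<not> {z. F z = y} \<subseteq> {x}"
    using card_mono[of "{x}" "{z. F z = y}"] card_fibre[OF assms] d by auto
  then show thesis using that by blast
qed

lemma mem_P_iff: "p \<in> P \<longleftrightarrow> (\<forall>n. p n \<in> V n) \<and> (\<forall>n. F (p (Suc n)) = p n)"
  by (auto simp: tree_paths_def tree_adj_def)

lemma P_in_V: "p \<in> P \<Longrightarrow> p n \<in> V n"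
  by (simp add: mem_P_iff)

lemma P_F: "p \<in> P \<Longrightarrow> F (p (Suc n)) = p n"
  by (simp add: mem_P_iff)

lemma P_eq_below:
  assumes "p \<in> P" "q \<in> P" "p n = q n" "k \<le> n" shows "p k = q k"
  using assms(4)
proof (induction rule: inc_induct)
  case (step m)
  then show ?case using P_F[OF assms(1), of m] P_F[OF assms(2), of m] by simp
qed (fact assms(3))

lemma agree_P_iff:
  assumes "p \<in> P" "q \<in> P" shows "agree (\<lambda>k u. u k) n p q \<longleftrightarrow> p n = q n"
  using P_eq_below[OF assms] by (auto simp: agree_def)

text \<open>Below level \<open>n\<close> the path is forced, by applying \<open>F\<close> to
  \<open>x\<close>; above it a preimage is chosen at every step.\<close>

lemma path_through:
  assumes x: "x \<in> V n" obtains p where "p \<in> P" "p n = x"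
proof -
  have "\<exists>z. F z = y" if "y \<in> V m" for y m using other_preimage[OF that] by blast
  define s where "s = (\<lambda>y. SOME z. F z = y)"
  have s: "F (s y) = y" if "y \<in> V m" for y m
    unfolding s_def using \<open>\<And>y m. y \<in> V m \<Longrightarrow> \<exists>z. F z = y\<close>[OF that] by (rule someI_ex)
  define up where "up = rec_nat x (\<lambda>j. s)"
  have up: "up 0 = x" "\<And>j. up (Suc j) = s (up j)" by (simp_all add: up_def)
  have up_V: "up j \<in> V (n + j)" for j
    by (induction j) (simp_all add: up x mem_V_Suc_iff s)
  have up_F: "F (up (Suc j)) = up j" for j using up(2) s up_V by metis
  have down_V: "k \<le> n \<Longrightarrow> (F ^^ k) x \<in> V (n - k)" for k
  proof (induction k)
    case (Suc k)
    then have "(F ^^ k) x \<in> V (Suc (n - Suc k))" by (simp add: Suc_diff_Suc)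
    then show ?case by (simp add: mem_V_Suc_iff)
  qed (use x in simp)
  define p where "p = (\<lambda>k. if k \<le> n then (F ^^ (n - k)) x else up (k - n))"
  \<comment> \<open>At \<open>k = n\<close> both descriptions give \<open>x\<close>, so the upper
    formula holds there too.\<close>
  have p_ge: "p k = up (k - n)" if "k \<ge> n" for k using that up(1) by (auto simp: p_def)
  have "p \<in> P"
    unfolding mem_P_iff
  proof (intro conjI allI)
    fix k
    show "p k \<in> V k"
      using down_V[of "n - k"] up_V[of "k - n"] by (auto simp: p_def)
    show "F (p (Suc k)) = p k"
    proof (cases "k < n")
      case True
      then have "n - k = Suc (n - Suc k)" by simp
      then show ?thesis using True by (simp add: p_def)
    next
      case False
      then show ?thesis using up_F[of "k - n"] by (simp add: p_ge Suc_diff_le)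
    qed
  qed
  then show thesis using that p_ge[of n] up(1) by simp
qed

text \<open>Branch off from \<open>p\<close> at level n + 1, to a sibling of
  \<open>p (Suc n)\<close>.\<close>

lemma P_perfect:
  assumes p: "p \<in> P" obtains q where "q \<in> P" "q \<noteq> p" "q n = p n"
proof -
  obtain c where c: "F c = p n" "c \<noteq> p (Suc n)" using other_preimage[OF P_in_V[OF p]] by blast
  then have "c \<in> V (Suc n)" using P_in_V[OF p] by (simp add: mem_V_Suc_iff)
  then obtain q where "q \<in> P" "q (Suc n) = c" by (rule path_through)
  then show thesis using that c P_F[of q n] by auto
qed

lemma level_topology_path_space: "level_topology (path_space f \<alpha>) (\<lambda>k u. u k)"
  unfolding path_space_def by (intro level_topology_subtopology level_topology_product)

lemma cantor_space_path_space:
  assumes "P \<noteq> {}" shows "cantor_space (path_space f \<alpha>)"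
proof -
  let ?T = "product_topology (\<lambda>n. discrete_topology (V n)) UNIV"
  have T: "level_topology ?T (\<lambda>k u. u k)" by (rule level_topology_product)
  have "closedin ?T P"
    unfolding closedin_def
  proof
    show "P \<subseteq> topspace ?T" by (auto simp: P_in_V PiE_iff)
    show "openin ?T (topspace ?T - P)"
    proof (rule level_topologyI[OF T])
      fix w assume w: "w \<in> topspace ?T - P"
      obtain n where n: "F (w (Suc n)) \<noteq> w n" using w by (auto simp: mem_P_iff PiE_iff)
      \<comment> \<open>The violated edge condition involves only the levels \<open>n\<close> and
        \<open>Suc n\<close>, so it persists for every sequence that agrees with \<open>w\<close> up
        to \<open>Suc n\<close>.\<close>
      have "y \<notin> P" if "agree (\<lambda>k u. u k) (Suc n) w y" for y
      proof -
        have "w (Suc n) = y (Suc n)" "w n = y n" using that by (simp_all add: agree_def)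
        then show ?thesis using n P_F by metis
      qed
      then show "\<exists>m. \<forall>y\<in>topspace ?T. agree (\<lambda>k u. u k) m w y \<longrightarrow> y \<in> topspace ?T - P" by blast
    qed auto
  qed
  moreover have "compact_space ?T"
    by (auto simp: compact_space_product_topology compact_space_discrete_topology finite_V)
  ultimately have "compact_space (path_space f \<alpha>)"
    unfolding path_space_def by (intro compact_space_subtopology closedin_compact_space)
  moreover have "metrizable_space (path_space f \<alpha>)"
    unfolding mtopology_of_path_metric[symmetric] mtopology_of_def
    by (intro Metric_space.metrizable_space_mtopology Metric_space_mspace_mdist)
  moreover have "connected_component_of_set (path_space f \<alpha>) x = {x}" if "x \<in> P" for x
  proof (rule level_topology_connected_component[OF level_topology_path_space])
    fix y assume "y \<noteq> x"
    then obtain n where "y n \<noteq> x n" by blast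
    then show "\<exists>n. \<not> agree (\<lambda>k u. u k) n x y" by (auto simp: agree_def intro!: exI[of _ n])
  qed (use that in \<open>simp add: topspace_path_space\<close>)
  moreover have "path_space f \<alpha> derived_set_of P = P"
    using level_topology_derived_set[OF level_topology_path_space] P_perfect agree_P_iff
    unfolding topspace_path_space by metis
  ultimately show ?thesis using assms by (simp add: cantor_space_def topspace_path_space)
qed

section \<open>The Galois action on the tree\<close>

lemma Gal_V: "\<tau> \<in> Gal \<Longrightarrow> x \<in> V n \<Longrightarrow> \<tau> x \<in> V n"
  using abs_galois_group_eval[of \<tau> x "poly_iter f n"] abs_galois_groupD(2,5)[of \<tau>]
  by (simp add: preimages_def)

lemma Gal_F: "\<tau> \<in> Gal \<Longrightarrow> x \<in> V n \<Longrightarrow> F (\<tau> x) = \<tau> (F x)"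
  using abs_galois_group_eval V_subset_sep_closure by metis

lemma Gal_inj: "\<tau> \<in> Gal \<Longrightarrow> x \<in> V n \<Longrightarrow> y \<in> V n \<Longrightarrow> \<tau> x = \<tau> y \<longleftrightarrow> x = y"
  using abs_galois_groupD(1)[of \<tau>] V_subset_sep_closure inj_on_eq_iff[of \<tau> sep_closure x y]
  by (simp add: Bij_def bij_betw_def)

lemma Gal_P: "\<tau> \<in> Gal \<Longrightarrow> p \<in> P \<Longrightarrow> (\<lambda>n. \<tau> (p n)) \<in> P"
  unfolding mem_P_iff using Gal_V Gal_F by metis

lemma Gal_transitive:
  assumes "x \<in> V n" "y \<in> V n" obtains \<tau> where "\<tau> \<in> Gal" "\<tau> x = y"
proof (cases "n = 0")
  case True
  have "\<one>\<^bsub>BijGroup sep_closure\<^esub> \<in> Gal" using subgroup_abs_galois_group by (rule subgroup.one_closed)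
  moreover have "\<one>\<^bsub>BijGroup sep_closure\<^esub> x = x"
    using V_subset_sep_closure[OF assms(1)] by (simp add: BijGroup_def)
  ultimately show thesis using that assms True V_0 by auto
next
  case False
  then have "Factorial_Ring.irreducible (poly_iter f n - [:\<alpha>:])" by (intro irred) simp
  then show thesis
    using abs_galois_group_transitive[of _ x y] that assms V_subset_sep_closure
    unfolding mem_V_iff eval_diff_eq_0_iff[symmetric] by metis
qed

lemma one_Gal: "\<one>\<^bsub>abs_galois_group\<^esub> = (\<lambda>x\<in>sep_closure. x)"
  by (simp add: abs_galois_group_def BijGroup_def)

lemma mult_Gal: "\<sigma> \<in> Gal \<Longrightarrow> \<tau> \<in> Gal \<Longrightarrow> \<sigma> \<otimes>\<^bsub>abs_galois_group\<^esub> \<tau> = compose sep_closure \<sigma> \<tau>"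
  using abs_galois_groupD(1) by (simp add: abs_galois_group_def BijGroup_def)

lemma group_Gal: "group (abs_galois_group :: ('k alg_closure \<Rightarrow> 'k alg_closure) monoid)"
proof -
  have "abs_galois_group = (BijGroup sep_closure)\<lparr>carrier := Gal\<rparr>"
    by (simp add: abs_galois_group_def)
  then show ?thesis
    using group.subgroup_imp_group[OF group_BijGroup subgroup_abs_galois_group] by metis
qed

text \<open>Shared by the actions on paths and on vertices. Bijectivity is read off from the inverse
  Galois element, so only the action laws on \<open>S\<close> have to be checked.\<close>

lemma Gal_action_hom:
  fixes h :: "('k alg_closure \<Rightarrow> 'k alg_closure) \<Rightarrow> 'b \<Rightarrow> 'b"
  assumes ext: "\<And>\<tau>. \<tau> \<in> Gal \<Longrightarrow> h \<tau> \<in> extensional S \<inter> (S \<rightarrow> S)"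
    and one: "\<And>x. x \<in> S \<Longrightarrow> h (\<lambda>x\<in>sep_closure. x) x = x"
    and mult: "\<And>\<sigma> \<tau> x. \<sigma> \<in> Gal \<Longrightarrow> \<tau> \<in> Gal \<Longrightarrow> x \<in> S \<Longrightarrow> h (compose sep_closure \<sigma> \<tau>) x = h \<sigma> (h \<tau> x)"
  shows "group_hom abs_galois_group (BijGroup S) h"
proof -
  interpret A: group "abs_galois_group :: ('k alg_closure \<Rightarrow> 'k alg_closure) monoid" by (rule group_Gal)
  have bij: "h \<tau> \<in> Bij S" if \<tau>: "\<tau> \<in> Gal" for \<tau>
  proof -
    let ?i = "inv\<^bsub>abs_galois_group\<^esub> \<tau>"
    have i: "?i \<in> Gal" using \<tau> by (rule A.inv_closed)
    have "compose sep_closure \<tau> ?i = (\<lambda>x\<in>sep_closure. x)" "compose sep_closure ?i \<tau> = (\<lambda>x\<in>sep_closure. x)"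
      using mult_Gal[OF \<tau> i] mult_Gal[OF i \<tau>] A.r_inv[OF \<tau>] A.l_inv[OF \<tau>] one_Gal by metis+
    then have "h \<tau> (h ?i x) = x" "h ?i (h \<tau> x) = x" if "x \<in> S" for x
      using mult[OF \<tau> i that] mult[OF i \<tau> that] one[OF that] by metis+
    then have "bij_betw (h \<tau>) S S"
      using ext[OF \<tau>] ext[OF i] by (intro bij_betw_byWitness[of _ "h ?i"]) auto
    then show ?thesis using ext[OF \<tau>] by (simp add: Bij_def)
  qed
  show ?thesis
    unfolding group_hom_def group_hom_axioms_def hom_def
  proof (intro conjI group_Gal group_BijGroup CollectI ballI)
    show "h \<in> Gal \<rightarrow> carrier (BijGroup S)" using bij by (simp add: BijGroup_def)
    fix \<sigma> \<tau> assume \<sigma>\<tau>: "\<sigma> \<in> Gal" "\<tau> \<in> Gal"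
    then have "h (\<sigma> \<otimes>\<^bsub>abs_galois_group\<^esub> \<tau>) \<in> extensional S" using ext A.m_closed by blast
    then show "h (\<sigma> \<otimes>\<^bsub>abs_galois_group\<^esub> \<tau>) = h \<sigma> \<otimes>\<^bsub>BijGroup S\<^esub> h \<tau>"
      using \<sigma>\<tau> by (intro extensionalityI[of _ S])
        (simp_all add: BijGroup_def bij mult_Gal mult compose_eq)
  qed
qed

definition path_rep :: "('k alg_closure \<Rightarrow> 'k alg_closure) \<Rightarrow> (nat \<Rightarrow> 'k alg_closure) \<Rightarrow> (nat \<Rightarrow> 'k alg_closure)" where
  "path_rep \<tau> = (\<lambda>p\<in>P. \<lambda>n. \<tau> (p n))"

lemma path_rep_apply: "p \<in> P \<Longrightarrow> path_rep \<tau> p = (\<lambda>n. \<tau> (p n))"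
  by (simp add: path_rep_def)

lemma path_rep_hom: "group_hom abs_galois_group (BijGroup P) path_rep"
proof (rule Gal_action_hom)
  show "path_rep \<tau> \<in> extensional P \<inter> (P \<rightarrow> P)" if "\<tau> \<in> Gal" for \<tau>
    using Gal_P[OF that] by (simp add: path_rep_def)
  show "path_rep (\<lambda>x\<in>sep_closure. x) p = p" if "p \<in> P" for p
    using V_subset_sep_closure[OF P_in_V[OF that]] that by (simp add: path_rep_apply)
  show "path_rep (compose sep_closure \<sigma> \<tau>) p = path_rep \<sigma> (path_rep \<tau> p)"
    if "\<sigma> \<in> Gal" "\<tau> \<in> Gal" "p \<in> P" for \<sigma> \<tau> p
    using V_subset_sep_closure[OF P_in_V[OF that(3)]] that
    by (simp add: path_rep_apply Gal_P compose_eq)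
qed

lemma tree_vertices_iff: "(n, b) \<in> tree_vertices f \<alpha> \<longleftrightarrow> b \<in> V n"
  by (simp add: tree_vertices_def)

lemma arboreal_rep_hom: "group_hom abs_galois_group (BijGroup (tree_vertices f \<alpha>)) (arboreal_rep f \<alpha>)"
proof (rule Gal_action_hom)
  show "arboreal_rep f \<alpha> \<tau> \<in> extensional (tree_vertices f \<alpha>) \<inter> (tree_vertices f \<alpha> \<rightarrow> tree_vertices f \<alpha>)"
    if "\<tau> \<in> Gal" for \<tau>
    using Gal_V[OF that] by (auto simp: arboreal_rep_def tree_vertices_iff)
  show "arboreal_rep f \<alpha> (\<lambda>x\<in>sep_closure. x) b = b" if "b \<in> tree_vertices f \<alpha>" for b
    using that V_subset_sep_closure by (cases b) (auto simp: arboreal_rep_def tree_vertices_iff)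
  show "arboreal_rep f \<alpha> (compose sep_closure \<sigma> \<tau>) b = arboreal_rep f \<alpha> \<sigma> (arboreal_rep f \<alpha> \<tau> b)"
    if "\<sigma> \<in> Gal" "\<tau> \<in> Gal" "b \<in> tree_vertices f \<alpha>" for \<sigma> \<tau> b
    using that V_subset_sep_closure Gal_V
    by (cases b) (auto simp: arboreal_rep_def tree_vertices_iff compose_eq)
qed

text \<open>With \<open>I\<close> as \<open>UNIV\<close> this concerns the full tree, with
  \<open>I\<close> as \<open>{..n}\<close> the finite subtrees; the profinite topology needs
  both.\<close>

lemma restrict_Gal_mem_rooted_aut:
  assumes \<tau>: "\<tau> \<in> Gal" and I: "0 \<in> I"
  shows "restrict (\<lambda>(n, b). (n, \<tau> b)) (Sigma I V)
    \<in> carrier (rooted_aut_group (Sigma I V) (0, to_ac \<alpha>) (tree_adj f))"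
proof -
  have bijV: "\<tau> ` V n = V n" for n
  proof (rule endo_inj_surj[OF finite_V])
    show "\<tau> ` V n \<subseteq> V n" using Gal_V[OF \<tau>] by blast
    show "inj_on \<tau> (V n)" using Gal_inj[OF \<tau>] by (auto simp: inj_on_def)
  qed
  let ?h = "restrict (\<lambda>(n, b). (n, \<tau> b)) (Sigma I V)"
  have "bij_betw ?h (Sigma I V) (Sigma I V)"
  proof (rule bij_betw_imageI)
    show "inj_on ?h (Sigma I V)" using Gal_inj[OF \<tau>] by (auto simp: inj_on_def)
    show "?h ` Sigma I V = Sigma I V"
    proof (intro equalityI subsetI)
      show "x \<in> Sigma I V" if "x \<in> ?h ` Sigma I V" for x using that Gal_V[OF \<tau>] by auto
      fix x assume "x \<in> Sigma I V"
      then obtain n b where x: "x = (n, b)" "n \<in> I" "b \<in> V n" by auto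
      then obtain c where "c \<in> V n" "b = \<tau> c" using bijV by blast
      then show "x \<in> ?h ` Sigma I V" using x by (intro image_eqI[of _ _ "(n, c)"]) auto
    qed
  qed
  moreover have "tree_adj f (n, \<tau> b) (m, \<tau> c) \<longleftrightarrow> tree_adj f (n, b) (m, c)"
    if "b \<in> V n" "c \<in> V m" for n b m c
  proof -
    have "F (\<tau> b) = \<tau> c \<longleftrightarrow> F b = c" if "b \<in> V (Suc m)" "c \<in> V m" for b c m
      using Gal_F[OF \<tau> that(1)] Gal_inj[OF \<tau> _ that(2), of "F b"] that(1) by (simp add: mem_V_Suc_iff)
    then show ?thesis using that by (auto simp: tree_adj_def)
  qed
  moreover have "?h (0, to_ac \<alpha>) = (0, to_ac \<alpha>)"
    using I V_0 abs_galois_groupD(2)[OF \<tau>] by simp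
  ultimately show ?thesis by (auto simp: rooted_aut_group_def Bij_def)
qed

text \<open>As a pullback topology, the profinite topology has a point only if each of its
  restrictions is an automorphism of the corresponding finite subtree.\<close>

lemma arboreal_rep_mem_topspace:
  assumes "\<tau> \<in> Gal" shows "arboreal_rep f \<alpha> \<tau> \<in> topspace (tree_aut_topology f \<alpha>)"
proof -
  have "arboreal_rep f \<alpha> \<tau> \<in> carrier (tree_aut f \<alpha>)"
    using restrict_Gal_mem_rooted_aut[OF assms, of UNIV]
    by (simp add: tree_aut_def arboreal_rep_def tree_vertices_def)
  moreover have "restrict (arboreal_rep f \<alpha> \<tau>) (subtree_vertices f \<alpha> n) \<in> carrier (subtree_aut f \<alpha> n)" for n
  proof -
    have "tree_vertices f \<alpha> \<inter> subtree_vertices f \<alpha> n = Sigma {..n} V"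
      by (auto simp: tree_vertices_def subtree_vertices_def)
    then show ?thesis
      using restrict_Gal_mem_rooted_aut[OF assms, of "{..n}"]
      by (simp add: subtree_aut_def arboreal_rep_def subtree_vertices_def restrict_restrict)
  qed
  ultimately show ?thesis
    by (simp add: tree_aut_topology_def topspace_pullback_topology PiE_iff)
qed

lemma arboreal_rep_eq_iff:
  "restrict (arboreal_rep f \<alpha> \<sigma>) (subtree_vertices f \<alpha> n) = restrict (arboreal_rep f \<alpha> \<tau>) (subtree_vertices f \<alpha> n)
     \<longleftrightarrow> (\<forall>k\<le>n. \<forall>x\<in>V k. \<sigma> x = \<tau> x)"
proof -
  have "restrict (arboreal_rep f \<alpha> \<sigma>) (subtree_vertices f \<alpha> n) = restrict (arboreal_rep f \<alpha> \<tau>) (subtree_vertices f \<alpha> n)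
    \<longleftrightarrow> (\<forall>b\<in>Sigma {..n} V. arboreal_rep f \<alpha> \<sigma> b = arboreal_rep f \<alpha> \<tau> b)"
    unfolding subtree_vertices_def by (auto simp: fun_eq_iff restrict_def split: if_splits)
  also have "\<dots> \<longleftrightarrow> (\<forall>k\<le>n. \<forall>x\<in>V k. \<sigma> x = \<tau> x)"
    by (auto simp: arboreal_rep_def tree_vertices_def)
  finally show ?thesis .
qed

text \<open>Every vertex lies on some path, so passing from vertices to paths loses no information
  at any level.\<close>

lemma path_rep_eq_iff:
  "(\<forall>p\<in>P. path_rep \<sigma> p k = path_rep \<tau> p k) \<longleftrightarrow> (\<forall>x\<in>V k. \<sigma> x = \<tau> x)"
  using P_in_V path_through by (auto simp: path_rep_apply) metis

lemma path_rep_eq_iff_arboreal_rep_eq: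
  assumes "\<sigma> \<in> Gal" "\<tau> \<in> Gal"
  shows "path_rep \<sigma> = path_rep \<tau> \<longleftrightarrow> arboreal_rep f \<alpha> \<sigma> = arboreal_rep f \<alpha> \<tau>"
proof -
  have "path_rep \<sigma> = path_rep \<tau> \<longleftrightarrow> (\<forall>k. \<forall>p\<in>P. path_rep \<sigma> p k = path_rep \<tau> p k)"
    unfolding path_rep_def by (auto simp: fun_eq_iff restrict_def split: if_splits)
  also have "\<dots> \<longleftrightarrow> (\<forall>k. \<forall>x\<in>V k. \<sigma> x = \<tau> x)" by (simp only: path_rep_eq_iff)
  also have "\<dots> \<longleftrightarrow> arboreal_rep f \<alpha> \<sigma> = arboreal_rep f \<alpha> \<tau>"
    by (auto simp: arboreal_rep_def fun_eq_iff restrict_def tree_vertices_def split: if_splits)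
  finally show ?thesis .
qed

end

lemma seq_dist_le_1: "seq_dist u w \<le> 1"
  by (simp add: seq_dist_def power_le_one)

text \<open>The function space contains only bounded maps, which could leave out homeomorphisms;
  since \<open>seq_dist\<close> is at most 1, boundedness is automatic.\<close>

lemma topspace_homeo_topology:
  "topspace (homeo_topology (path_metric f \<alpha>)) = carrier (homeo_group (path_space f \<alpha>))"
proof -
  let ?P = "tree_paths f \<alpha>" and ?m = "path_metric f \<alpha>"
  interpret Metric_space ?P seq_dist by (rule Metric_space_seq_dist)
  have "h \<in> mspace (cfunspace (path_space f \<alpha>) ?m)" if h: "h \<in> carrier (homeo_group (path_space f \<alpha>))" for h
  proof -
    have hB: "h \<in> Bij ?P" and hc: "homeomorphic_map (path_space f \<alpha>) (path_space f \<alpha>) h"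
      using h by (auto simp: homeo_group_def topspace_path_space)
    have hP: "h \<in> ?P \<rightarrow> ?P" using hB by (rule Bij_imp_funcset)
    have "mbounded (h ` ?P)"
    proof (cases "?P = {}")
      case False
      then obtain p where "p \<in> ?P" by blast
      then have "h ` ?P \<subseteq> mcball p 1" using funcset_mem[OF hP] seq_dist_le_1 by (auto simp: in_mcball)
      then show ?thesis using mbounded_subset mbounded_mcball by blast
    next
      case True
      then have "h ` ?P = {}" by simp
      then show ?thesis by (simp only: mbounded_empty)
    qed
    then show ?thesis
      using hP Bij_imp_extensional[OF hB] homeomorphic_imp_continuous_map[OF hc]
      by (simp add: topspace_path_space mspace_path_metric mdist_path_metric mtopology_of_path_metric)
  qed
  then show ?thesis by (auto simp: homeo_topology_def mtopology_of_path_metric)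
qed

context preimage_tree
begin

section \<open>The closure of a dense subgroup\<close>

definition E :: "((nat \<Rightarrow> 'k alg_closure) \<Rightarrow> (nat \<Rightarrow> 'k alg_closure)) set" where
  "E = path_rep ` Gal"

lemma subgroup_E: "subgroup E (BijGroup P)"
  using group_hom.img_is_subgroup[OF path_rep_hom] by (simp add: E_def)

lemma E_Bij: "g \<in> E \<Longrightarrow> g \<in> Bij P"
  using subgroup.subset[OF subgroup_E] by (auto simp: BijGroup_def)

lemma E_P: "g \<in> E \<Longrightarrow> p \<in> P \<Longrightarrow> g p \<in> P"
  using Bij_imp_funcset[OF E_Bij] by blast

text \<open>A Galois element acts injectively on each coordinate separately. Elements of
  \<open>E\<close> are therefore isometries, and the level-n vertex of \<open>g p\<close> depends
  only on that of \<open>p\<close>; homeomorphy, equicontinuity and the coset computations rest on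
  this.\<close>

lemma E_level_eq_iff:
  assumes "g \<in> E" "p \<in> P" "q \<in> P" shows "g p n = g q n \<longleftrightarrow> p n = q n"
proof -
  obtain \<tau> where "\<tau> \<in> Gal" "g = path_rep \<tau>" using assms(1) by (auto simp: E_def)
  then show ?thesis using Gal_inj[of \<tau> "p n" n "q n"] assms(2,3) by (simp add: path_rep_apply P_in_V)
qed

lemma E_homeo: "g \<in> E \<Longrightarrow> g \<in> carrier (homeo_group (path_space f \<alpha>))"
proof -
  assume g: "g \<in> E"
  have "homeomorphic_map (path_space f \<alpha>) (path_space f \<alpha>) g"
    using E_Bij[OF g] E_level_eq_iff[OF g]
    by (intro level_topology_homeomorphic_map[OF level_topology_path_space level_topology_path_space])
      (auto simp: topspace_path_space Bij_def agree_def)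
  then show ?thesis using E_Bij[OF g] by (simp add: homeo_group_def topspace_path_space)
qed

abbreviation level :: "nat \<Rightarrow> ((nat \<Rightarrow> 'k alg_closure) \<Rightarrow> nat \<Rightarrow> 'k alg_closure) \<Rightarrow> (nat \<Rightarrow> 'k alg_closure) \<Rightarrow> 'k alg_closure" where
  "level k h \<equiv> \<lambda>p\<in>P. h p k"

lemma agree_E_iff:
  assumes "g \<in> E" "h \<in> E" shows "agree level n g h \<longleftrightarrow> (\<forall>p\<in>P. g p n = h p n)"
proof
  assume eq: "\<forall>p\<in>P. g p n = h p n"
  show "agree level n g h"
    unfolding agree_restrict_iff
  proof (intro ballI allI impI)
    fix p k assume p: "p \<in> P" and "k \<le> n"
    show "g p k = h p k"
      using P_eq_below[OF E_P[OF assms(1) p] E_P[OF assms(2) p] _ \<open>k \<le> n\<close>] eq p by blast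
  qed
qed (simp add: agree_restrict_iff)

lemma E_closed:
  assumes h: "h \<in> extensional P" and lim: "\<And>n. \<exists>g\<in>E. agree level n h g"
  shows "h \<in> E"
proof -
  have "\<exists>\<tau>\<in>Gal. \<forall>p\<in>P. \<forall>k\<le>n. h p k = \<tau> (p k)" for n
    using lim[of n] by (auto simp: E_def agree_restrict_iff path_rep_apply)
  then obtain \<tau> where \<tau>: "\<And>n. \<tau> n \<in> Gal" "\<And>n p k. p \<in> P \<Longrightarrow> k \<le> n \<Longrightarrow> \<tau> n (p k) = h p k" by metis
  obtain \<sigma> where \<sigma>: "\<sigma> \<in> Gal" "\<And>x y N. x \<in> sep_closure \<Longrightarrow> (\<And>n. n \<ge> N \<Longrightarrow> \<tau> n x = y) \<Longrightarrow> \<sigma> x = y"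
    using abs_galois_group_limit[of \<tau>, OF \<tau>(1)] by blast
  \<comment> \<open>From index \<open>k\<close> on, \<open>\<tau> n\<close> takes the value
    \<open>h p k\<close> at the vertex \<open>p k\<close>, so \<open>k\<close> itself is the
    threshold.\<close>
  have "\<sigma> (p k) = h p k" if "p \<in> P" for p k
    using \<sigma>(2)[OF V_subset_sep_closure[OF P_in_V[OF that]], of k] \<tau>(2)[OF that] by blast
  then have "path_rep \<sigma> = h" using h by (intro extensionalityI[of _ P]) (auto simp: path_rep_def)
  then show ?thesis using \<sigma>(1) by (auto simp: E_def)
qed

lemma E_countable_dense:
  obtains S where "countable S" "S \<subseteq> E" "\<And>g n. g \<in> E \<Longrightarrow> \<exists>h\<in>S. \<forall>p\<in>P. g p n = h p n"
proof -
  let ?c = "\<lambda>n \<tau>. restrict \<tau> (V n)"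
  \<comment> \<open>For each \<open>n\<close>, one Galois element is kept per restriction to
    \<open>V n\<close>; there are only finitely many such restrictions.\<close>
  define R where "R = (\<Union>n. inv_into Gal (?c n) ` ?c n ` Gal)"
  have "finite (?c n ` Gal)" for n
  proof (rule finite_subset)
    show "?c n ` Gal \<subseteq> V n \<rightarrow>\<^sub>E V n" using Gal_V by auto
    show "finite (V n \<rightarrow>\<^sub>E V n)" using finite_V by (intro finite_PiE)
  qed
  then have "countable R" unfolding R_def by (intro countable_UN) (auto intro: countable_finite)
  moreover have R: "R \<subseteq> Gal" unfolding R_def by (auto intro: inv_into_into)
  moreover have "\<exists>h\<in>path_rep ` R. \<forall>p\<in>P. g p n = h p n" if "g \<in> E" for g n
  proof -
    obtain \<tau> where \<tau>: "\<tau> \<in> Gal" "g = path_rep \<tau>" using \<open>g \<in> E\<close> by (auto simp: E_def)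
    let ?\<sigma> = "inv_into Gal (?c n) (?c n \<tau>)"
    have "?\<sigma> \<in> R" using \<tau>(1) by (auto simp: R_def)
    have eq: "?c n ?\<sigma> = ?c n \<tau>" by (rule f_inv_into_f[OF imageI[OF \<tau>(1)]])
    have "?\<sigma> x = \<tau> x" if "x \<in> V n" for x
      using fun_cong[OF eq, of x] unfolding restrict_apply'[OF that] .
    then have "\<forall>p\<in>P. g p n = path_rep ?\<sigma> p n" unfolding \<tau>(2) path_rep_eq_iff by metis
    then show ?thesis using \<open>?\<sigma> \<in> R\<close> by blast
  qed
  ultimately show thesis by (intro that[of "path_rep ` R"]) (auto simp: E_def)
qed

end

section \<open>The dense group and its Ellis group\<close>

locale preimage_tree_group = preimage_tree f \<alpha> d for f :: "'k::field poly" and \<alpha> d +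
  fixes S :: "((nat \<Rightarrow> 'k alg_closure) \<Rightarrow> (nat \<Rightarrow> 'k alg_closure)) set" and v :: "nat \<Rightarrow> 'k alg_closure"
  assumes v: "v \<in> P" and S: "S \<subseteq> E" and S_dense: "\<And>g n. g \<in> E \<Longrightarrow> \<exists>h\<in>S. \<forall>p\<in>P. g p n = h p n"
begin

definition G :: "((nat \<Rightarrow> 'k alg_closure) \<Rightarrow> (nat \<Rightarrow> 'k alg_closure)) monoid" where
  "G = (BijGroup P)\<lparr>carrier := generate (BijGroup P) S\<rparr>"

interpretation B: group "BijGroup P" by (rule group_BijGroup)

lemma carrier_G: "carrier G = generate (BijGroup P) S"
  by (simp add: G_def)

lemma S_subset_Bij: "S \<subseteq> carrier (BijGroup P)"
  using S subgroup.subset[OF subgroup_E] by blast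

lemma group_G: "group G"
  unfolding G_def using B.generate_is_subgroup[OF S_subset_Bij] by (rule B.subgroup_imp_group)

interpretation G: group G by (rule group_G)

lemma countably_generated_G: "countable S \<Longrightarrow> countably_generated G"
  unfolding countably_generated_def
proof (intro exI[of _ S] conjI)
  have sub: "subgroup (generate (BijGroup P) S) (BijGroup P)"
    using B.generate_is_subgroup[OF S_subset_Bij] .
  have S_gen: "S \<subseteq> generate (BijGroup P) S" by (auto intro: generate.incl)
  then show "S \<subseteq> carrier G" by (simp add: carrier_G)
  show "generate G S = carrier G"
    using B.generate_consistent[OF S_gen sub] by (simp add: G_def)
qed

lemma G_subset_E: "g \<in> carrier G \<Longrightarrow> g \<in> E"
  unfolding carrier_G using B.generate_subgroup_incl[OF S subgroup_E] by blast

lemma G_dense: "g \<in> E \<Longrightarrow> \<exists>h\<in>carrier G. \<forall>p\<in>P. g p n = h p n"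
  unfolding carrier_G using S_dense[of g n] generate.incl by metis

lemma mult_E: "g \<in> E \<Longrightarrow> h \<in> E \<Longrightarrow> g \<otimes>\<^bsub>BijGroup P\<^esub> h = compose P g h"
  using E_Bij by (simp add: BijGroup_def)

lemma mult_G: "g \<in> carrier G \<Longrightarrow> h \<in> carrier G \<Longrightarrow> g \<otimes>\<^bsub>G\<^esub> h = compose P g h"
  using mult_E G_subset_E by (simp add: G_def)

lemma one_G: "\<one>\<^bsub>G\<^esub> = (\<lambda>p\<in>P. p)"
  by (simp add: G_def BijGroup_def)

lemma mult_G_v: "g \<in> carrier G \<Longrightarrow> h \<in> carrier G \<Longrightarrow> (g \<otimes>\<^bsub>G\<^esub> h) v = g (h v)"
  using v by (simp add: mult_G compose_eq)

lemma E_transitive: "x \<in> V n \<Longrightarrow> \<exists>g\<in>E. g v n = x"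
  using Gal_transitive[OF P_in_V[OF v]] path_rep_apply[OF v] by (metis E_def imageI)

lemma G_transitive: "x \<in> V n \<Longrightarrow> \<exists>g\<in>carrier G. g v n = x"
  using E_transitive G_dense v by metis

lemma G_v: "g \<in> carrier G \<Longrightarrow> g v \<in> P"
  using E_P G_subset_E v by blast

abbreviation \<mu> where "\<mu> \<equiv> path_metric f \<alpha>"

text \<open>One inclusion is the closedness of \<open>E\<close>. For the other, an element of
  \<open>G\<close> that matches \<open>h\<close> at level \<open>n\<close> matches it at all lower
  levels as well.\<close>

lemma closure_G: "Abstract_Topology.closure_of (homeo_topology \<mu>) (carrier G) = E"
  unfolding level_topology_closure_of[OF level_topology_homeo] topspace_homeo_topology
proof (intro equalityI subsetI)
  fix h assume h: "h \<in> {x \<in> carrier (homeo_group (path_space f \<alpha>)).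
    \<forall>n. \<exists>y\<in>carrier G \<inter> carrier (homeo_group (path_space f \<alpha>)). agree level n x y}"
  show "h \<in> E"
  proof (rule E_closed)
    show "h \<in> extensional P" using h Bij_imp_extensional by (auto simp: homeo_group_def topspace_path_space)
    show "\<exists>g\<in>E. agree level n h g" for n using h G_subset_E by blast
  qed
next
  fix h assume h: "h \<in> E"
  have "\<exists>y\<in>carrier G \<inter> carrier (homeo_group (path_space f \<alpha>)). agree level n h y" for n
    using G_dense[OF h, of n] G_subset_E E_homeo agree_E_iff[OF h] by blast
  then show "h \<in> {x \<in> carrier (homeo_group (path_space f \<alpha>)).
    \<forall>n. \<exists>y\<in>carrier G \<inter> carrier (homeo_group (path_space f \<alpha>)). agree level n x y}"
    using E_homeo[OF h] by blast
qed

abbreviation ellis where "ellis \<equiv> ellis_group \<mu> G (\<lambda>g. g)"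
abbreviation ellis_top where "ellis_top \<equiv> ellis_topology \<mu> G (\<lambda>g. g)"

lemma ellis_eq: "ellis = (BijGroup P)\<lparr>carrier := E\<rparr>"
  by (simp add: ellis_group_def mtopology_of_path_metric homeo_group_def topspace_path_space closure_G)

lemma carrier_ellis: "carrier ellis = E"
  by (simp add: ellis_eq)

lemma group_ellis: "group ellis"
  unfolding ellis_eq using subgroup_E by (rule B.subgroup_imp_group)

lemma mult_ellis: "g \<in> E \<Longrightarrow> h \<in> E \<Longrightarrow> g \<otimes>\<^bsub>ellis\<^esub> h = compose P g h"
  using mult_E by (simp add: ellis_eq)

lemma level_topology_ellis: "level_topology ellis_top level"
  unfolding ellis_topology_def by (intro level_topology_subtopology level_topology_homeo)

lemma topspace_ellis: "topspace ellis_top = E"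
  using E_homeo by (auto simp: ellis_topology_def carrier_ellis topspace_homeo_topology)

lemma hom_G: "(\<lambda>g. g) \<in> hom G (homeo_group (path_space f \<alpha>))"
  using E_homeo G_subset_E by (auto simp: hom_def homeo_group_def G_def topspace_path_space)

lemma equicontinuous_G: "equicontinuous_action \<mu> G (\<lambda>g. g)"
  unfolding equicontinuous_action_def mspace_path_metric mdist_path_metric
proof (intro allI impI)
  fix \<epsilon> :: real assume "\<epsilon> > 0"
  then obtain N where N: "(1/2::real) ^ N < \<epsilon>" using real_arch_pow_inv[of \<epsilon> "1/2"] by auto
  have "seq_dist (g p) (g q) < \<epsilon>" if "g \<in> carrier G" "p \<in> P" "q \<in> P" "seq_dist p q < (1/2) ^ N" for g p q
  proof -
    have "seq_dist (g p) (g q) < (1/2) ^ N"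
      using that E_level_eq_iff[OF G_subset_E[OF that(1)]] by (simp add: seq_dist_less_iff)
    then show ?thesis using N by linarith
  qed
  then show "\<exists>\<delta>>0. \<forall>g\<in>carrier G. \<forall>p\<in>P. \<forall>q\<in>P. seq_dist p q < \<delta> \<longrightarrow> seq_dist (g p) (g q) < \<epsilon>"
    by (intro exI[of _ "(1/2) ^ N"]) simp
qed

section \<open>The isomorphism with the arboreal image\<close>

text \<open>Any Galois lift of \<open>g\<close> will do: two lifts with the same action on paths
  agree on all vertices.\<close>

definition ellis_iso where
  "ellis_iso g = arboreal_rep f \<alpha> (SOME \<tau>. \<tau> \<in> Gal \<and> path_rep \<tau> = g)"

lemma ellis_iso_path_rep: "\<tau> \<in> Gal \<Longrightarrow> ellis_iso (path_rep \<tau>) = arboreal_rep f \<alpha> \<tau>"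
  unfolding ellis_iso_def
  using someI[of "\<lambda>\<sigma>. \<sigma> \<in> Gal \<and> path_rep \<sigma> = path_rep \<tau>" \<tau>] path_rep_eq_iff_arboreal_rep_eq by blast

lemma carrier_arboreal_image: "carrier (arboreal_image f \<alpha>) = arboreal_rep f \<alpha> ` Gal"
  by (simp add: arboreal_image_def)

lemma bij_betw_ellis_iso: "bij_betw ellis_iso E (arboreal_rep f \<alpha> ` Gal)"
proof (rule bij_betw_imageI)
  show "inj_on ellis_iso E"
    by (auto simp: inj_on_def E_def ellis_iso_path_rep path_rep_eq_iff_arboreal_rep_eq)
  show "ellis_iso ` E = arboreal_rep f \<alpha> ` Gal"
    by (simp add: E_def image_image ellis_iso_path_rep cong: image_cong)
qed

lemma ellis_iso_iso: "ellis_iso \<in> iso ellis (arboreal_image f \<alpha>)"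
proof -
  interpret Q: group_hom abs_galois_group "BijGroup P" path_rep by (rule path_rep_hom)
  interpret A: group_hom abs_galois_group "BijGroup (tree_vertices f \<alpha>)" "arboreal_rep f \<alpha>"
    by (rule arboreal_rep_hom)
  have "ellis_iso \<in> hom ellis (arboreal_image f \<alpha>)"
    unfolding hom_def carrier_ellis carrier_arboreal_image
  proof (intro CollectI conjI ballI)
    show "ellis_iso \<in> E \<rightarrow> arboreal_rep f \<alpha> ` Gal" using bij_betw_ellis_iso by (auto simp: bij_betw_def)
    fix g h assume "g \<in> E" "h \<in> E"
    then obtain \<sigma> \<tau> where st: "\<sigma> \<in> Gal" "g = path_rep \<sigma>" "\<tau> \<in> Gal" "h = path_rep \<tau>"
      by (auto simp: E_def)
    have "g \<otimes>\<^bsub>ellis\<^esub> h = path_rep (\<sigma> \<otimes>\<^bsub>abs_galois_group\<^esub> \<tau>)"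
      using st by (simp add: ellis_eq)
    then have "ellis_iso (g \<otimes>\<^bsub>ellis\<^esub> h) = arboreal_rep f \<alpha> (\<sigma> \<otimes>\<^bsub>abs_galois_group\<^esub> \<tau>)"
      using st ellis_iso_path_rep[of "\<sigma> \<otimes>\<^bsub>abs_galois_group\<^esub> \<tau>"] by (simp del: Q.hom_mult A.hom_mult)
    also have "\<dots> = ellis_iso g \<otimes>\<^bsub>arboreal_image f \<alpha>\<^esub> ellis_iso h"
      using st by (simp add: ellis_iso_path_rep arboreal_image_def tree_aut_def rooted_aut_group_def)
    finally show "ellis_iso (g \<otimes>\<^bsub>ellis\<^esub> h) = ellis_iso g \<otimes>\<^bsub>arboreal_image f \<alpha>\<^esub> ellis_iso h" .
  qed
  then show ?thesis
    using bij_betw_ellis_iso by (simp add: iso_def carrier_ellis carrier_arboreal_image)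
qed

lemma ellis_iso_homeomorphic: "homeomorphic_map ellis_top (arboreal_topology f \<alpha>) ellis_iso"
proof (rule level_topology_homeomorphic_map[OF level_topology_ellis])
  show "level_topology (arboreal_topology f \<alpha>) (\<lambda>k \<sigma>. restrict \<sigma> (subtree_vertices f \<alpha> k))"
    unfolding arboreal_topology_def tree_aut_topology_def
    by (intro level_topology_subtopology level_topology_pullback[OF level_topology_product])
  have "topspace (arboreal_topology f \<alpha>) = arboreal_rep f \<alpha> ` Gal"
    using arboreal_rep_mem_topspace by (auto simp: arboreal_topology_def carrier_arboreal_image)
  then show "bij_betw ellis_iso (topspace ellis_top) (topspace (arboreal_topology f \<alpha>))"
    using bij_betw_ellis_iso by (simp add: topspace_ellis)
  fix n g h assume "g \<in> topspace ellis_top" "h \<in> topspace ellis_top"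
  then obtain \<sigma> \<tau> where st: "\<sigma> \<in> Gal" "g = path_rep \<sigma>" "\<tau> \<in> Gal" "h = path_rep \<tau>"
    by (auto simp: E_def topspace_ellis)
  have "agree level n g h \<longleftrightarrow> (\<forall>k\<le>n. \<forall>p\<in>P. path_rep \<sigma> p k = path_rep \<tau> p k)"
    unfolding agree_restrict_iff st by blast
  also have "\<dots> \<longleftrightarrow> (\<forall>k\<le>n. \<forall>x\<in>V k. \<sigma> x = \<tau> x)" by (simp only: path_rep_eq_iff)
  also have "\<dots> \<longleftrightarrow> agree (\<lambda>k \<sigma>. restrict \<sigma> (subtree_vertices f \<alpha> k)) n (ellis_iso g) (ellis_iso h)"
    unfolding agree_def st ellis_iso_path_rep[OF st(1)] ellis_iso_path_rep[OF st(3)] arboreal_rep_eq_iff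
    \<comment> \<open>The right side quantifies over heights up to \<open>n\<close> and over levels
      up to each height; the two bounds collapse into one.\<close>
    by (meson le_trans order_refl)
  finally show "agree (\<lambda>k \<sigma>. restrict \<sigma> (subtree_vertices f \<alpha> k)) n (ellis_iso g) (ellis_iso h) \<longleftrightarrow> agree level n g h"
    by blast
qed

lemma path_act_ellis_iso: "g \<in> E \<Longrightarrow> p \<in> P \<Longrightarrow> path_act (ellis_iso g) p = g p"
  by (auto simp: E_def ellis_iso_path_rep path_act_def arboreal_rep_def path_rep_apply tree_vertices_iff P_in_V)

section \<open>The chain of vertex stabilizers\<close>

text \<open>For \<open>x\<close> in \<open>V n\<close> this is a left coset of the stabilizer of
  \<open>v n\<close>, otherwise it is empty. Labelling cosets by vertices turns coset computations
  into evaluation at \<open>v\<close>.\<close>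

definition coset :: "nat \<Rightarrow> 'k alg_closure \<Rightarrow> ((nat \<Rightarrow> 'k alg_closure) \<Rightarrow> (nat \<Rightarrow> 'k alg_closure)) set" where
  "coset n x = {g \<in> carrier G. g v n = x}"

abbreviation C where "C n \<equiv> coset n (v n)"

lemma subgroup_C: "subgroup (C n) G"
proof
  show "C n \<subseteq> carrier G" by (auto simp: coset_def)
  show "\<one>\<^bsub>G\<^esub> \<in> C n" using v by (simp add: coset_def) (simp add: one_G)
  show mult: "g \<otimes>\<^bsub>G\<^esub> h \<in> C n" if "g \<in> C n" "h \<in> C n" for g h
    using that E_level_eq_iff[OF G_subset_E G_v v, of g h n] by (simp add: coset_def mult_G_v)
  show "inv\<^bsub>G\<^esub> g \<in> C n" if "g \<in> C n" for g
  proof -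
    have g: "g \<in> carrier G" "g v n = v n" using that by (simp_all add: coset_def)
    have "g ((inv\<^bsub>G\<^esub> g) v) = v"
      using mult_G_v[of g "inv\<^bsub>G\<^esub> g"] g(1) v by (simp add: one_G)
    then have "g ((inv\<^bsub>G\<^esub> g) v) n = g v n" using g(2) by simp
    then show ?thesis
      using E_level_eq_iff[OF G_subset_E[OF g(1)] G_v v, of "inv\<^bsub>G\<^esub> g" n] g by (simp add: coset_def)
  qed
qed

text \<open>Two elements lie in the same coset exactly if they move \<open>v n\<close> to the same
  vertex: then the inverse of one times the other fixes \<open>v n\<close>.\<close>

lemma l_coset_C: "g \<in> carrier G \<Longrightarrow> g <#\<^bsub>G\<^esub> C n = coset n (g v n)"
proof (intro equalityI subsetI)
  fix k assume g: "g \<in> carrier G" and "k \<in> g <#\<^bsub>G\<^esub> C n"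
  then obtain h where h: "h \<in> C n" "k = g \<otimes>\<^bsub>G\<^esub> h" by (auto simp: l_coset_def)
  then have "h \<in> carrier G" "h v n = v n" by (simp_all add: coset_def)
  then show "k \<in> coset n (g v n)"
    using g h(2) E_level_eq_iff[OF G_subset_E[OF g] G_v v] by (simp add: coset_def mult_G_v)
next
  fix k assume g: "g \<in> carrier G" and "k \<in> coset n (g v n)"
  then have k: "k \<in> carrier G" "k v n = g v n" by (simp_all add: coset_def)
  let ?h = "inv\<^bsub>G\<^esub> g \<otimes>\<^bsub>G\<^esub> k"
  have h: "?h \<in> carrier G" using g k(1) by simp
  have eq: "k = g \<otimes>\<^bsub>G\<^esub> ?h" using g k(1) by (simp flip: G.m_assoc)
  then have "k v = g (?h v)" using mult_G_v[OF g h] by simp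
  then have "?h v n = v n" using E_level_eq_iff[OF G_subset_E[OF g] G_v[OF h] v, of n] k(2) by simp
  then show "k \<in> g <#\<^bsub>G\<^esub> C n" using eq h by (auto simp: l_coset_def coset_def)
qed

lemma coset_inj: "x \<in> V n \<Longrightarrow> coset n x = coset n y \<Longrightarrow> x = y"
  using G_transitive[of x n] by (auto simp: coset_def)

lemma lcosets_C: "lcosets\<^bsub>G\<^esub> (C n) = coset n ` V n"
proof -
  have "lcosets\<^bsub>G\<^esub> (C n) = (\<lambda>g. coset n (g v n)) ` carrier G"
    by (auto simp: LCOSETS_def l_coset_C)
  also have "\<dots> = coset n ` V n"
  proof (intro equalityI subsetI)
    fix K assume "K \<in> coset n ` V n"
    then obtain x where "x \<in> V n" "K = coset n x" by blast
    moreover from this obtain g where "g \<in> carrier G" "g v n = x" using G_transitive by blast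
    ultimately show "K \<in> (\<lambda>g. coset n (g v n)) ` carrier G" by blast
  qed (use P_in_V[OF G_v] in auto)
  finally show ?thesis .
qed

lemma group_chain_C: "group_chain G C"
  unfolding group_chain_def
proof (intro conjI allI subgroup_C)
  show "C 0 = carrier G" using V_0 P_in_V[OF v, of 0] P_in_V[OF G_v, of _ 0] by (auto simp: coset_def)
  show "finite (lcosets\<^bsub>G\<^esub> (C n))" for n by (simp add: lcosets_C finite_V)
  fix n
  have step: "g v n = v n" if "g \<in> carrier G" "F (g v (Suc n)) = v n" for g
    using P_F[OF G_v[OF that(1)]] that(2) by simp
  \<comment> \<open>A sibling of \<open>v (Suc n)\<close>. An element moving
    \<open>v (Suc n)\<close> to \<open>c\<close> still fixes the common parent \<open>v n\<close>,
    so it lies in \<open>C n\<close> but not in \<open>C (Suc n)\<close>.\<close>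
  obtain c where c: "F c = v n" "c \<noteq> v (Suc n)" using other_preimage[OF P_in_V[OF v]] by blast
  then have "c \<in> V (Suc n)" using P_in_V[OF v] by (simp add: mem_V_Suc_iff)
  then obtain g where "g \<in> carrier G" "g v (Suc n) = c" using G_transitive by blast
  then have "g \<in> C n - C (Suc n)" using c step by (simp add: coset_def)
  moreover have "C (Suc n) \<subseteq> C n" using step P_F[OF v] by (auto simp: coset_def)
  ultimately show "C (Suc n) \<subset> C n" by blast
qed

definition path_cosets :: "(nat \<Rightarrow> 'k alg_closure) \<Rightarrow> nat \<Rightarrow> ((nat \<Rightarrow> 'k alg_closure) \<Rightarrow> (nat \<Rightarrow> 'k alg_closure)) set" where
  "path_cosets p = (\<lambda>n. coset n (p n))"

lemma path_cosets_eq_iff: "p \<in> P \<Longrightarrow> path_cosets p n = path_cosets q n \<longleftrightarrow> p n = q n"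
  using coset_inj[OF P_in_V] by (auto simp: path_cosets_def)

abbreviation L where "L \<equiv> chain_limit_set G C"

lemma path_cosets_image: "path_cosets ` P = L"
proof (intro equalityI subsetI)
  fix u assume "u \<in> path_cosets ` P"
  then obtain p where p: "p \<in> P" "u = path_cosets p" by blast
  have "\<exists>g\<in>carrier G. u (Suc n) = g <#\<^bsub>G\<^esub> C (Suc n) \<and> u n = g <#\<^bsub>G\<^esub> C n" for n
  proof -
    \<comment> \<open>An element that carries \<open>v\<close> to \<open>p\<close> at level
      \<open>Suc n\<close> does so at level \<open>n\<close> too, hence represents both
      cosets.\<close>
    obtain g where g: "g \<in> carrier G" "g v (Suc n) = p (Suc n)" using G_transitive[OF P_in_V[OF p(1)]] by blast
    then have "g v n = p n" using P_F[OF G_v[OF g(1)]] P_F[OF p(1)] by metis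
    then show ?thesis using g p(2) by (intro bexI[of _ g]) (simp_all add: l_coset_C path_cosets_def)
  qed
  then show "u \<in> L" using p P_in_V by (auto simp: chain_limit_set_def lcosets_C path_cosets_def)
next
  fix u assume u: "u \<in> L"
  then have "\<exists>x\<in>V n. u n = coset n x" for n by (simp add: chain_limit_set_def lcosets_C image_iff)
  then obtain p where p: "\<And>n. p n \<in> V n" "\<And>n. u n = coset n (p n)" by metis
  have "F (p (Suc n)) = p n" for n
  proof -
    obtain g where g: "g \<in> carrier G" "u (Suc n) = g <#\<^bsub>G\<^esub> C (Suc n)" "u n = g <#\<^bsub>G\<^esub> C n"
      using u unfolding chain_limit_set_def by blast
    then have "p (Suc n) = g v (Suc n)" "p n = g v n"
      using p(2) coset_inj[OF p(1)[of "Suc n"], of "g v (Suc n)"] coset_inj[OF p(1)[of n], of "g v n"]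
      by (simp_all add: l_coset_C)
    then show ?thesis using P_F[OF G_v[OF g(1)]] by simp
  qed
  then have "p \<in> P" using p(1) by (simp add: mem_P_iff)
  moreover have "u = path_cosets p" using p(2) by (auto simp: path_cosets_def)
  ultimately show "u \<in> path_cosets ` P" by blast
qed

lemma bij_betw_path_cosets: "bij_betw path_cosets P L"
proof (rule bij_betw_imageI[OF _ path_cosets_image])
  show "inj_on path_cosets P" by (intro inj_onI ext) (metis path_cosets_eq_iff)
qed

lemma topspace_chain_limit: "topspace (chain_limit G C) = L"
  by (auto simp: chain_limit_def chain_limit_set_def PiE_iff)

lemma level_topology_chain_limit: "level_topology (chain_limit G C) (\<lambda>k u. u k)"
  unfolding chain_limit_def by (intro level_topology_subtopology level_topology_product)

definition limit_path :: "(nat \<Rightarrow> ((nat \<Rightarrow> 'k alg_closure) \<Rightarrow> (nat \<Rightarrow> 'k alg_closure)) set) \<Rightarrow> nat \<Rightarrow> 'k alg_closure" where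
  "limit_path = inv_into P path_cosets"

lemma limit_path_path_cosets: "p \<in> P \<Longrightarrow> limit_path (path_cosets p) = p"
  using bij_betw_path_cosets by (simp add: limit_path_def bij_betw_def)

lemma path_cosets_mem: "p \<in> P \<Longrightarrow> path_cosets p \<in> L"
  using path_cosets_image by blast

lemma mem_L_E: assumes "u \<in> L" obtains p where "p \<in> P" "u = path_cosets p"
  using assms path_cosets_image by blast

lemma homeomorphic_limit_path: "homeomorphic_map (chain_limit G C) (path_space f \<alpha>) limit_path"
proof (rule level_topology_homeomorphic_map[OF level_topology_chain_limit level_topology_path_space])
  show "bij_betw limit_path (topspace (chain_limit G C)) (topspace (path_space f \<alpha>))"
    unfolding limit_path_def topspace_chain_limit topspace_path_space
    using bij_betw_path_cosets by (rule bij_betw_inv_into)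
  fix n u w assume "u \<in> topspace (chain_limit G C)" "w \<in> topspace (chain_limit G C)"
  then obtain p q where "p \<in> P" "u = path_cosets p" "q \<in> P" "w = path_cosets q"
    unfolding topspace_chain_limit using mem_L_E by metis
  then show "agree (\<lambda>k u. u k) n (limit_path u) (limit_path w) \<longleftrightarrow> agree (\<lambda>k u. u k) n u w"
    by (simp add: agree_def limit_path_path_cosets path_cosets_eq_iff)
qed

lemma limit_path_base: "limit_path (\<lambda>n. \<one>\<^bsub>G\<^esub> <#\<^bsub>G\<^esub> C n) = v"
proof -
  have "(\<lambda>n. \<one>\<^bsub>G\<^esub> <#\<^bsub>G\<^esub> C n) = path_cosets v"
    using v by (simp add: l_coset_C path_cosets_def) (simp add: one_G)
  then show ?thesis by (simp add: limit_path_path_cosets v)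
qed

text \<open>The action on paths, transported to coset sequences. Equivariance is thus built in, and
  what has to be shown is that elements of \<open>G\<close> act by left multiplication.\<close>

definition chain_act where "chain_act g = (\<lambda>u\<in>L. path_cosets (g (limit_path u)))"

lemma chain_act_path_cosets: "p \<in> P \<Longrightarrow> chain_act g (path_cosets p) = path_cosets (g p)"
  by (simp add: chain_act_def path_cosets_mem limit_path_path_cosets)

lemma chain_act_hom: "group_action ellis L chain_act"
  unfolding group_action_def group_hom_def group_hom_axioms_def hom_def
proof (intro conjI group_ellis group_BijGroup CollectI ballI funcsetI)
  have bij: "chain_act g \<in> Bij L" if "g \<in> E" for g
  proof -
    have "bij_betw (path_cosets \<circ> (g \<circ> limit_path)) L L"
      using bij_betw_inv_into[OF bij_betw_path_cosets] bij_betw_path_cosets E_Bij[OF that]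
      unfolding limit_path_def Bij_def by (blast intro: bij_betw_trans)
    then show ?thesis by (simp add: chain_act_def Bij_def o_def cong: bij_betw_cong)
  qed
  show "chain_act g \<in> carrier (BijGroup L)" if "g \<in> carrier ellis" for g
    using that bij by (simp add: carrier_ellis BijGroup_def)
  fix g h assume "g \<in> carrier ellis" "h \<in> carrier ellis"
  then have gh: "g \<in> E" "h \<in> E" by (simp_all add: carrier_ellis)
  have "chain_act (compose P g h) = compose L (chain_act g) (chain_act h)"
  proof (rule extensionalityI[of _ L])
    fix u assume "u \<in> L"
    then obtain p where "p \<in> P" "u = path_cosets p" by (rule mem_L_E)
    then show "chain_act (compose P g h) u = compose L (chain_act g) (chain_act h) u"
      using E_P[OF gh(2)] by (simp add: compose_eq path_cosets_mem chain_act_path_cosets)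
  qed (simp_all add: chain_act_def)
  then show "chain_act (g \<otimes>\<^bsub>ellis\<^esub> h) = chain_act g \<otimes>\<^bsub>BijGroup L\<^esub> chain_act h"
    using gh bij by (simp add: mult_ellis BijGroup_def)
qed

lemma chain_act_continuous:
  "continuous_map (prod_topology ellis_top (chain_limit G C)) (chain_limit G C) (\<lambda>(g, u). chain_act g u)"
proof (rule level_topology_continuous_map[OF level_topology_prod[OF level_topology_ellis level_topology_chain_limit]
      level_topology_chain_limit])
  have top: "topspace (prod_topology ellis_top (chain_limit G C)) = E \<times> L"
    by (simp add: topspace_ellis topspace_chain_limit)
  show "(\<lambda>(g, u). chain_act g u) \<in> topspace (prod_topology ellis_top (chain_limit G C)) \<rightarrow> topspace (chain_limit G C)"
    unfolding top topspace_chain_limit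
    using E_P by (auto simp: chain_act_path_cosets intro!: path_cosets_mem elim!: mem_L_E)
  fix n
  have key: "agree (\<lambda>k u. u k) n (chain_act g u) (chain_act h w)"
    if gu: "g \<in> E" "u \<in> L" "h \<in> E" "w \<in> L" and a: "agree level n g h" "agree (\<lambda>k u. u k) n u w" for g u h w
  proof -
    obtain p q where pq: "p \<in> P" "u = path_cosets p" "q \<in> P" "w = path_cosets q"
      using gu mem_L_E by metis
    \<comment> \<open>Both arguments vary, so the comparison passes through \<open>h p k\<close>:
      \<open>h\<close> respects levels, and \<open>g\<close> and \<open>h\<close> agree uniformly on
      paths.\<close>
    have "g p k = h q k" if "k \<le> n" for k
    proof -
      have "p k = q k" using a(2) that pq by (simp add: agree_def path_cosets_eq_iff)
      then have "h p k = h q k" using E_level_eq_iff gu(3) pq by blast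
      moreover have "g p k = h p k" using a(1) that pq(1) by (simp add: agree_restrict_iff)
      ultimately show ?thesis by simp
    qed
    then show ?thesis using pq E_P gu by (simp add: agree_def chain_act_path_cosets path_cosets_eq_iff)
  qed
  show "\<exists>m. \<forall>x\<in>topspace (prod_topology ellis_top (chain_limit G C)).
      \<forall>y\<in>topspace (prod_topology ellis_top (chain_limit G C)).
      agree (\<lambda>k p. (level k (fst p), snd p k)) m x y \<longrightarrow>
      agree (\<lambda>k u. u k) n (case x of (g, u) \<Rightarrow> chain_act g u) (case y of (g, u) \<Rightarrow> chain_act g u)"
    unfolding top
  proof (intro exI[of _ n] ballI impI)
    fix x y assume xy: "x \<in> E \<times> L" "y \<in> E \<times> L" and a: "agree (\<lambda>k p. (level k (fst p), snd p k)) n x y"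
    obtain g u h w where eq: "x = (g, u)" "y = (h, w)" by (cases x, cases y)
    have "agree level n g h" "agree (\<lambda>k u. u k) n u w"
      using a unfolding agree_def eq by simp_all
    then show "agree (\<lambda>k u. u k) n (case x of (g, u) \<Rightarrow> chain_act g u) (case y of (g, u) \<Rightarrow> chain_act g u)"
      using key[of g u h w] xy unfolding eq by simp
  qed
qed

lemma chain_act_left_mult:
  assumes h: "h \<in> carrier G" and u: "u \<in> L"
  shows "chain_act h u = (\<lambda>n. h <#\<^bsub>G\<^esub> u n)"
proof
  fix n
  obtain p where p: "p \<in> P" "u = path_cosets p" using u by (rule mem_L_E)
  \<comment> \<open>A representative of the coset \<open>u n\<close>. Left multiplication by
    \<open>h\<close> gives the coset labelled by \<open>h (g v) n\<close>, which equals
    \<open>h p n\<close> because \<open>g v\<close> and \<open>p\<close> agree at level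
    \<open>n\<close>.\<close>
  obtain g where g: "g \<in> carrier G" "g v n = p n" using G_transitive[OF P_in_V[OF p(1)]] by blast
  have "h <#\<^bsub>G\<^esub> u n = h <#\<^bsub>G\<^esub> (g <#\<^bsub>G\<^esub> C n)" using g p(2) by (simp add: l_coset_C path_cosets_def)
  also have "\<dots> = (h \<otimes>\<^bsub>G\<^esub> g) <#\<^bsub>G\<^esub> C n"
    using h g(1) subgroup.subset[OF subgroup_C] by (intro G.lcos_m_assoc)
  also have "\<dots> = coset n (h (g v) n)" using h g(1) by (simp add: l_coset_C mult_G_v)
  also have "h (g v) n = h p n"
    using E_level_eq_iff[OF G_subset_E[OF h] G_v[OF g(1)] p(1)] g(2) by blast
  finally show "chain_act h u n = h <#\<^bsub>G\<^esub> u n"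
    using p by (simp add: chain_act_path_cosets) (simp add: path_cosets_def)
qed

lemma ellis_chain_action_chain_act: "ellis_chain_action \<mu> G (\<lambda>g. g) C chain_act"
  unfolding ellis_chain_action_def topspace_chain_limit
  using chain_act_hom chain_act_continuous chain_act_left_mult by blast

text \<open>The Cantor property is established for the path space, so it is carried over against the
  direction of \<open>limit_path\<close>.\<close>

lemma cantor_space_chain_limit: "cantor_space (chain_limit G C)"
proof -
  have "path_space f \<alpha> homeomorphic_space chain_limit G C"
    using homeomorphic_limit_path homeomorphic_map_imp_homeomorphic_space homeomorphic_space_sym by blast
  then obtain h where "homeomorphic_map (path_space f \<alpha>) (chain_limit G C) h"
    unfolding homeomorphic_space by blast
  then show ?thesis using cantor_space_path_space v by (blast intro: cantor_space_homeomorphic)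
qed

lemma limit_path_equivariant:
  assumes "u \<in> L" "g \<in> E" shows "path_act (ellis_iso g) (limit_path u) = limit_path (chain_act g u)"
  using assms(1)
proof (rule mem_L_E)
  fix p assume "p \<in> P" "u = path_cosets p"
  then show ?thesis
    using assms(2) E_P by (simp add: limit_path_path_cosets chain_act_path_cosets path_act_ellis_iso)
qed

end

theorem theorem1p7:
  fixes f :: "'k::field poly" and \<alpha> :: 'k and d :: nat and v :: "nat \<Rightarrow> 'k alg_closure"
  assumes "Polynomial.degree f = d" and "d \<ge> 2"
    and "\<And>n. n \<ge> 1 \<Longrightarrow> card {x. poly (map_poly to_ac (poly_iter f n - [:\<alpha>:])) x = 0} = d ^ n"
    and "\<And>n. n \<ge> 1 \<Longrightarrow> Factorial_Ring.irreducible (poly_iter f n - [:\<alpha>:])"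
    and "v \<in> tree_paths f \<alpha>"
  shows "\<exists>(G :: ((nat \<Rightarrow> 'k alg_closure) \<Rightarrow> (nat \<Rightarrow> 'k alg_closure)) monoid) \<Phi>.
    group G \<and> countably_generated G \<and>
    \<Phi> \<in> hom G (homeo_group (path_space f \<alpha>)) \<and>
    equicontinuous_action (path_metric f \<alpha>) G \<Phi> \<and>
    (\<exists>\<phi>'.
      \<phi>' \<in> iso (ellis_group (path_metric f \<alpha>) G \<Phi>) (arboreal_image f \<alpha>) \<and>
      homeomorphic_map (ellis_topology (path_metric f \<alpha>) G \<Phi>) (arboreal_topology f \<alpha>) \<phi>' \<and>
      (\<exists>C \<phi> act.
        group_chain G C \<and>
        cantor_space (chain_limit G C) \<and> cantor_space (path_space f \<alpha>) \<and>
        homeomorphic_map (chain_limit G C) (path_space f \<alpha>) \<phi> \<and>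
        \<phi> (\<lambda>n. \<one>\<^bsub>G\<^esub> <#\<^bsub>G\<^esub> C n) = v \<and>
        ellis_chain_action (path_metric f \<alpha>) G \<Phi> C act \<and>
        (\<forall>u\<in>topspace (chain_limit G C). \<forall>g\<in>carrier (ellis_group (path_metric f \<alpha>) G \<Phi>).
          path_act (\<phi>' g) (\<phi> u) = \<phi> (act g u))))"
proof -
  interpret T: preimage_tree f \<alpha> d using assms(1-4) by unfold_locales
  obtain S where S: "countable S" "S \<subseteq> T.E" "\<And>g n. g \<in> T.E \<Longrightarrow> \<exists>h\<in>S. \<forall>p\<in>tree_paths f \<alpha>. g p n = h p n"
    by (rule T.E_countable_dense) blast
  interpret A: preimage_tree_group f \<alpha> d S v
    using S(2,3) assms(5) by unfold_locales
  show ?thesis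
    using A.group_G A.countably_generated_G[OF S(1)] A.hom_G A.equicontinuous_G
      A.ellis_iso_iso A.ellis_iso_homeomorphic A.group_chain_C A.cantor_space_chain_limit
      T.cantor_space_path_space assms(5) A.homeomorphic_limit_path A.limit_path_base
      A.ellis_chain_action_chain_act A.limit_path_equivariant
    unfolding A.topspace_chain_limit[symmetric] A.carrier_ellis[symmetric]
    by (intro exI[of _ A.G] exI[of _ "\<lambda>g. g"] conjI exI[of _ A.ellis_iso] exI[of _ A.C]
        exI[of _ A.limit_path] exI[of _ A.chain_act]) blast+
qed

end
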